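(* Let $(M,g)$ be a conformally flat homogeneous four-dimensional pseudo-Riemannian manifold (of Lorentzian or neutral signature) with non-degenerate Ricci operator. Then $(M,g)$ does not admit any left-invariant Walker structure.
   Context: Conventions. $(M,g)$ is a pseudo-Riemannian manifold with Levi-Civita connection $\nabla$, curvature $R(X,Y)=[\nabla_X,\nabla_Y]-\nabla_{[X,Y]}$, Ricci tensor $\varrho(X,Y)=\sum_i\varepsilon_i\,g(R(e_i,X)Y,e_i)$ for a pseudo-orthonormal basis $\{e_i\}$ with $\varepsilon_i=g(e_i,e_i)=\pm1$, and Ricci operator $Q$ defined by $g(QX,Y)=\varrho(X,Y)$. The signature is either Lorentzian $(3,1)$ or neutral $(2,2)$. $(M,g)$ is (locally) homogeneous: for any two points $p,p'$ there is a local isometry between neighbourhoods of $p$ and $p'$ mapping $p$ to $p'$. Hence the Segre type (Jordan structure) of $Q$ is the same at all points. Non-degenerate Ricci operator: distinct Jordan blocks of $Q$ (over $\mathbb C$) have distinct eigenvalues, i.e. no eigenvalue belongs to two different Jordan blocks; otherwise $Q$ is called degenerate. Left-invariance: for a conformally flat homogeneous four-manifold with non-degenerate Ricci operator the isotropy Lie algebra at each point is trivial, so $(M,g)$ is locally isometric to a four-dimensional Lie group $G$ with a left-invariant pseudo-Riemannian metric. "Left-invariant" refers to this Lie group; a left-invariant distribution is one spanned by left-invariant vector fields, i.e. determined by a linear subspace of the Lie algebra of $G$. Walker structure: a Walker structure is a parallel degenerate (null) distribution. A left-invariant Walker structure on $(M,g)$ is a left-invariant distribution $\mathcal D$ of rank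 $1$ (null line field) or rank $2$ (null plane field) such that $g$ vanishes identically on $\mathcal D$ and $\nabla_X Y\in\mathcal D$ for every vector field $X$ and every section $Y$ of $\mathcal D$. *)

theory Defs
  imports "HOL-Analysis.Analysis" "HOL-Algebra.Group" "Jordan_Normal_Form.Jordan_Normal_Form"
begin

no_notation Matrix.vec_index (infixl "$" 100)
no_notation Matrix.scalar_prod (infix "\<bullet>" 70)


section \<open>Smooth functions and smooth manifolds\<close>

text \<open>\<open>ck_on k S f\<close> and \<open>smooth_on S f\<close> are only meant for open sets \<open>S\<close>.\<close>

primrec ck_on ::
  "nat \<Rightarrow> 'a::euclidean_space set \<Rightarrow> ('a \<Rightarrow> 'b::real_normed_vector) \<Rightarrow> bool" where
  "ck_on 0 S f \<longleftrightarrow> continuous_on S f"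
| "ck_on (Suc k) S f \<longleftrightarrow>
     f differentiable_on S \<and> (\<forall>v. ck_on k S (\<lambda>x. frechet_derivative f (at x) v))"

definition smooth_on :: "'a::euclidean_space set \<Rightarrow> ('a \<Rightarrow> 'b::real_normed_vector) \<Rightarrow> bool" where
  "smooth_on S f \<longleftrightarrow> (\<forall>k. ck_on k S f)"

text \<open>A manifold is a whole type \<open>'m\<close> (Hausdorff and second countable by its sort) together with
  a smooth atlas, which need not be maximal. A chart is a pair of its domain and its coordinate
  map.\<close>

type_synonym ('m, 'n) chart = "'m set \<times> ('m \<Rightarrow> real ^ 'n)"

abbreviation chart_inv :: "('m, 'n::finite) chart \<Rightarrow> real ^ 'n \<Rightarrow> 'm" where
  "chart_inv c \<equiv> inv_into (fst c) (snd c)"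

abbreviation chart_image :: "('m, 'n::finite) chart \<Rightarrow> (real ^ 'n) set" where
  "chart_image c \<equiv> snd c ` fst c"

definition is_chart :: "('m::topological_space, 'n::finite) chart \<Rightarrow> bool" where
  "is_chart c \<longleftrightarrow> open (fst c) \<and> open (chart_image c) \<and>
     homeomorphism (fst c) (chart_image c) (snd c) (chart_inv c)"

definition local_rep :: "('m \<Rightarrow> 'k) \<Rightarrow> ('m, 'n::finite) chart \<Rightarrow> ('k, 'l::finite) chart \<Rightarrow>
    real ^ 'n \<Rightarrow> real ^ 'l" where
  "local_rep F c d = snd d \<circ> F \<circ> chart_inv c"

definition differential :: "('m \<Rightarrow> 'k) \<Rightarrow> ('m, 'n::finite) chart \<Rightarrow> ('k, 'l::finite) chart \<Rightarrow>
    'm \<Rightarrow> real ^ 'n \<Rightarrow> real ^ 'l" where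
  "differential F c d p = frechet_derivative (local_rep F c d) (at (snd c p))"

definition smooth_atlas ::
  "('m::{t2_space,second_countable_topology}, 'n::finite) chart set \<Rightarrow> bool" where
  "smooth_atlas A \<longleftrightarrow> (\<forall>c\<in>A. is_chart c) \<and> (\<Union>c\<in>A. fst c) = UNIV \<and>
     (\<forall>c\<in>A. \<forall>d\<in>A. smooth_on (snd c ` (fst c \<inter> fst d)) (local_rep id c d))"

definition smooth_map ::
  "('m::topological_space, 'n::finite) chart set \<Rightarrow> ('k::topological_space, 'l::finite) chart set \<Rightarrow>
    'm set \<Rightarrow> ('m \<Rightarrow> 'k) \<Rightarrow> bool" where
  "smooth_map A B W F \<longleftrightarrow> continuous_on W F \<and>
     (\<forall>c\<in>A. \<forall>d\<in>B. smooth_on (snd c ` (W \<inter> fst c \<inter> F -` fst d)) (local_rep F c d))"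

definition diffeomorphism_on ::
  "('m::topological_space, 'n::finite) chart set \<Rightarrow> ('k::topological_space, 'l::finite) chart set \<Rightarrow>
    'm set \<Rightarrow> ('m \<Rightarrow> 'k) \<Rightarrow> bool" where
  "diffeomorphism_on A B W F \<longleftrightarrow> open W \<and> open (F ` W) \<and> inj_on F W \<and>
     smooth_map A B W F \<and> smooth_map B A (F ` W) (inv_into W F)"


section \<open>Pseudo-Riemannian metrics\<close>

text \<open>Tensor fields are given by their components in the charts of the atlas, as functions of the
  coordinates: in the chart \<open>c\<close> a metric is a matrix-valued function on \<open>chart_image c\<close> and a vector
  field is a vector-valued one. The values outside \<open>chart_image c\<close> are irrelevant.\<close>

type_synonym ('m, 'n) metric = "('m, 'n) chart \<Rightarrow> real ^ 'n \<Rightarrow> real ^ 'n ^ 'n"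
type_synonym ('m, 'n) vector_field = "('m, 'n) chart \<Rightarrow> real ^ 'n \<Rightarrow> real ^ 'n"
type_synonym ('m, 'n) distribution = "('m, 'n) chart \<Rightarrow> real ^ 'n \<Rightarrow> (real ^ 'n) set"

definition form :: "real ^ 'n ^ 'n \<Rightarrow> real ^ 'n \<Rightarrow> real ^ 'n \<Rightarrow> real" where
  "form m u v = u \<bullet> (m *v v)"

definition pseudo_riemannian_metric ::
  "('m::{t2_space,second_countable_topology}, 'n::finite) chart set \<Rightarrow> ('m, 'n) metric \<Rightarrow> bool" where
  "pseudo_riemannian_metric A g \<longleftrightarrow>
     (\<forall>c\<in>A. smooth_on (chart_image c) (g c) \<and>
        (\<forall>x\<in>chart_image c. transpose (g c x) = g c x \<and> invertible (g c x))) \<and>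
     (\<forall>c\<in>A. \<forall>d\<in>A. \<forall>p\<in>fst c \<inter> fst d. \<forall>u v.
        form (g d (snd d p)) (differential id c d p u) (differential id c d p v) =
        form (g c (snd c p)) u v)"

text \<open>Such a family is automatically a basis, having \<open>CARD('n)\<close> members.\<close>

definition pseudo_orthonormal_basis :: "real ^ 'n ^ 'n \<Rightarrow> ('n::finite \<Rightarrow> real ^ 'n) \<Rightarrow> bool" where
  "pseudo_orthonormal_basis m e \<longleftrightarrow>
     (\<forall>i. form m (e i) (e i) = 1 \<or> form m (e i) (e i) = -1) \<and>
     (\<forall>i j. i \<noteq> j \<longrightarrow> form m (e i) (e j) = 0)"

text \<open>The number of minus signs; the signature is \<open>(CARD('n) - q, q)\<close>.\<close>

definition metric_index ::
  "('m::topological_space, 'n::finite) chart set \<Rightarrow> ('m, 'n) metric \<Rightarrow> nat \<Rightarrow> bool" where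
  "metric_index A g q \<longleftrightarrow> (\<forall>c\<in>A. \<forall>x\<in>chart_image c. \<exists>e.
     pseudo_orthonormal_basis (g c x) e \<and> card {i. form (g c x) (e i) (e i) = -1} = q)"

definition local_isometry ::
  "('m::topological_space, 'n::finite) chart set \<Rightarrow> ('m, 'n) metric \<Rightarrow>
   ('k::topological_space, 'n) chart set \<Rightarrow> ('k, 'n) metric \<Rightarrow> 'm set \<Rightarrow> ('m \<Rightarrow> 'k) \<Rightarrow> bool" where
  "local_isometry A g B h W F \<longleftrightarrow> diffeomorphism_on A B W F \<and>
     (\<forall>c\<in>A. \<forall>d\<in>B. \<forall>p\<in>W \<inter> fst c. F p \<in> fst d \<longrightarrow> (\<forall>u v.
        form (h d (snd d (F p))) (differential F c d p u) (differential F c d p v) =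
        form (g c (snd c p)) u v))"

definition locally_homogeneous ::
  "('m::topological_space, 'n::finite) chart set \<Rightarrow> ('m, 'n) metric \<Rightarrow> bool" where
  "locally_homogeneous A g \<longleftrightarrow>
     (\<forall>p p'. \<exists>W F. p \<in> W \<and> F p = p' \<and> local_isometry A g A g W F)"

definition locally_isometric ::
  "('m::topological_space, 'n::finite) chart set \<Rightarrow> ('m, 'n) metric \<Rightarrow>
   ('k::topological_space, 'n) chart set \<Rightarrow> ('k, 'n) metric \<Rightarrow> bool" where
  "locally_isometric A g B h \<longleftrightarrow> (\<forall>p. \<exists>W F. p \<in> W \<and> local_isometry A g B h W F)"


section \<open>Levi-Civita connection and curvature\<close>

text \<open>The following notions are formulated in local coordinates: \<open>h\<close> is the component matrix of the
  metric in a chart, and \<open>X\<close>, \<open>Y\<close>, \<open>Z\<close> are the components of vector fields.\<close>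

definition pderiv_at :: "'n::finite \<Rightarrow> (real ^ 'n \<Rightarrow> real) \<Rightarrow> real ^ 'n \<Rightarrow> real" where
  "pderiv_at i f x = frechet_derivative f (at x) (axis i 1)"

definition christoffel ::
  "(real ^ 'n \<Rightarrow> real ^ 'n ^ 'n) \<Rightarrow> real ^ 'n \<Rightarrow> 'n::finite \<Rightarrow> 'n \<Rightarrow> 'n \<Rightarrow> real" where
  "christoffel h x k i j = (1/2) * (\<Sum>l\<in>UNIV. matrix_inv (h x) $ k $ l *
     (pderiv_at i (\<lambda>y. h y $ j $ l) x + pderiv_at j (\<lambda>y. h y $ i $ l) x
        - pderiv_at l (\<lambda>y. h y $ i $ j) x))"

definition covariant_derivative :: "(real ^ 'n \<Rightarrow> real ^ 'n ^ 'n) \<Rightarrow>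
    (real ^ 'n \<Rightarrow> real ^ 'n) \<Rightarrow> (real ^ 'n \<Rightarrow> real ^ 'n) \<Rightarrow> real ^ 'n \<Rightarrow> real ^ 'n::finite" where
  "covariant_derivative h X Y x = frechet_derivative Y (at x) (X x) +
     (\<chi> k. \<Sum>i\<in>UNIV. \<Sum>j\<in>UNIV. christoffel h x k i j * X x $ i * Y x $ j)"

definition lie_bracket ::
  "(real ^ 'n \<Rightarrow> real ^ 'n) \<Rightarrow> (real ^ 'n \<Rightarrow> real ^ 'n) \<Rightarrow> real ^ 'n \<Rightarrow> real ^ 'n::finite" where
  "lie_bracket X Y x = frechet_derivative Y (at x) (X x) - frechet_derivative X (at x) (Y x)"

definition curvature :: "(real ^ 'n \<Rightarrow> real ^ 'n ^ 'n) \<Rightarrow> (real ^ 'n \<Rightarrow> real ^ 'n) \<Rightarrow>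
    (real ^ 'n \<Rightarrow> real ^ 'n) \<Rightarrow> (real ^ 'n \<Rightarrow> real ^ 'n) \<Rightarrow> real ^ 'n \<Rightarrow> real ^ 'n::finite" where
  "curvature h X Y Z x =
     covariant_derivative h X (covariant_derivative h Y Z) x
     - covariant_derivative h Y (covariant_derivative h X Z) x
     - covariant_derivative h (lie_bracket X Y) Z x"

text \<open>Since the curvature is tensorial, its value on tangent vectors may be computed with any
  extension of them to vector fields; we take those with constant coefficients.\<close>

definition curvature_at :: "(real ^ 'n \<Rightarrow> real ^ 'n ^ 'n) \<Rightarrow> real ^ 'n \<Rightarrow>
    real ^ 'n \<Rightarrow> real ^ 'n \<Rightarrow> real ^ 'n \<Rightarrow> real ^ 'n::finite" where
  "curvature_at h x u v w = curvature h (\<lambda>_. u) (\<lambda>_. v) (\<lambda>_. w) x"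

text \<open>The sum does not depend on the choice of the pseudo-orthonormal basis.\<close>

definition ricci ::
  "(real ^ 'n \<Rightarrow> real ^ 'n ^ 'n) \<Rightarrow> real ^ 'n \<Rightarrow> real ^ 'n \<Rightarrow> real ^ 'n::finite \<Rightarrow> real" where
  "ricci h x u v = (let e = (SOME e. pseudo_orthonormal_basis (h x) e) in
     \<Sum>i\<in>UNIV. form (h x) (e i) (e i) * form (h x) (curvature_at h x (e i) u v) (e i))"

definition ricci_operator ::
  "(real ^ 'n \<Rightarrow> real ^ 'n ^ 'n) \<Rightarrow> real ^ 'n::finite \<Rightarrow> real ^ 'n ^ 'n" where
  "ricci_operator h x = (THE Q. \<forall>u v. form (h x) (Q *v u) v = ricci h x u v)"

text \<open>Every point has a neighbourhood on which some positive smooth multiple of the metric is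
  flat.\<close>

definition conformally_flat ::
  "('m::topological_space, 'n::finite) chart set \<Rightarrow> ('m, 'n) metric \<Rightarrow> bool" where
  "conformally_flat A g \<longleftrightarrow> (\<forall>c\<in>A. \<forall>x\<in>chart_image c. \<exists>N f.
     open N \<and> x \<in> N \<and> N \<subseteq> chart_image c \<and> smooth_on N f \<and> (\<forall>y\<in>N. f y > (0::real)) \<and>
     (\<forall>y\<in>N. \<forall>u v w. curvature_at (\<lambda>z. f z *\<^sub>R g c z) y u v w = 0))"

text \<open>The index \<open>of_nat i :: 4\<close> runs through all four elements of the type \<open>4\<close> as \<open>i\<close> runs through
  \<open>0, 1, 2, 3\<close>.\<close>

definition complex_matrix :: "real ^ 4 ^ 4 \<Rightarrow> complex Matrix.mat" where
  "complex_matrix Q = Matrix.mat 4 4 (\<lambda>(i, j). complex_of_real (Q $ of_nat i $ of_nat j))"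

definition nondegenerate_operator :: "real ^ 4 ^ 4 \<Rightarrow> bool" where
  "nondegenerate_operator Q \<longleftrightarrow>
     (\<exists>blocks. jordan_nf (complex_matrix Q) blocks \<and> distinct (map snd blocks))"

definition nondegenerate_ricci_operator ::
  "('m::topological_space, 4) chart set \<Rightarrow> ('m, 4) metric \<Rightarrow> bool" where
  "nondegenerate_ricci_operator A g \<longleftrightarrow>
     (\<forall>c\<in>A. \<forall>x\<in>chart_image c. nondegenerate_operator (ricci_operator (g c) x))"


section \<open>Lie groups and left-invariant Walker structures\<close>

definition lie_group ::
  "'k monoid \<Rightarrow> ('k::{t2_space,second_countable_topology}, 'n::finite) chart set \<Rightarrow> bool" where
  "lie_group G B \<longleftrightarrow> Group.group G \<and> carrier G = UNIV \<and> smooth_atlas B \<and>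
     continuous_on UNIV (\<lambda>(a, b). a \<otimes>\<^bsub>G\<^esub> b) \<and>
     (\<forall>c\<in>B. \<forall>c'\<in>B. \<forall>d\<in>B.
        smooth_on {(snd c a, snd c' b) | a b. a \<in> fst c \<and> b \<in> fst c' \<and> a \<otimes>\<^bsub>G\<^esub> b \<in> fst d}
          (\<lambda>(x, y). snd d (chart_inv c x \<otimes>\<^bsub>G\<^esub> chart_inv c' y))) \<and>
     smooth_map B B UNIV (\<lambda>a. inv\<^bsub>G\<^esub> a)"

definition left_invariant_metric :: "'k monoid \<Rightarrow>
    ('k::{t2_space,second_countable_topology}, 'n::finite) chart set \<Rightarrow> ('k, 'n) metric \<Rightarrow> bool" where
  "left_invariant_metric G B h \<longleftrightarrow> pseudo_riemannian_metric B h \<and>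
     (\<forall>a. local_isometry B h B h UNIV (\<lambda>b. a \<otimes>\<^bsub>G\<^esub> b))"

definition smooth_vector_field ::
  "('m::topological_space, 'n::finite) chart set \<Rightarrow> ('m, 'n) vector_field \<Rightarrow> bool" where
  "smooth_vector_field A X \<longleftrightarrow> (\<forall>c\<in>A. smooth_on (chart_image c) (X c)) \<and>
     (\<forall>c\<in>A. \<forall>d\<in>A. \<forall>p\<in>fst c \<inter> fst d. X d (snd d p) = differential id c d p (X c (snd c p)))"

definition left_invariant_vector_field :: "'k monoid \<Rightarrow>
    ('k::topological_space, 'n::finite) chart set \<Rightarrow> ('k, 'n) vector_field \<Rightarrow> bool" where
  "left_invariant_vector_field G B X \<longleftrightarrow> smooth_vector_field B X \<and>
     (\<forall>a. \<forall>c\<in>B. \<forall>d\<in>B. \<forall>b\<in>fst c. a \<otimes>\<^bsub>G\<^esub> b \<in> fst d \<longrightarrow>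
        X d (snd d (a \<otimes>\<^bsub>G\<^esub> b)) = differential (\<lambda>b. a \<otimes>\<^bsub>G\<^esub> b) c d b (X c (snd c b)))"

definition left_invariant_distribution :: "'k monoid \<Rightarrow>
    ('k::topological_space, 'n::finite) chart set \<Rightarrow> nat \<Rightarrow> ('k, 'n) distribution \<Rightarrow> bool" where
  "left_invariant_distribution G B r D \<longleftrightarrow>
     (\<exists>E :: nat \<Rightarrow> ('k, 'n) vector_field. (\<forall>i<r. left_invariant_vector_field G B (E i)) \<and>
        (\<forall>c\<in>B. \<forall>x\<in>chart_image c. D c x = span ((\<lambda>i. E i c x) ` {..<r}) \<and> dim (D c x) = r))"

definition null_distribution ::
  "('m, 'n::finite) chart set \<Rightarrow> ('m, 'n) metric \<Rightarrow> ('m, 'n) distribution \<Rightarrow> bool" where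
  "null_distribution A g D \<longleftrightarrow>
     (\<forall>c\<in>A. \<forall>x\<in>chart_image c. \<forall>u\<in>D c x. \<forall>v\<in>D c x. form (g c x) u v = 0)"

definition parallel_distribution ::
  "('m::topological_space, 'n::finite) chart set \<Rightarrow> ('m, 'n) metric \<Rightarrow> ('m, 'n) distribution \<Rightarrow>
    bool" where
  "parallel_distribution A g D \<longleftrightarrow>
     (\<forall>X Y. smooth_vector_field A X \<and> smooth_vector_field A Y \<and>
        (\<forall>c\<in>A. \<forall>x\<in>chart_image c. Y c x \<in> D c x) \<longrightarrow>
        (\<forall>c\<in>A. \<forall>x\<in>chart_image c. covariant_derivative (g c) (X c) (Y c) x \<in> D c x))"

definition left_invariant_walker_structure :: "'k monoid \<Rightarrow>
    ('k::topological_space, 'n::finite) chart set \<Rightarrow> ('k, 'n) metric \<Rightarrow> ('k, 'n) distribution \<Rightarrow>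
    bool" where
  "left_invariant_walker_structure G B h D \<longleftrightarrow>
     (left_invariant_distribution G B 1 D \<or> left_invariant_distribution G B 2 D) \<and>
     null_distribution B h D \<and> parallel_distribution B h D"

text \<open>"Left-invariant" refers to a Lie group \<open>G\<close> with left-invariant metric \<open>h\<close> (and atlas \<open>B\<close>) to
  which the manifold is locally isometric.\<close>

definition admits_left_invariant_walker_structure ::
  "('m::{t2_space,second_countable_topology}, 'n::finite) chart set \<Rightarrow> ('m, 'n) metric \<Rightarrow>
   'k monoid \<Rightarrow> ('k::{t2_space,second_countable_topology}, 'n) chart set \<Rightarrow> ('k, 'n) metric \<Rightarrow>
   bool" where
  "admits_left_invariant_walker_structure A g G B h \<longleftrightarrow>
     lie_group G B \<and> left_invariant_metric G B h \<and> locally_isometric A g B h \<and>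
     (\<exists>D. left_invariant_walker_structure G B h D)"

end

theory Submission
  imports Defs "Jordan_Normal_Form.Jordan_Normal_Form_Uniqueness"
begin

text \<open>
  The statement is proved by showing that a left-invariant Walker structure forces some eigenvalue
  of the Ricci operator to have geometric multiplicity at least two over \<open>\<complex>\<close>. Such an
  operator is called derogatory below; two different Jordan blocks then share an eigenvalue, which
  non-degeneracy excludes.

  Conformal flatness means that the curvature is determined by one self-adjoint operator \<open>S\<close>,
  \<open>R(x, y) z = g(y, z) S x - g(x, z) S y + g(S y, z) x - g(S x, z) y\<close>,
  and contraction shows that the Ricci operator is \<open>2 S + t\<close> for a scalar \<open>t\<close>, so that it suffices
  to treat \<open>S\<close> (\<open>conformally_flat_curvature\<close>, \<open>ricci_operator_schouten\<close>,
  \<open>nondegenerate_not_derogatory\<close>).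

  The left-invariant fields of the Lie group have constant inner products and constant structure
  coefficients. Pulled back by a local isometry they give a frame with the same constants on an open
  set of the manifold. By the Koszul formula the Levi-Civita connection is then the same constant
  bilinear product \<open>\<Gamma>\<close> on \<open>\<real>\<^sup>4\<close> in both places, and the whole question becomes one about the tuple
  consisting of the inner product \<open>\<eta>\<close>, the product \<open>\<Gamma>\<close>, the operator \<open>S\<close> and a \<open>\<Gamma>\<close>-invariant null
  subspace \<open>D\<close> (\<open>left_invariant_ext_constant_frame\<close>, \<open>pullback_frame\<close>, \<open>frame_connection\<close>,
  \<open>frame_curvature\<close>).

  A parallel subspace is preserved by all curvature operators. If \<open>D\<close> is a line spanned by \<open>u\<close>, the
  curvature formula gives \<open>S u = l u\<close> and shows that \<open>S + l\<close> maps the three-dimensional space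
  \<open>u\<^sup>\<bottom>\<close> into the line of \<open>u\<close>; hence \<open>S + l\<close> has a kernel of dimension at least two
  (\<open>parallel_null_line_derogatory\<close>).

  If \<open>D\<close> is a plane, the curvature formula gives only that \<open>S\<close> preserves \<open>D\<close> with trace zero, which
  leaves the Segre types with one block for each of the eigenvalues \<open>\<plusminus>\<mu>\<close>, or a single nilpotent block.
  These are excluded by the second Bianchi identity: contracted, it says that \<open>S\<close> is a Codazzi
  tensor. For Codazzi \<open>S\<close>, the restriction of \<open>\<Gamma>\<close> to \<open>D\<close> is so constrained that \<open>\<Gamma> u\<close> vanishes on
  \<open>D\<close> for every \<open>u \<in> D\<close>, unless \<open>S\<close> is derogatory, and this contradicts the curvature formula
  (\<open>codazzi\<close>, \<open>codazzi_curvature_system\<close>, \<open>parallel_plane_normal_form_contradiction\<close>,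
  \<open>parallel_null_plane_derogatory\<close>). The real, complex and nilpotent cases are treated at once, by
  working in a cyclic basis of \<open>D\<close> instead of a Jordan basis.
\<close>

no_notation Matrix.vec_index (infixl "$" 100)
no_notation Matrix.scalar_prod (infix "\<bullet>" 70)

section \<open>Calculus of smooth functions\<close>

text \<open>The simplifier turns sums such as \<open>x + x\<close> into componentwise products with numerals; these rules turn
  them back into scalar multiples.\<close>

lemma vec_times_numeral:
  fixes x :: "real ^ 'n"
  shows "numeral w * x = numeral w *\<^sub>R x" "x * numeral w = numeral w *\<^sub>R x"
  by (simp_all add: Finite_Cartesian_Product.vec_eq_iff)

text \<open>Derivatives are taken at points of an open set, so that values outside of it do not matter.\<close>

lemma ck_on_cong:
  assumes "open S" "\<And>x. x \<in> S \<Longrightarrow> f x = g x" "ck_on k S f"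
  shows "ck_on k S g"
  using assms(2,3)
proof (induction k arbitrary: f g)
  case 0
  then show ?case by (simp cong: continuous_on_cong)
next
  case (Suc k)
  have fd: "f differentiable at x" if "x \<in> S" for x
    using Suc.prems(2) that assms(1) by (simp add: differentiable_on_eq_differentiable_at)
  have gd: "(g has_derivative frechet_derivative f (at x)) (at x)" if "x \<in> S" for x
    by (rule has_derivative_transform_within_open[OF fd[OF that, unfolded frechet_derivative_works] assms(1) that])
      (rule Suc.prems(1))
  have eq: "frechet_derivative g (at x) = frechet_derivative f (at x)" if "x \<in> S" for x
    using frechet_derivative_at[OF gd[OF that]] by simp
  have "g differentiable_on S"
    using gd by (auto simp: differentiable_on_eq_differentiable_at[OF assms(1)] differentiable_def)
  moreover have "ck_on k S (\<lambda>x. frechet_derivative g (at x) v)" for v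
    by (rule Suc.IH[of "\<lambda>x. frechet_derivative f (at x) v"]) (use Suc.prems(2) eq in auto)
  ultimately show ?case by simp
qed

lemma ck_on_Suc_imp: "ck_on (Suc k) S f \<Longrightarrow> ck_on k S f"
  by (induction k arbitrary: f) (auto intro: differentiable_imp_continuous_on)

lemma ck_on_subset:
  assumes "ck_on k S f" "T \<subseteq> S" shows "ck_on k T f"
  using assms(1)
  by (induction k arbitrary: f)
    (auto intro: continuous_on_subset[OF _ assms(2)] differentiable_on_subset[OF _ assms(2)])

lemma ck_on_SucI:
  assumes "open S" "\<And>x. x \<in> S \<Longrightarrow> (f has_derivative D x) (at x)"
    and "\<And>v. ck_on k S (\<lambda>x. D x v)"
  shows "ck_on (Suc k) S f"
proof -
  have eq: "frechet_derivative f (at x) = D x" if "x \<in> S" for x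
    using frechet_derivative_at[OF assms(2)[OF that]] by simp
  have "f differentiable_on S"
    using assms(2) by (auto simp: differentiable_on_eq_differentiable_at[OF assms(1)] differentiable_def)
  moreover have "ck_on k S (\<lambda>x. frechet_derivative f (at x) v)" for v
    by (rule ck_on_cong[OF assms(1) _ assms(3)[of v]]) (simp add: eq)
  ultimately show ?thesis by simp
qed

lemma ck_on_SucD:
  assumes "open S" "ck_on (Suc k) S f"
  shows "x \<in> S \<Longrightarrow> (f has_derivative frechet_derivative f (at x)) (at x)"
    and "ck_on k S (\<lambda>x. frechet_derivative f (at x) v)"
  using assms by (auto simp: differentiable_on_eq_differentiable_at frechet_derivative_works)

lemma ck_on_const: "open S \<Longrightarrow> ck_on k S (\<lambda>x. c)"
proof (induction k arbitrary: c)
  case (Suc k)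
  show ?case by (rule ck_on_SucI[OF Suc.prems, of _ "\<lambda>x v. 0"]) (use Suc in auto)
qed simp

lemma ck_on_bounded_linear:
  assumes "open S" "bounded_linear L" "ck_on k S f"
  shows "ck_on k S (\<lambda>x. L (f x))"
  using assms(3)
proof (induction k arbitrary: f)
  case 0
  then show ?case using assms(2) by (simp add: bounded_linear.continuous_on)
next
  case (Suc k)
  show ?case
    by (rule ck_on_SucI[OF assms(1), of _ "\<lambda>x v. L (frechet_derivative f (at x) v)"])
      (use Suc ck_on_SucD[OF assms(1) Suc.prems] in \<open>auto intro: bounded_linear.has_derivative[OF assms(2)]\<close>)
qed

lemma ck_on_add:
  assumes "open S" "ck_on k S f" "ck_on k S g"
  shows "ck_on k S (\<lambda>x. f x + g x)"
  using assms(2,3)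
proof (induction k arbitrary: f g)
  case 0
  then show ?case by (simp add: continuous_on_add)
next
  case (Suc k)
  show ?case
    by (rule ck_on_SucI[OF assms(1), of _ "\<lambda>x v. frechet_derivative f (at x) v + frechet_derivative g (at x) v"])
      (use Suc.IH ck_on_SucD[OF assms(1) Suc.prems(1)] ck_on_SucD[OF assms(1) Suc.prems(2)] in \<open>auto intro: has_derivative_add\<close>)
qed

lemma ck_on_sum:
  assumes "open S" "\<And>i. i \<in> I \<Longrightarrow> ck_on k S (f i)"
  shows "ck_on k S (\<lambda>x. \<Sum>i\<in>I. f i x)"
  using assms(2)
  by (induction I rule: infinite_finite_induct) (auto intro: ck_on_add ck_on_const assms(1))

lemma ck_on_bilinear:
  assumes "open S" "bounded_bilinear P" "ck_on k S f" "ck_on k S g"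
  shows "ck_on k S (\<lambda>x. P (f x) (g x))"
  using assms(3,4)
proof (induction k arbitrary: f g)
  case 0
  then show ?case using bounded_bilinear.continuous_on[OF assms(2)] by simp
next
  case (Suc k)
  note f = ck_on_SucD[OF assms(1) Suc.prems(1)] ck_on_Suc_imp[OF Suc.prems(1)]
  note g = ck_on_SucD[OF assms(1) Suc.prems(2)] ck_on_Suc_imp[OF Suc.prems(2)]
  show ?case
    by (rule ck_on_SucI[OF assms(1), of _ "\<lambda>x v. P (f x) (frechet_derivative g (at x) v) + P (frechet_derivative f (at x) v) (g x)"])
      (use Suc.IH f g in \<open>auto intro!: bounded_bilinear.FDERIV[OF assms(2)] ck_on_add assms(1)\<close>)
qed

text \<open>Written in coordinates, the chain rule expresses the derivative of the composition by products
  of functions that are \<open>k\<close> times differentiable, which keeps the induction on \<open>k\<close> going.\<close>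

lemma ck_on_compose:
  fixes f :: "'b::euclidean_space \<Rightarrow> 'c::real_normed_vector" and g ::
      "'a::euclidean_space \<Rightarrow> 'b"
  assumes "open S" "open T" "g ` S \<subseteq> T" "ck_on k S g" "ck_on k T f"
  shows "ck_on k S (\<lambda>x. f (g x))"
  using assms(4,5)
proof (induction k arbitrary: f)
  case 0
  then show ?case using assms(3) by (auto intro: continuous_on_compose2)
next
  case (Suc k)
  note g = ck_on_SucD[OF assms(1) Suc.prems(1)] ck_on_Suc_imp[OF Suc.prems(1)]
  note f = ck_on_SucD[OF assms(2) Suc.prems(2)]
  let ?D = "\<lambda>x v. \<Sum>b\<in>Basis. (frechet_derivative g (at x) v \<bullet> b) *\<^sub>R frechet_derivative f (at (g x)) b"
  have D: "((\<lambda>x. f (g x)) has_derivative ?D x) (at x)" if "x \<in> S" for x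
  proof -
    have gx: "g x \<in> T" using that assms(3) by auto
    have lf: "linear (frechet_derivative f (at (g x)))"
      using f(1)[OF gx] by (simp add: has_derivative_linear)
    have "frechet_derivative f (at (g x)) w =
        (\<Sum>b\<in>Basis. (w \<bullet> b) *\<^sub>R frechet_derivative f (at (g x)) b)" for w
      using arg_cong[OF euclidean_representation[of w, symmetric], of "frechet_derivative f (at (g x))"]
      by (simp add: linear_sum[OF lf] linear_cmul[OF lf])
    then have "?D x = (\<lambda>v. frechet_derivative f (at (g x)) (frechet_derivative g (at x) v))"
        by metis
    then show ?thesis using has_derivative_compose[OF g(1)[OF that] f(1)[OF gx]] by simp
  qed
  show ?case
  proof (rule ck_on_SucI[OF assms(1) D])
    fix v
    show "ck_on k S (\<lambda>x. ?D x v)"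
      by (intro ck_on_sum ck_on_bilinear[OF assms(1) bounded_bilinear_scaleR] assms(1)
          ck_on_bounded_linear[OF assms(1) bounded_linear_inner_left g(2)] Suc.IH g(3) f(2))
  qed
qed

lemma smooth_on_has_derivative:
  "open S \<Longrightarrow> smooth_on S f \<Longrightarrow> x \<in> S \<Longrightarrow> (f
      has_derivative frechet_derivative f (at x)) (at x)"
  using ck_on_SucD(1)[of S 0 f x] by (simp add: smooth_on_def)

lemma smooth_on_frechet_derivative:
  "open S \<Longrightarrow> smooth_on S f \<Longrightarrow> smooth_on S (\<lambda>x. frechet_derivative f (at x) v)"
  unfolding smooth_on_def using ck_on_SucD(2) by blast

lemma smooth_on_cong: "open S \<Longrightarrow> (\<And>x. x \<in> S \<Longrightarrow> f x =
    g x) \<Longrightarrow> smooth_on S f \<Longrightarrow> smooth_on S g"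
  unfolding smooth_on_def using ck_on_cong by blast

lemma smooth_on_subset: "smooth_on S f \<Longrightarrow> T \<subseteq> S \<Longrightarrow> smooth_on T f"
  unfolding smooth_on_def using ck_on_subset by blast

lemma smooth_on_bounded_linear:
  "open S \<Longrightarrow> bounded_linear L \<Longrightarrow> smooth_on S f \<Longrightarrow> smooth_on S (\<lambda>x. L (f x))"
  unfolding smooth_on_def using ck_on_bounded_linear by blast

lemma smooth_on_sum:
  "open S \<Longrightarrow> (\<And>i. i \<in> I \<Longrightarrow> smooth_on S (f i)) \<Longrightarrow> smooth_on S (\<lambda>x. \<Sum>i\<in>I. f i x)"
  by (simp add: smooth_on_def ck_on_sum)

lemma smooth_on_bilinear:
  "open S \<Longrightarrow> bounded_bilinear P \<Longrightarrow> smooth_on S f \<Longrightarrow> smooth_on S g \<Longrightarrow> smooth_on S (\<lambda>x. P (f x) (g x))"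
  by (simp add: smooth_on_def ck_on_bilinear)

lemma smooth_on_compose:
  fixes f :: "'b::euclidean_space \<Rightarrow> 'c::real_normed_vector" and g ::
      "'a::euclidean_space \<Rightarrow> 'b"
  shows "open S \<Longrightarrow> open T \<Longrightarrow> g ` S \<subseteq> T \<Longrightarrow> smooth_on S g \<Longrightarrow> smooth_on T f \<Longrightarrow>
    smooth_on S (\<lambda>x. f (g x))"
  by (simp add: smooth_on_def ck_on_compose[of S T])

text \<open>The mixed second difference is expressed by one of the two mixed derivatives at a nearby point,
  by the mean value theorem in each of the two directions. It is symmetric in the directions, which
  is why the two mixed derivatives agree.\<close>

lemma second_difference:
  fixes f :: "'a::euclidean_space \<Rightarrow> real"
  assumes S: "open S" "smooth_on S f" and sub: "cball x r \<subseteq> S" and h: "0 < h"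
      "h * (norm u + norm v) \<le> r"
  shows "\<exists>\<xi> \<in> cball x r. f (x + h *\<^sub>R u + h *\<^sub>R v) - f (x + h *\<^sub>R u) - f (x + h *\<^sub>R v) + f x =
    h\<^sup>2 * frechet_derivative (\<lambda>y. frechet_derivative f (at y) u) (at \<xi>) v"
proof -
  have inb: "x + s *\<^sub>R u + t *\<^sub>R v \<in> cball x r" if "0 \<le> s" "s \<le> h" "0 \<le> t"
      "t \<le> h" for s t
  proof -
    have "norm (s *\<^sub>R u + t *\<^sub>R v) \<le> s * norm u + t * norm v"
      using norm_triangle_ineq[of "s *\<^sub>R u" "t *\<^sub>R v"] that by simp
    also have "\<dots> \<le> h * (norm u + norm v)"
      using that by (simp add: distrib_left add_mono mult_right_mono)
    finally have "norm (s *\<^sub>R u + t *\<^sub>R v) \<le> r" using h by simp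
    then show ?thesis by (simp add: dist_norm add.assoc norm_minus_commute flip: norm_minus_cancel[of "s *\<^sub>R u + t *\<^sub>R v"])
  qed
  have line: "((\<lambda>s. F (p + s *\<^sub>R w)) has_real_derivative frechet_derivative F (at (p + s *\<^sub>R w)) w) (at s)"
    if "smooth_on S F" "p + s *\<^sub>R w \<in> S" for F p w s
  proof -
    note d = smooth_on_has_derivative[OF S(1) that]
    have "((\<lambda>s. p + s *\<^sub>R w) has_derivative (\<lambda>t. t *\<^sub>R w)) (at s)"
      by (auto intro!: derivative_eq_intros)
    from has_derivative_compose[OF this d]
    have "((\<lambda>s. F (p + s *\<^sub>R w))
        has_derivative (\<lambda>t. t * frechet_derivative F (at (p + s *\<^sub>R w)) w)) (at s)"
      using linear_cmul[OF has_derivative_linear[OF d]] by simp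
    then show ?thesis by (simp add: has_field_derivative_def mult_commute_abs)
  qed
  define fu where "fu y = frechet_derivative f (at y) u" for y
  have fu: "smooth_on S fu" unfolding fu_def using smooth_on_frechet_derivative S by blast
  have "\<exists>\<sigma>>0. \<sigma> < h \<and> (f (x + h *\<^sub>R u + h *\<^sub>R v) - f (x + h *\<^sub>R u)) - (f (x + 0 *\<^sub>R u + h *\<^sub>R v) - f (x + 0 *\<^sub>R u))
     = (h - 0) * (fu (x + \<sigma> *\<^sub>R u + h *\<^sub>R v) - fu (x + \<sigma> *\<^sub>R u))"
  proof (rule MVT2[OF h(1)])
    fix s assume s: "0 \<le> s" "s \<le> h"
    have 1: "x + s *\<^sub>R u + h *\<^sub>R v \<in> S" "x + s *\<^sub>R u \<in> S"
        using inb[of s h] inb[of s 0] s h(1) sub by auto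
    then have 2: "x + h *\<^sub>R v + s *\<^sub>R u \<in> S" by (simp add: algebra_simps)
    show "((\<lambda>s. f (x + s *\<^sub>R u + h *\<^sub>R v) - f (x + s *\<^sub>R u)) has_real_derivative
       fu (x + s *\<^sub>R u + h *\<^sub>R v) - fu (x + s *\<^sub>R u)) (at s)"
      using DERIV_diff[OF line[OF S(2) 2] line[OF S(2) 1(2)]] by (simp add: fu_def algebra_simps)
  qed
  then obtain \<sigma> where \<sigma>: "0 < \<sigma>" "\<sigma> < h"
      "f (x + h *\<^sub>R u + h *\<^sub>R v) - f (x + h *\<^sub>R u) - f (x + h *\<^sub>R v) + f x
     = h * (fu (x + \<sigma> *\<^sub>R u + h *\<^sub>R v) - fu (x + \<sigma> *\<^sub>R u))" by auto
  have "\<exists>\<tau>>0. \<tau> < h \<and> fu (x + \<sigma> *\<^sub>R u + h *\<^sub>R v) - fu (x + \<sigma> *\<^sub>R u + 0 *\<^sub>R v)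
     = (h - 0) * frechet_derivative fu (at (x + \<sigma> *\<^sub>R u + \<tau> *\<^sub>R v)) v"
    by (rule MVT2[OF h(1)], rule line[OF fu]) (use inb[of \<sigma>] \<sigma> sub in auto)
  then obtain \<tau> where \<tau>: "0 < \<tau>" "\<tau> < h"
      "fu (x + \<sigma> *\<^sub>R u + h *\<^sub>R v) - fu (x + \<sigma> *\<^sub>R u)
     = h * frechet_derivative fu (at (x + \<sigma> *\<^sub>R u + \<tau> *\<^sub>R v)) v" by auto
  show ?thesis
    by (rule bexI[OF _ inb[of \<sigma> \<tau>]])
      (use \<sigma> \<tau> in \<open>auto simp: fu_def[abs_def, symmetric] power2_eq_square\<close>)
qed

lemma symmetric_second_derivative_real:
  fixes f :: "'a::euclidean_space \<Rightarrow> real"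
  assumes S: "open S" "smooth_on S f" and x: "x \<in> S"
  shows "frechet_derivative (\<lambda>y. frechet_derivative f (at y) u) (at x) v =
    frechet_derivative (\<lambda>y. frechet_derivative f (at y) v) (at x) u"
proof -
  define F where "F u v y = frechet_derivative (\<lambda>y. frechet_derivative f (at y) u) (at y) v"
      for u v y
  have cont: "continuous_on S (F u v)" for u v
  proof -
    have "smooth_on S (F u v)" unfolding F_def using smooth_on_frechet_derivative S by blast
    then show ?thesis unfolding smooth_on_def using ck_on.simps(1) by blast
  qed
  have "\<bar>F u v x - F v u x\<bar> \<le> e" if "e > 0" for e
  proof -
    have e2: "e / 2 > 0" using that by simp
    have "((F u v) \<longlongrightarrow> F u v x) (at x)" for u v
      using cont[of u v] S(1) x by (simp add: continuous_on_eq_continuous_at continuous_at)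
    then have "\<forall>\<^sub>F y in at x. dist (F u v y) (F u v x) < e / 2"
        "\<forall>\<^sub>F y in at x. dist (F v u y) (F v u x) < e / 2"
      using e2 tendstoD by blast+
    then have "\<forall>\<^sub>F y in at x. dist (F u v y) (F u v x) < e / 2 \<and> dist (F v u y) (F v u x) < e / 2 \<and> y \<in> S"
      using eventually_at_in_open'[OF S(1) x] by eventually_elim auto
    then obtain d where d: "d > 0"
        "\<And>y. y \<noteq> x \<Longrightarrow> dist y x < d \<Longrightarrow>
      dist (F u v y) (F u v x) < e / 2 \<and> dist (F v u y) (F v u x) < e / 2 \<and> y \<in> S"
      unfolding eventually_at by auto
    define r where "r = d / 2"
    have r: "0 < r" "cball x r \<subseteq> S"
      "\<And>y. y \<in> cball x r \<Longrightarrow> \<bar>F u v y - F u v x\<bar> < e / 2 \<and> \<bar>F v u y - F v u x\<bar> < e / 2"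
    proof -
      show "0 < r" using d by (simp add: r_def)
      have "dist y x < d" if "y \<in> cball x r" for y using that d(1) by (simp add: r_def dist_commute)
      then show "cball x r \<subseteq> S" using d(2) x by (metis subsetI)
      show "\<bar>F u v y - F u v x\<bar> < e / 2 \<and> \<bar>F v u y - F v u x\<bar> < e / 2" if
          "y \<in> cball x r" for y
        using d(2)[of y] \<open>\<And>y. y \<in> cball x r \<Longrightarrow> dist y x < d\<close>[OF that] \<open>e > 0\<close>
        by (cases "y = x") (auto simp: dist_real_def)
    qed
    define h where "h = r / (norm u + norm v + 1)"
    have nn: "0 < norm u + norm v + 1" by (simp add: add_nonneg_pos)
    have h: "0 < h" unfolding h_def using r(1) nn by simp
    have "h * (norm u + norm v + 1) = r" using nn by (simp add: h_def)
    then have h2: "h * (norm u + norm v) \<le> r" using h by (simp add: algebra_simps)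
    then have h3: "h * (norm v + norm u) \<le> r" by (simp add: add.commute)
    obtain \<xi> where \<xi>: "\<xi> \<in> cball x r"
        "f (x + h *\<^sub>R u + h *\<^sub>R v) - f (x + h *\<^sub>R u) - f (x + h *\<^sub>R v) + f x =
       h\<^sup>2 * F u v \<xi>" using second_difference[OF S r(2) h h2] unfolding F_def by blast
    obtain \<zeta> where \<zeta>: "\<zeta> \<in> cball x r"
        "f (x + h *\<^sub>R v + h *\<^sub>R u) - f (x + h *\<^sub>R v) - f (x + h *\<^sub>R u) + f x =
       h\<^sup>2 * F v u \<zeta>" using second_difference[OF S r(2) h h3] unfolding F_def by blast
    have "h\<^sup>2 * F u v \<xi> = h\<^sup>2 * F v u \<zeta>" using \<xi>(2) \<zeta>(2)
        by (simp add: algebra_simps)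
    then have "F u v \<xi> = F v u \<zeta>" using h by simp
    then show ?thesis using r(3)[OF \<xi>(1)] r(3)[OF \<zeta>(1)] by linarith
  qed
  then have "\<bar>F u v x - F v u x\<bar> \<le> 0" by (rule field_le_epsilon[where y = 0, simplified]) 
  then show ?thesis by (simp add: F_def)
qed

lemma symmetric_second_derivative:
  fixes f :: "'a::euclidean_space \<Rightarrow> 'b::euclidean_space"
  assumes S: "open S" "smooth_on S f" and x: "x \<in> S"
  shows "frechet_derivative (\<lambda>y. frechet_derivative f (at y) u) (at x) v =
    frechet_derivative (\<lambda>y. frechet_derivative f (at y) v) (at x) u"
proof (rule euclidean_eqI)
  fix b :: 'b
  define fb where "fb y = f y \<bullet> b" for y
  have fb: "smooth_on S fb"
    unfolding fb_def by (rule smooth_on_bounded_linear[OF S(1) bounded_linear_inner_left S(2)])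
  have d: "frechet_derivative fb (at y) w = frechet_derivative f (at y) w \<bullet> b" if "y \<in> S"
      for y w
    using frechet_derivative_at[OF bounded_linear.has_derivative[OF bounded_linear_inner_left
        smooth_on_has_derivative[OF S that]], of b] unfolding fb_def[abs_def] by metis
  have dd: "frechet_derivative (\<lambda>y. frechet_derivative fb (at y) u) (at x) v =
    frechet_derivative (\<lambda>y. frechet_derivative f (at y) u) (at x) v \<bullet> b" for u v
  proof -
    have "((\<lambda>y. frechet_derivative f (at y) u \<bullet> b) has_derivative
      (\<lambda>v. frechet_derivative (\<lambda>y. frechet_derivative f (at y) u) (at x) v \<bullet> b)) (at x)"
      by (rule bounded_linear.has_derivative[OF bounded_linear_inner_left
        smooth_on_has_derivative[OF S(1) smooth_on_frechet_derivative[OF S] x]])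
    then have "((\<lambda>y. frechet_derivative fb (at y) u) has_derivative
      (\<lambda>v. frechet_derivative (\<lambda>y. frechet_derivative f (at y) u) (at x) v \<bullet> b)) (at x)"
      by (rule has_derivative_transform_within_open[OF _ S(1) x]) (simp add: d)
    from frechet_derivative_at[OF this] show ?thesis by metis
  qed
  show "frechet_derivative (\<lambda>y. frechet_derivative f (at y) u) (at x) v \<bullet> b =
    frechet_derivative (\<lambda>y. frechet_derivative f (at y) v) (at x) u \<bullet> b"
    using symmetric_second_derivative_real[OF S(1) fb x, of u v] by (simp add: dd)
qed

section \<open>Derogatory operators\<close>

text \<open>The vectors \<open>x1 + i y1\<close> and \<open>x2 + i y2\<close> of the complexification are eigenvectors for the eigenvalue
  \<open>\<alpha> + i \<beta>\<close>, and the last clause is their linear independence over \<open>\<complex>\<close>, the coefficients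
  being \<open>a + i b\<close> and \<open>c + i d\<close>.\<close>

definition derogatory :: "('a::real_vector \<Rightarrow> 'a) \<Rightarrow> bool" where
  "derogatory S \<longleftrightarrow> (\<exists>\<alpha> \<beta> x1 y1 x2 y2.
     S x1 = \<alpha> *\<^sub>R x1 - \<beta> *\<^sub>R y1 \<and> S y1 = \<beta> *\<^sub>R x1 + \<alpha> *\<^sub>R y1 \<and>
     S x2 = \<alpha> *\<^sub>R x2 - \<beta> *\<^sub>R y2 \<and> S y2 = \<beta> *\<^sub>R x2 + \<alpha> *\<^sub>R y2 \<and>
     (\<forall>a b c d. a *\<^sub>R x1 - b *\<^sub>R y1 + c *\<^sub>R x2 - d *\<^sub>R y2 = 0 \<and>
        b *\<^sub>R x1 + a *\<^sub>R y1 + d *\<^sub>R x2 + c *\<^sub>R y2 = 0 \<longrightarrow> a = 0 \<and> b = 0 \<and> c = 0 \<and> d = 0))"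

lemma derogatoryI:
  assumes "S x1 = \<alpha> *\<^sub>R x1 - \<beta> *\<^sub>R y1" "S y1 =
      \<beta> *\<^sub>R x1 + \<alpha> *\<^sub>R y1"
    "S x2 = \<alpha> *\<^sub>R x2 - \<beta> *\<^sub>R y2" "S y2 =
        \<beta> *\<^sub>R x2 + \<alpha> *\<^sub>R y2"
    "\<And>a b c d. a *\<^sub>R x1 - b *\<^sub>R y1 + c *\<^sub>R x2 - d *\<^sub>R y2 =
        0 \<Longrightarrow>
        b *\<^sub>R x1 + a *\<^sub>R y1 + d *\<^sub>R x2 + c *\<^sub>R y2 = 0 \<Longrightarrow> a = 0 \<and> b = 0 \<and> c = 0 \<and> d = 0"
  shows "derogatory S"
  unfolding derogatory_def using assms by blast

lemma derogatory_real:
  assumes "S 0 = 0" "S x1 = l *\<^sub>R x1" "S x2 = l *\<^sub>R x2"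
    and "\<And>a c. a *\<^sub>R x1 + c *\<^sub>R x2 = 0 \<Longrightarrow> a = 0 \<and> c = 0"
  shows "derogatory S"
  by (rule derogatoryI[of S x1 l 0 0 x2 0]) (use assms in auto)

section \<open>Null subspaces of pseudo-Euclidean four-space\<close>

locale bilinear_form =
  fixes \<eta> :: "real ^ 4 \<Rightarrow> real ^ 4 \<Rightarrow> real"
  assumes bilin: "bilinear \<eta>"
    and sym: "\<eta> x y = \<eta> y x"
    and nondeg: "(\<And>y. \<eta> x y = 0) \<Longrightarrow> x = 0"
begin

lemmas eta_simps = bilinear_ladd[OF bilin] bilinear_radd[OF bilin] bilinear_lmul[OF bilin]
  bilinear_rmul[OF bilin] bilinear_lneg[OF bilin] bilinear_rneg[OF bilin] bilinear_lsub[OF bilin]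
  bilinear_rsub[OF bilin] bilinear_lzero[OF bilin] bilinear_rzero[OF bilin]

text \<open>The map from vectors to functionals is injective by non-degeneracy, hence bijective.\<close>

lemma functional_representation:
  assumes "linear f"
  shows "\<exists>v. \<forall>x. \<eta> v x = f x"
proof -
  define T where "T v = (\<chi> i. \<eta> v (axis i 1))" for v
  have lin: "linear T"
    unfolding T_def by (rule linearI) (auto simp: Finite_Cartesian_Product.vec_eq_iff eta_simps)
  have expand: "g x = (\<Sum>i\<in>UNIV. x $ i * g (axis i 1))" if "linear g" for g ::
      "real ^ 4 \<Rightarrow> real" and x
  proof -
    have "g x = g (\<Sum>i\<in>UNIV. x $ i *\<^sub>R axis i 1)"
      using basis_expansion[of x] by (simp add: scalar_mult_eq_scaleR)
    also have "\<dots> = (\<Sum>i\<in>UNIV. x $ i * g (axis i 1))"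
      using that by (simp add: linear_sum linear_cmul)
    finally show ?thesis .
  qed
  have leta: "linear (\<eta> v)" for v using bilin by (simp add: bilinear_def)
  have "v = 0" if "T v = 0" for v
  proof (rule nondeg)
    fix y
    from that have "\<eta> v (axis i 1) = 0" for i
        by (simp add: T_def Finite_Cartesian_Product.vec_eq_iff)
    then show "\<eta> v y = 0" by (subst expand[OF leta]) simp
  qed
  then have "inj T" using lin by (simp add: linear_injective_0)
  then have "surj T" using lin linear_injective_imp_surjective by blast
  then obtain v where v: "T v = (\<chi> i. f (axis i 1))" by (metis surjD)
  then have "\<eta> v (axis i 1) = f (axis i 1)" for i
      by (simp add: T_def Finite_Cartesian_Product.vec_eq_iff)
  then have "\<eta> v x = f x" for x by (subst expand[OF leta], subst expand[OF assms]) simp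
  then show ?thesis by blast
qed

definition hyperbolic :: "real ^ 4 \<Rightarrow> real ^ 4 \<Rightarrow> real ^ 4 \<Rightarrow> real ^ 4 \<Rightarrow> bool" where
  "hyperbolic u1 u2 v1 v2 \<longleftrightarrow>
     \<eta> u1 u1 = 0 \<and> \<eta> u1 u2 = 0 \<and> \<eta> u2 u2 = 0 \<and> \<eta> v1 v1 = 0 \<and> \<eta> v1 v2 = 0 \<and> \<eta> v2 v2 = 0 \<and>
     \<eta> u1 v1 = 1 \<and> \<eta> u1 v2 = 0 \<and> \<eta> u2 v1 = 0 \<and> \<eta> u2 v2 = 1"

lemma hyperbolicD:
  assumes "hyperbolic u1 u2 v1 v2"
  shows "\<eta> u1 u1 = 0" "\<eta> u1 u2 = 0" "\<eta> u2 u1 = 0" "\<eta> u2 u2 = 0"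
    "\<eta> v1 v1 = 0" "\<eta> v1 v2 = 0" "\<eta> v2 v1 = 0" "\<eta> v2 v2 = 0"
    "\<eta> u1 v1 = 1" "\<eta> u1 v2 = 0" "\<eta> u2 v1 = 0" "\<eta> u2 v2 = 1"
    "\<eta> v1 u1 = 1" "\<eta> v2 u1 = 0" "\<eta> v1 u2 = 0" "\<eta> v2 u2 = 1"
  using assms sym[of u1 u2] sym[of u1 v1] sym[of u1 v2] sym[of u2 v1] sym[of u2 v2] sym[of v1 v2]
  unfolding hyperbolic_def by simp_all

text \<open>The four vectors have an invertible Gram matrix, hence are independent and span \<open>\<real>\<^sup>4\<close>.\<close>

lemma hyperbolic_expansion:
  assumes "hyperbolic u1 u2 v1 v2"
  shows "x = \<eta> x v1 *\<^sub>R u1 + \<eta> x v2 *\<^sub>R u2 + \<eta> x u1 *\<^sub>R v1 + \<eta> x u2 *\<^sub>R v2"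
proof -
  define L :: "real ^ 4 \<Rightarrow> real ^ 4" where
    "L c = c $ 1 *\<^sub>R u1 + c $ 2 *\<^sub>R u2 + c $ 3 *\<^sub>R v1 + c $ 4 *\<^sub>R v2" for c
  note h = hyperbolicD[OF assms]
  have lin: "linear L" unfolding L_def by (rule linearI) (auto simp: algebra_simps)
  have coef: "\<eta> (L c) v1 = c $ 1" "\<eta> (L c) v2 = c $ 2" "\<eta> (L c) u1 = c $ 3" "\<eta> (L c) u2 =
      c $ 4" for c
    by (simp_all add: L_def eta_simps h)
  have "c = 0" if "L c = 0" for c
    using coef[of c] that by (simp add: Finite_Cartesian_Product.vec_eq_iff forall_4 eta_simps)
  then have "inj L" using lin by (simp add: linear_injective_0)
  then have "surj L" using lin linear_injective_imp_surjective by blast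
  then obtain c where "L c = x" by (metis surjD)
  then show ?thesis using coef[of c] L_def[of c] by simp
qed

text \<open>Start with any vectors dual to \<open>u1\<close> and \<open>u2\<close>. Adding vectors of the null plane does not change
  these pairings, and is enough freedom to make the dual vectors null and orthogonal.\<close>

lemma hyperbolic_complement:
  assumes iso: "\<eta> u1 u1 = 0" "\<eta> u1 u2 = 0" "\<eta> u2 u2 = 0"
    and ind: "\<And>a b. a *\<^sub>R u1 + b *\<^sub>R u2 = 0 \<Longrightarrow> a = 0 \<and> b = 0"
  shows "\<exists>v1 v2. hyperbolic u1 u2 v1 v2"
proof -
  have dual: "\<exists>v. \<eta> v x = 1 \<and> \<eta> v y = 0" if xy:
      "\<And>a b. a *\<^sub>R x + b *\<^sub>R y = 0 \<Longrightarrow> a = 0 \<and> b = 0" for x y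
  proof -
    have y: "y \<bullet> y \<noteq> 0" using xy[of 0 1] by auto
    define z where "z = x - ((x \<bullet> y) / (y \<bullet> y)) *\<^sub>R y"
    have zy: "z \<bullet> y = 0" using y by (simp add: z_def inner_diff_left)
    have "z \<noteq> 0" using xy[of 1 "- ((x \<bullet> y) / (y \<bullet> y))"] by (auto simp: z_def)
    moreover have "z \<bullet> z = z \<bullet> x - (x \<bullet> y) / (y \<bullet> y) * (z \<bullet> y)"
      by (subst (2) z_def) (simp add: inner_diff_right)
    then have "z \<bullet> x = z \<bullet> z" using zy by simp
    ultimately have zx: "z \<bullet> x \<noteq> 0" by simp
    have "linear (\<lambda>w. (z /\<^sub>R (z \<bullet> x)) \<bullet> w)"
        by (rule linearI) (auto simp: inner_add_right)
    from functional_representation[OF this] obtain v where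
      "\<And>w. \<eta> v w = (z /\<^sub>R (z \<bullet> x)) \<bullet> w" by blast
    then show ?thesis using zx zy by (intro exI[of _ v]) simp
  qed
  obtain w1 where w1: "\<eta> w1 u1 = 1" "\<eta> w1 u2 = 0" using dual[OF ind] by blast
  have "a = 0 \<and> b = 0" if "a *\<^sub>R u2 + b *\<^sub>R u1 = 0" for a b using ind[of b a] that
      by (simp add: add.commute)
  from dual[OF this] obtain w2 where w2: "\<eta> w2 u2 = 1" "\<eta> w2 u1 = 0" by blast
  \<comment> \<open>The multiples are those that make \<open>v1\<close> null and then \<open>v2\<close> orthogonal to \<open>v1\<close> and null.\<close>
  define v1 where "v1 = w1 - (\<eta> w1 w1 / 2) *\<^sub>R u1"
  define v2 where "v2 = w2 - \<eta> v1 w2 *\<^sub>R u1 - (\<eta> w2 w2 / 2) *\<^sub>R u2"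
  note s = w1 w2 iso sym[of u1 w1] sym[of u2 w1] sym[of u1 w2] sym[of u2 w2] sym[of u2 u1] sym[of w2 w1]
  have "hyperbolic u1 u2 v1 v2"
    unfolding hyperbolic_def by (simp add: v1_def v2_def eta_simps s algebra_simps)
  then show ?thesis by blast
qed

end

section \<open>The algebraic system behind the null plane case\<close>

text \<open>The scalar equations to which the null plane case reduces: for the two basis vectors \<open>u\<^sub>k\<close> of the
  plane, \<open>x\<^sub>k\<close> and \<open>y\<^sub>k\<close> describe \<open>\<Gamma> u\<^sub>k\<close> on the plane and \<open>b\<^sub>k\<close> the remaining component of \<open>\<Gamma> u\<^sub>k\<close>;
  \<open>m\<close> and \<open>n\<close> are the components of \<open>\<Gamma>\<close> in the complementary directions that do not commute with
  \<open>S\<close>. The inequality says that \<open>S\<close> is not derogatory.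

  Put \<open>q = m + n \<surd>\<delta>\<close>. The last four equations are the components of \<open>(x\<^sub>k + 3 y\<^sub>k \<surd>\<delta>) q = 0\<close> in
  \<open>\<real>[\<surd>\<delta>]\<close>. Either \<open>q\<close> is cancellable and the claim is immediate, or \<open>q = 0\<close> and the first six
  equations are a regular homogeneous system, or \<open>\<delta>\<close> is a square and \<open>q\<close> a zero divisor; in the
  last case the equations contradict the inequality or force the claim.\<close>

lemma codazzi_curvature_system:
  fixes x1 x2 y1 y2 b1 b2 m n \<delta> p r :: real
  assumes a1: "2 * b1 + 2 * p * y1 = - m" and a2: "2 * p * x1 + r * y1 = - \<delta> * n"
    and a4: "2 * p * \<delta> * y1 + 2 * r * x1 - 2 * \<delta> * b1 = - \<delta> * m"
    and a5: "2 * b2 + 2 * p * y2 = n" and a6: "2 * p * x2 + r * y2 = m"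
    and a8: "2 * p * \<delta> * y2 + 2 * r * x2 - 2 * \<delta> * b2 = \<delta> * n"
    and b1: "x1 * m + 3 * \<delta> * y1 * n = 0" "x1 * n + 3 * y1 * m = 0"
    and b2: "x2 * m + 3 * \<delta> * y2 * n = 0" "x2 * n + 3 * y2 * m = 0"
    and nd: "r\<^sup>2 \<noteq> 4 * \<delta> * p\<^sup>2"
  shows "x1 = 0 \<and> y1 = 0 \<and> x2 = 0 \<and> y2 = 0"
proof -
  have "2 * (r * x1 - 2 * \<delta> * b1) =
      (2 * p * \<delta> * y1 + 2 * r * x1 - 2 * \<delta> * b1) - \<delta> * (2 * b1 + 2 * p * y1)"
    "2 * (r * x2 - 2 * \<delta> * b2) =
      (2 * p * \<delta> * y2 + 2 * r * x2 - 2 * \<delta> * b2) - \<delta> * (2 * b2 + 2 * p * y2)"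
    by (simp_all add: algebra_simps)
  then have e1: "r * x1 = 2 * \<delta> * b1" and e2: "r * x2 = 2 * \<delta> * b2"
    unfolding a1 a4 a5 a8 by simp_all
  show ?thesis
  proof (cases "n = 0")
    case True
    show ?thesis
    proof (cases "m = 0")
      case False
      then show ?thesis using True b1 b2 by simp
    next
      case m: True
      have "x = 0 \<and> y = 0" if "2 * b + 2 * p * y = 0" "2 * p * x + r * y = 0" "r * x = 2 * \<delta> * b"
          for x y b
      proof -
        have "(r\<^sup>2 - 4 * \<delta> * p\<^sup>2) * y =
          r * (2 * p * x + r * y) - 2 * p * (r * x - 2 * \<delta> * b) - 2 * p * \<delta> * (2 * b + 2 * p * y)"
          "(r\<^sup>2 - 4 * \<delta> * p\<^sup>2) * x =
          r * (r * x - 2 * \<delta> * b) + r * \<delta> * (2 * b + 2 * p * y) - 2 * \<delta> * p * (2 * p * x + r * y)"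
          by (simp_all add: power2_eq_square algebra_simps)
        then have "(r\<^sup>2 - 4 * \<delta> * p\<^sup>2) * y = 0"
            "(r\<^sup>2 - 4 * \<delta> * p\<^sup>2) * x = 0"
          unfolding that by simp_all
        then show ?thesis using nd by simp
      qed
      from this[of b1 y1 x1] this[of b2 y2 x2] show ?thesis using a1 a2 a5 a6 e1 e2 True m by simp
    qed
  next
    case n: False
    \<comment> \<open>If \<open>q\<close> is a zero divisor, \<open>\<rho>\<close> is a square root of \<open>\<delta>\<close>.\<close>
    define \<rho> where "\<rho> = m / n"
    have m: "m = \<rho> * n" using n by (simp add: \<rho>_def)
    have "n * (x1 + 3 * \<rho> * y1) = 0" "n * (x2 + 3 * \<rho> * y2) = 0"
      using b1(2) b2(2) by (simp_all add: m algebra_simps)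
    then have x: "x1 = - 3 * \<rho> * y1" "x2 = - 3 * \<rho> * y2" using n by simp_all
    have "3 * n * (y1 * (\<delta> - \<rho>\<^sup>2)) = 0"
        "3 * n * (y2 * (\<delta> - \<rho>\<^sup>2)) = 0"
      using b1(1) b2(1) by (simp_all add: m x power2_eq_square algebra_simps)
    then have y: "y1 = 0 \<or> \<delta> = \<rho>\<^sup>2" "y2 = 0 \<or> \<delta> = \<rho>\<^sup>2" using n
        by simp_all
    show ?thesis
    proof (cases "\<delta> = \<rho>\<^sup>2")
      case False
      then show ?thesis using x y by simp
    next
      case d: True
      show ?thesis
      proof (cases "\<rho> = 0")
        case True
        then show ?thesis using x d a2 a6 m nd by simp
      next
        case \<rho>: False
        have "\<rho> * (2 * \<rho> * b2 + 3 * r * y2) = 0" using e2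
          by (simp add: x d power2_eq_square algebra_simps)
        then have b: "2 * \<rho> * b2 = - 3 * r * y2" using \<rho> by simp
        have "\<rho> * n = 2 * p * \<rho> * y2 - 3 * r * y2"
          using b by (simp add: a5[symmetric] algebra_simps)
        moreover have "\<rho> * n = r * y2 - 6 * p * \<rho> * y2"
          using a6 by (simp add: m x algebra_simps)
        moreover have "4 * y2 * (r - 2 * p * \<rho>) =
            (r * y2 - 6 * p * \<rho> * y2) - (2 * p * \<rho> * y2 - 3 * r * y2)"
          by (simp add: algebra_simps)
        ultimately have "4 * y2 * (r - 2 * p * \<rho>) = 0" by simp
        moreover have "r \<noteq> 2 * p * \<rho>" using nd d by (auto simp: power_mult_distrib)
        ultimately have "y2 = 0" by simp
        then have "n = 0" using b a5 \<rho> by simp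
        then show ?thesis using n by simp
      qed
    qed
  qed
qed

section \<open>Metric Lie algebras with the curvature of a conformally flat space\<close>

text \<open>\<open>\<Gamma> x y\<close> is the covariant derivative of the left-invariant field \<open>y\<close> in the direction \<open>x\<close>, and \<open>S\<close>
  the Schouten operator. The Lie bracket is \<open>\<Gamma> x y - \<Gamma> y x\<close>, as the connection is torsion-free.\<close>

locale conformally_flat_lie_algebra = bilinear_form +
  fixes \<Gamma> :: "real ^ 4 \<Rightarrow> real ^ 4 \<Rightarrow> real ^ 4" and S ::
      "real ^ 4 \<Rightarrow> real ^ 4"
  assumes bil: "bilinear \<Gamma>"
    and skew: "\<eta> (\<Gamma> x y) z = - \<eta> y (\<Gamma> x z)"
    and lin: "linear S"
    and self_adjoint: "\<eta> (S x) y = \<eta> x (S y)"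
    and curv: "\<Gamma> x (\<Gamma> y z) - \<Gamma> y (\<Gamma> x z) - \<Gamma> (\<Gamma> x y - \<Gamma> y x) z =
      \<eta> y z *\<^sub>R S x - \<eta> x z *\<^sub>R S y + \<eta> (S y) z *\<^sub>R x - \<eta> (S x) z *\<^sub>R y"
begin

lemmas Gamma_simps = bilinear_ladd[OF bil] bilinear_radd[OF bil] bilinear_lmul[OF bil]
  bilinear_rmul[OF bil] bilinear_lneg[OF bil] bilinear_rneg[OF bil] bilinear_lsub[OF bil]
  bilinear_rsub[OF bil] bilinear_lzero[OF bil] bilinear_rzero[OF bil]
lemmas S_simps = linear_add[OF lin] linear_diff[OF lin] linear_cmul[OF lin] linear_neg[OF lin]
  linear_0[OF lin]

definition br where "br x y = \<Gamma> x y - \<Gamma> y x"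
text \<open>The obstruction \<open>(\<nabla>\<^sub>x S) y - (\<nabla>\<^sub>y S) x\<close> to \<open>S\<close> being a Codazzi tensor.\<close>

definition C where "C x y = (\<Gamma> x (S y) - S (\<Gamma> x y)) - (\<Gamma> y (S x) - S (\<Gamma> y x))"

text \<open>The left side is the cyclic sum of \<open>R(x, y) z\<close>, and the curvature formula satisfies the first
  Bianchi identity because \<open>S\<close> is self-adjoint.\<close>

lemma jacobi: "br x (br y z) + br y (br z x) + br z (br x y) = 0"
proof -
  have "br x (br y z) + br y (br z x) + br z (br x y) =
    (\<Gamma> x (\<Gamma> y z) - \<Gamma> y (\<Gamma> x z) - \<Gamma> (\<Gamma> x y - \<Gamma> y x) z) +
    (\<Gamma> y (\<Gamma> z x) - \<Gamma> z (\<Gamma> y x) - \<Gamma> (\<Gamma> y z - \<Gamma> z y) x) +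
    (\<Gamma> z (\<Gamma> x y) - \<Gamma> x (\<Gamma> z y) - \<Gamma> (\<Gamma> z x - \<Gamma> x z) y)"
    by (simp add: br_def Gamma_simps algebra_simps)
  also have "\<dots> = 0"
    unfolding curv
    using sym[of y x] sym[of z x] sym[of z y] self_adjoint[of y x] self_adjoint[of z x]
      self_adjoint[of z y] sym[of y "S x"] sym[of z "S x"] sym[of z "S y"]
    by (simp add: algebra_simps)
  finally show ?thesis .
qed

text \<open>The cyclic sum of \<open>(\<nabla>\<^sub>x R)(y, z) w\<close> vanishes formally, up to a term that the Jacobi identity
  removes. Since \<open>\<Gamma> x\<close> is skew, \<open>\<nabla>\<^sub>x R\<close> is given by the curvature formula with \<open>\<nabla>\<^sub>x S\<close> in place of
  \<open>S\<close>.\<close>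

lemma second_bianchi:
  "\<eta> z w *\<^sub>R C x y + \<eta> x w *\<^sub>R C y z + \<eta> y w *\<^sub>R C z x =
   \<eta> (C x y) w *\<^sub>R z + \<eta> (C y z) w *\<^sub>R x + \<eta> (C z x) w *\<^sub>R y"
proof -
  define R where "R x y z = \<eta> y z *\<^sub>R S x - \<eta> x z *\<^sub>R S y + \<eta> (S y) z *\<^sub>R x - \<eta> (S x) z *\<^sub>R y"
    for x y z
  have R: "R x y z = \<Gamma> x (\<Gamma> y z) - \<Gamma> y (\<Gamma> x z) - \<Gamma> (br x y) z"
      for x y z
    using curv by (simp add: R_def br_def)
  have "(\<Gamma> x (R y z w) - R y z (\<Gamma> x w) - R (br x y) z w) +
    (\<Gamma> y (R z x w) - R z x (\<Gamma> y w) - R (br y z) x w) +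
    (\<Gamma> z (R x y w) - R x y (\<Gamma> z w) - R (br z x) y w) =
    \<Gamma> (br (br x y) z + br (br y z) x + br (br z x) y) w"
    unfolding R by (simp add: Gamma_simps algebra_simps)
  also have "br (br x y) z + br (br y z) x + br (br z x) y = 0"
    using jacobi[of x y z] by (simp add: br_def Gamma_simps algebra_simps)
  finally have "(\<Gamma> x (R y z w) - R y z (\<Gamma> x w) - R (br x y) z w) +
    (\<Gamma> y (R z x w) - R z x (\<Gamma> y w) - R (br y z) x w) +
    (\<Gamma> z (R x y w) - R x y (\<Gamma> z w) - R (br z x) y w) = 0"
    by (simp add: Gamma_simps)
  then show ?thesis
    using skew[of _ _ w]
    by (simp add: R_def C_def br_def Gamma_simps S_simps eta_simps algebra_simps)
qed

lemma bilinear_C: "bilinear C"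
  unfolding bilinear_def C_def by (auto intro!: linearI simp: Gamma_simps S_simps algebra_simps)

text \<open>Contraction of the second Bianchi identity over \<open>z\<close> and \<open>w\<close> expresses \<open>C\<close> by its trace \<open>t\<close> (this
  uses that the dimension exceeds three), and contracting once more gives \<open>t = 0\<close>.\<close>

lemma codazzi:
  assumes hyp: "hyperbolic u1 u2 v1 v2"
  shows "C x y = 0"
proof -
  note h = hyperbolicD[OF hyp]
  note c = bilinear_radd[OF bilinear_C] bilinear_rmul[OF bilinear_C]
  note cl = bilinear_ladd[OF bilinear_C] bilinear_lmul[OF bilinear_C]
  define t where "t x = \<eta> (C x u1) v1 + \<eta> (C x u2) v2 + \<eta> (C x v1) u1 + \<eta> (C x v2) u2"
      for x
  have anti: "C y x = - C x y" for x y by (simp add: C_def)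
  have ex: "\<eta> x v1 *\<^sub>R C y u1 + \<eta> x v2 *\<^sub>R C y u2 + \<eta> x u1 *\<^sub>R C y v1 + \<eta> x u2 *\<^sub>R C y v2 = C y x" for x y
    using arg_cong[OF hyperbolic_expansion[OF hyp, of x], of "C y"] by (simp add: c)
  have ex': "\<eta> x v1 *\<^sub>R C u1 y + \<eta> x v2 *\<^sub>R C u2 y + \<eta> x u1 *\<^sub>R C v1 y + \<eta> x u2 *\<^sub>R C v2 y = C x y" for x y
    using arg_cong[OF hyperbolic_expansion[OF hyp, of x], of "\<lambda>z. C z y"] by (simp add: cl)
  have main: "C x y = t y *\<^sub>R x - t x *\<^sub>R y" for x y
  proof -
    note b = second_bianchi[of u1 v1 x y] second_bianchi[of u2 v2 x y]
       second_bianchi[of v1 u1 x y] second_bianchi[of v2 u2 x y]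
    have "4 *\<^sub>R C x y + (\<eta> x v1 *\<^sub>R C y u1 + \<eta> x v2 *\<^sub>R C y u2 + \<eta> x u1 *\<^sub>R C y v1 + \<eta> x u2 *\<^sub>R C y v2)
      + (\<eta> y v1 *\<^sub>R C u1 x + \<eta> y v2 *\<^sub>R C u2 x + \<eta> y u1 *\<^sub>R C v1 x + \<eta> y u2 *\<^sub>R C v2 x)
      = (\<eta> (C x y) v1 *\<^sub>R u1 + \<eta> (C x y) v2 *\<^sub>R u2 + \<eta> (C x y) u1 *\<^sub>R v1 + \<eta> (C x y) u2 *\<^sub>R v2)
       + t y *\<^sub>R x + (\<eta> (C u1 x) v1 + \<eta> (C u2 x) v2 + \<eta> (C v1 x) u1 + \<eta> (C v2 x) u2) *\<^sub>R y"
      using arg_cong2[OF arg_cong2[OF b(1) b(2), of "(+)"] arg_cong2[OF b(3) b(4), of "(+)"], of "(+)"]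
      by (simp add: h t_def algebra_simps vec_times_numeral)
    also have "\<eta> (C u1 x) v1 + \<eta> (C u2 x) v2 + \<eta> (C v1 x) u1 + \<eta> (C v2 x) u2 = - t x"
      unfolding t_def by (simp add: anti[of x u1] anti[of x u2] anti[of x v1] anti[of x v2] eta_simps)
    also have "\<eta> (C x y) v1 *\<^sub>R u1 + \<eta> (C x y) v2 *\<^sub>R u2 + \<eta> (C x y) u1 *\<^sub>R v1 + \<eta> (C x y) u2 *\<^sub>R v2 = C x y"
      using hyperbolic_expansion[OF hyp, of "C x y"] by simp
    finally have "4 *\<^sub>R C x y + C y x + C y x = C x y + t y *\<^sub>R x - t x *\<^sub>R y"
      unfolding ex ex' by simp
    moreover have "4 *\<^sub>R C x y + C y x + C y x = C x y + C x y"
      unfolding anti[of x y] by (simp add: algebra_simps scaleR_2[symmetric] flip: scaleR_left.add)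
    ultimately show ?thesis by (simp add: algebra_simps)
  qed
  have tlin: "t x = \<eta> x v1 * t u1 + \<eta> x v2 * t u2 + \<eta> x u1 * t v1 + \<eta> x u2 * t v2"
      for x
    using arg_cong[OF hyperbolic_expansion[OF hyp, of x], of t]
        by (simp add: t_def cl eta_simps algebra_simps)
  have "t x = 0" for x
    using t_def[of x] tlin[of x] unfolding main by (simp add: eta_simps h algebra_simps)
  then show ?thesis using main by simp
qed

text \<open>The basis is adapted to a parallel null plane spanned by \<open>u1\<close> and \<open>u2\<close>, on which \<open>S\<close> acts with
  square \<open>\<delta>\<close>; \<open>p\<close> and \<open>r\<close> are the remaining entries of \<open>S\<close>.

  The matrix entries \<open>a11\<close>, \<open>a21\<close>, \<open>a12\<close>, \<open>a22\<close> of \<open>\<Gamma> x\<close> on the plane and the number \<open>be x\<close> determine the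
  skew operator \<open>\<Gamma> x\<close>. The Codazzi equations for pairs \<open>(u\<^sub>k, v\<^sub>i)\<close> say that \<open>\<Gamma> u\<^sub>k\<close> commutes with \<open>S\<close>
  on the plane and express the commutators of \<open>\<Gamma> v\<^sub>i\<close> with \<open>S\<close>
      by \<open>\<Gamma> u\<^sub>k\<close>. The curvature equations
  modulo operators commuting with \<open>S\<close> complete the system solved above, so that \<open>\<Gamma> u\<^sub>k\<close> vanishes on
  the plane. But then so does \<open>R(u2, v1)\<close>, which acts there as the identity.\<close>

lemma parallel_plane_normal_form_contradiction:
  assumes hyp: "hyperbolic u1 u2 v1 v2"
    and Su: "S u1 = \<delta> *\<^sub>R u2" "S u2 = u1"
    and Sv: "S v1 = v2 + p *\<^sub>R u2" "S v2 = \<delta> *\<^sub>R v1 + p *\<^sub>R u1 + r *\<^sub>R u2"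
    and par: "\<And>x. \<eta> (\<Gamma> x u1) u1 = 0" "\<And>x. \<eta> (\<Gamma> x u1) u2 = 0"
       "\<And>x. \<eta> (\<Gamma> x u2) u1 = 0" "\<And>x. \<eta> (\<Gamma> x u2) u2 = 0"
    and nd: "r\<^sup>2 \<noteq> 4 * \<delta> * p\<^sup>2"
  shows False
proof -
  note h = hyperbolicD[OF hyp]
  define a11 where "a11 x = \<eta> (\<Gamma> x u1) v1" for x
  define a21 where "a21 x = \<eta> (\<Gamma> x u1) v2" for x
  define a12 where "a12 x = \<eta> (\<Gamma> x u2) v1" for x
  define a22 where "a22 x = \<eta> (\<Gamma> x u2) v2" for x
  define be where "be x = \<eta> (\<Gamma> x v2) v1" for x
  note d = a11_def a21_def a12_def a22_def be_def
  have Gu1: "\<Gamma> x u1 = a11 x *\<^sub>R u1 + a21 x *\<^sub>R u2" for x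
    using hyperbolic_expansion[OF hyp, of "\<Gamma> x u1"] by (simp add: par d)
  have Gu2: "\<Gamma> x u2 = a12 x *\<^sub>R u1 + a22 x *\<^sub>R u2" for x
    using hyperbolic_expansion[OF hyp, of "\<Gamma> x u2"] by (simp add: par d)
  have vv: "\<eta> (\<Gamma> x v) v = 0" for x v using skew[of x v v] sym[of "\<Gamma> x v" v] by simp
  have Gv1: "\<Gamma> x v1 = - be x *\<^sub>R u2 - a11 x *\<^sub>R v1 - a12 x *\<^sub>R v2" for x
    using hyperbolic_expansion[OF hyp, of "\<Gamma> x v1"] skew[of x v1 u1] skew[of x v1 u2] skew[of x v1 v2]
      sym[of v1] sym[of v2] by (simp add: vv d)
  have Gv2: "\<Gamma> x v2 = be x *\<^sub>R u1 - a21 x *\<^sub>R v1 - a22 x *\<^sub>R v2" for x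
    using hyperbolic_expansion[OF hyp, of "\<Gamma> x v2"] skew[of x v2 u1] skew[of x v2 u2]
      sym[of v2] by (simp add: vv d)
  note G = Gu1 Gu2 Gv1 Gv2
  have cod: "\<eta> (C x y) z = 0" for x y z using codazzi[OF hyp] by (simp add: eta_simps)
  have alin: "a11 (x + y) = a11 x + a11 y" "a11 (x - y) = a11 x - a11 y" "a11 (c *\<^sub>R x) = c * a11 x"
      "a11 (- x) = - a11 x"
    "a21 (x + y) = a21 x + a21 y" "a21 (x - y) = a21 x - a21 y" "a21 (c *\<^sub>R x) = c * a21 x" "a21 (- x) =
        - a21 x"
    "a12 (x + y) = a12 x + a12 y" "a12 (x - y) = a12 x - a12 y" "a12 (c *\<^sub>R x) = c * a12 x" "a12 (- x) =
        - a12 x"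
    "a22 (x + y) = a22 x + a22 y" "a22 (x - y) = a22 x - a22 y" "a22 (c *\<^sub>R x) = c * a22 x" "a22 (- x) =
        - a22 x" for x y c
    by (simp_all add: d Gamma_simps eta_simps)
  note cs = vec_times_numeral alin C_def Su Sv G Gamma_simps S_simps eta_simps h algebra_simps
  have cx: "a21 u1 = \<delta> * a12 u1" "a21 u2 = \<delta> * a12 u2" "a22 u1 = a11 u1" "a22 u2 = a11 u2"
    using cod[of u1 v1 u1] cod[of u1 v1 u2] cod[of u2 v1 u1] cod[of u2 v1 u2] by (simp_all add: cs)
  define n1 where "n1 = a11 v1 - a22 v1"
  define m1 where "m1 = a21 v1 - \<delta> * a12 v1"
  have T1: "2 * be u1 + 2 * p * a12 u1 = - m1" "2 * p * a11 u1 + r * a12 u1 = - \<delta> * n1"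
    "2 * p * \<delta> * a12 u1 + 2 * r * a11 u1 - 2 * \<delta> * be u1 = - \<delta> * (a11 v2 - a22 v2)"
    using cod[of u1 v1 v1] cod[of u1 v1 v2] cod[of u1 v2 v2]
    by (simp_all add: cs cx n1_def m1_def)
  have T2: "2 * be u2 + 2 * p * a12 u2 = n1" "2 * p * a11 u2 + r * a12 u2 = m1"
    "a11 v2 - a22 v2 = 2 * p * a11 u2 + r * a12 u2"
    "2 * p * \<delta> * a12 u2 + 2 * r * a11 u2 - 2 * \<delta> * be u2 = a21 v2 - \<delta> * a12 v2"
    "a21 v2 - \<delta> * a12 v2 = - (2 * p * a11 u1 + r * a12 u1)"
    using cod[of u2 v1 v1] cod[of u2 v1 v2] cod[of u2 v2 v1] cod[of u2 v2 v2] cod[of u1 v2 v1]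
    by (simp_all add: cs cx n1_def m1_def)
  have n2: "a11 v2 - a22 v2 = m1" and m2: "a21 v2 - \<delta> * a12 v2 = \<delta> * n1"
    using T1 T2 by simp_all
  have R: "\<eta> (\<Gamma> x (\<Gamma> y z) - \<Gamma> y (\<Gamma> x z) - \<Gamma> (\<Gamma> x y - \<Gamma> y x) z) w =
      \<eta> (\<eta> y z *\<^sub>R S x - \<eta> x z *\<^sub>R S y + \<eta> (S y) z *\<^sub>R x - \<eta> (S x) z *\<^sub>R y) w" for x y z w
   using curv by simp
  have R1: "a11 u1 * m1 + 3 * \<delta> * a12 u1 * n1 = 0" "a11 u1 * n1 + 3 * a12 u1 * m1 = 0"
  proof -
    note e11 = R[of u1 v1 u1 v1, simplified cs, unfolded cx]
    note e12 = R[of u1 v1 u2 v1, simplified cs, unfolded cx]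
    note e21 = R[of u1 v1 u1 v2, simplified cs, unfolded cx]
    note e22 = R[of u1 v1 u2 v2, simplified cs, unfolded cx]
    show "a11 u1 * m1 + 3 * \<delta> * a12 u1 * n1 = 0"
      using e21 arg_cong[OF e12, of "\<lambda>t. \<delta> * t"] arg_cong[OF m2, of "\<lambda>t. a12 u1 * t"]
      unfolding n1_def m1_def by (simp only: real_scaleR_def algebra_simps mult_zero_left mult_zero_right mult_1 mult_1_right, linarith?)
    show "a11 u1 * n1 + 3 * a12 u1 * m1 = 0"
      using e11 e22 arg_cong[OF n2, of "\<lambda>t. a12 u1 * t"]
      unfolding n1_def m1_def by (simp only: real_scaleR_def algebra_simps mult_zero_left mult_zero_right mult_1 mult_1_right, linarith?)
  qed
  have R2: "a11 u2 * m1 + 3 * \<delta> * a12 u2 * n1 = 0" "a11 u2 * n1 + 3 * a12 u2 * m1 = 0"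
  proof -
    note e11 = R[of u2 v1 u1 v1, simplified cs, unfolded cx]
    note e12 = R[of u2 v1 u2 v1, simplified cs, unfolded cx]
    note e21 = R[of u2 v1 u1 v2, simplified cs, unfolded cx]
    note e22 = R[of u2 v1 u2 v2, simplified cs, unfolded cx]
    show "a11 u2 * m1 + 3 * \<delta> * a12 u2 * n1 = 0"
      using e21 arg_cong[OF e12, of "\<lambda>t. \<delta> * t"] arg_cong[OF m2, of "\<lambda>t. a12 u2 * t"]
      unfolding n1_def m1_def by (simp only: real_scaleR_def algebra_simps mult_zero_left mult_zero_right mult_1 mult_1_right, linarith?)
    show "a11 u2 * n1 + 3 * a12 u2 * m1 = 0"
      using e11 e22 arg_cong[OF n2, of "\<lambda>t. a12 u2 * t"]
      unfolding n1_def m1_def by (simp only: real_scaleR_def algebra_simps mult_zero_left mult_zero_right mult_1 mult_1_right, linarith?)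
  qed
  have "a11 u1 = 0 \<and> a12 u1 = 0 \<and> a11 u2 = 0 \<and> a12 u2 = 0"
    by (rule codazzi_curvature_system[OF T1(1,2) T1(3)[unfolded n2] T2(1,2) T2(4)[unfolded m2] R1 R2 nd])
  then show False
    using R[of u2 v1 u1 v1, simplified cs] cx by simp
qed

text \<open>Let \<open>\<sigma> = \<alpha> + i \<beta>\<close> be the square root of \<open>\<delta>\<close> with \<open>r = - 2 \<sigma> p\<close>. Then \<open>u1 + \<sigma> u2\<close> and
  \<open>\<sigma> v1 + v2 - p u2\<close> are eigenvectors for \<open>\<sigma>\<close>; the vectors below are their real and imaginary parts.\<close>

lemma normal_form_derogatory:
  assumes hyp: "hyperbolic u1 u2 v1 v2"
    and Su: "S u1 = \<delta> *\<^sub>R u2" "S u2 = u1"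
    and Sv: "S v1 = v2 + p *\<^sub>R u2" "S v2 = \<delta> *\<^sub>R v1 + p *\<^sub>R u1 + r *\<^sub>R u2"
    and deg: "r\<^sup>2 = 4 * \<delta> * p\<^sup>2"
  shows "derogatory S"
proof -
  note h = hyperbolicD[OF hyp]
  obtain \<alpha> \<beta> where ab: "\<delta> = \<alpha>\<^sup>2 - \<beta>\<^sup>2" "\<alpha> * \<beta> = 0"
      "r = - 2 * \<alpha> * p" "\<beta> * p = 0"
  proof (cases "\<delta> \<ge> 0")
    case True
    have "r\<^sup>2 = (2 * sqrt \<delta> * p)\<^sup>2" using deg True by (simp add: power_mult_distrib)
    then have "r = 2 * sqrt \<delta> * p \<or> r = - (2 * sqrt \<delta> * p)"
        by (simp add: power2_eq_iff)
    then show ?thesis using that[of "sqrt \<delta>" 0] that[of "- sqrt \<delta>" 0] True by auto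
  next
    case False
    then have "4 * \<delta> * p\<^sup>2 \<le> 0" by (simp add: mult_nonpos_nonneg)
    then have r: "r = 0" unfolding deg[symmetric] by simp
    then have "p = 0" using deg False by simp
    then show ?thesis using that[of 0 "sqrt (- \<delta>)"] False r by simp
  qed
  define x1 where "x1 = u1 + \<alpha> *\<^sub>R u2"
  define y1 where "y1 = \<beta> *\<^sub>R u2"
  define x2 where "x2 = \<alpha> *\<^sub>R v1 + v2 - p *\<^sub>R u2"
  define y2 where "y2 = \<beta> *\<^sub>R v1"
  note d = x1_def y1_def x2_def y2_def
  have ab': "\<alpha> = 0 \<or> \<beta> = 0" "\<beta> = 0 \<or> p = 0" using ab by auto
  have ind: "a = 0 \<and> b = 0 \<and> c = 0 \<and> d = 0"
    if z: "a *\<^sub>R x1 - b *\<^sub>R y1 + c *\<^sub>R x2 - d *\<^sub>R y2 = 0"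
        "b *\<^sub>R x1 + a *\<^sub>R y1 + d *\<^sub>R x2 + c *\<^sub>R y2 = 0" for a b c d
  proof -
    have "\<eta> (a *\<^sub>R x1 - b *\<^sub>R y1 + c *\<^sub>R x2 - d *\<^sub>R y2) w = 0"
      "\<eta> (b *\<^sub>R x1 + a *\<^sub>R y1 + d *\<^sub>R x2 + c *\<^sub>R y2) w = 0" for w unfolding z
          by (simp_all add: eta_simps)
    from this[of u2] this[of v1] show ?thesis by (simp add: d eta_simps h)
  qed
  have d2: "\<delta> = \<alpha> * \<alpha> - \<beta> * \<beta>" using ab(1)
      by (simp add: power2_eq_square)
  have "S x1 = \<alpha> *\<^sub>R x1 - \<beta> *\<^sub>R y1" "S y1 =
      \<beta> *\<^sub>R x1 + \<alpha> *\<^sub>R y1"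
    "S x2 = \<alpha> *\<^sub>R x2 - \<beta> *\<^sub>R y2" "S y2 =
        \<beta> *\<^sub>R x2 + \<alpha> *\<^sub>R y2"
    unfolding d using ab(3) ab'
    by (auto simp: S_simps Su Sv d2 algebra_simps vec_times_numeral)
  then show ?thesis using ind by (rule derogatoryI)
qed

text \<open>The curvature operators preserve the plane. Pairing the curvature formula with vectors of the
  plane shows that \<open>S\<close> preserves it with trace zero. If \<open>S\<close> vanishes on the plane, it is derogatory.
  Otherwise the plane has a cyclic vector \<open>u2\<close>, the basis \<open>S u2, u2\<close> can be completed to a normal form
  of \<open>S\<close>, and the normal form is contradictory or derogatory.\<close>

lemma parallel_null_plane_derogatory:
  assumes iso: "\<eta> w1 w1 = 0" "\<eta> w1 w2 = 0" "\<eta> w2 w2 = 0"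
    and ind: "\<And>a b. a *\<^sub>R w1 + b *\<^sub>R w2 = 0 \<Longrightarrow> a = 0 \<and> b = 0"
    and par: "\<And>x. \<eta> (\<Gamma> x w1) w1 = 0" "\<And>x. \<eta> (\<Gamma> x w1) w2 = 0"
       "\<And>x. \<eta> (\<Gamma> x w2) w1 = 0" "\<And>x. \<eta> (\<Gamma> x w2) w2 = 0"
  shows "derogatory S"
proof -
  obtain z1 z2 where hyp: "hyperbolic w1 w2 z1 z2" using hyperbolic_complement[OF iso ind] by blast
  note h = hyperbolicD[OF hyp]
  have inD: "\<Gamma> x w = \<eta> (\<Gamma> x w) z1 *\<^sub>R w1 + \<eta> (\<Gamma> x w) z2 *\<^sub>R w2" if
      "w = w1 \<or> w = w2" for x w
    using that hyperbolic_expansion[OF hyp, of "\<Gamma> x w"] par[of x] by auto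
  have Rz: "\<eta> (\<Gamma> x (\<Gamma> y w) - \<Gamma> y (\<Gamma> x w) - \<Gamma> (\<Gamma> x y - \<Gamma> y x) w) w' = 0"
    if "w = w1 \<or> w = w2" "w' = w1 \<or> w' = w2" for x y w w'
  proof -
    have *: "\<eta> (\<Gamma> x (\<Gamma> y w)) w' = 0" for x y
    proof -
      obtain a b where "\<Gamma> y w = a *\<^sub>R w1 + b *\<^sub>R w2"
        using inD[OF \<open>w = w1 \<or> w = w2\<close>, of y] by blast
      then show ?thesis using that(2) by (auto simp: Gamma_simps eta_simps par)
    qed
    have "\<eta> (\<Gamma> v w) w' = 0" for v using that by (auto simp: par)
    then show ?thesis by (simp add: eta_simps *)
  qed
  have E: "\<eta> y w * \<eta> (S x) w' - \<eta> x w * \<eta> (S y) w' + \<eta> (S y) w * \<eta> x w' - \<eta> (S x) w * \<eta> y w' = 0"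
    if "w = w1 \<or> w = w2" "w' = w1 \<or> w' = w2" for x y w w'
    using Rz[OF that, of x y] unfolding curv by (simp add: eta_simps)
  have s0: "\<eta> (S w1) w1 = 0" "\<eta> (S w1) w2 = 0" "\<eta> (S w2) w2 = 0" "\<eta> (S w2) w1 = 0"
    using E[of w2 w1 z2 w1] E[of w1 w2 z1 w1] E[of w1 w2 z1 w2] E[of w2 w1 z2 w2] by (simp_all add: h)
  define s where "s = \<eta> (S w1) z1"
  define t where "t = \<eta> (S w1) z2"
  define u where "u = \<eta> (S w2) z1"
  have "\<eta> (S z2) w2 + \<eta> (S z1) w1 = 0" using E[of w1 w2 z2 z1] by (simp add: h)
  then have "\<eta> (S w2) z2 = - s" using self_adjoint[of w2 z2] self_adjoint[of w1 z1] sym[of _ "S _"]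
    by (simp add: s_def)
  then have Sw: "S w1 = s *\<^sub>R w1 + t *\<^sub>R w2" "S w2 = u *\<^sub>R w1 - s *\<^sub>R w2"
    using hyperbolic_expansion[OF hyp, of "S w1"] hyperbolic_expansion[OF hyp, of "S w2"]
    by (simp_all add: s0 s_def t_def u_def)
  define \<delta> where "\<delta> = s * s + t * u"
  show ?thesis
  proof (cases "s = 0 \<and> t = 0 \<and> u = 0")
    case True
    then show ?thesis using Sw ind derogatory_real[of S w1 0 w2] by (simp add: linear_0[OF lin])
  next
    case False
    \<comment> \<open>The left side is the determinant of \<open>u2\<close> and \<open>S u2\<close> for \<open>u2 = c w1 + d w2\<close>.\<close>
    obtain c d where cd: "(c * t - d * s) * c - (c * s + d * u) * d \<noteq> 0"
    proof (cases "t = 0 \<and> u = 0")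
      case True
      then show ?thesis using that[of 1 1] False by simp
    next
      case False
      then show ?thesis using that[of 1 0] that[of 0 1] by auto
    qed
    define u2 where "u2 = c *\<^sub>R w1 + d *\<^sub>R w2"
    define u1 where "u1 = (c * s + d * u) *\<^sub>R w1 + (c * t - d * s) *\<^sub>R w2"
    have S2: "S u2 = u1" by (simp add: u1_def u2_def S_simps Sw algebra_simps)
    have S1: "S u1 = \<delta> *\<^sub>R u2"
      by (simp add: u1_def u2_def S_simps Sw \<delta>_def algebra_simps)
    have iso': "\<eta> u1 u1 = 0" "\<eta> u1 u2 = 0" "\<eta> u2 u2 = 0"
      by (simp_all add: u1_def u2_def eta_simps h)
    have par': "\<eta> (\<Gamma> x u1) u1 = 0" "\<eta> (\<Gamma> x u1) u2 = 0"
       "\<eta> (\<Gamma> x u2) u1 = 0" "\<eta> (\<Gamma> x u2) u2 = 0" for x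
      by (simp_all add: u1_def u2_def eta_simps Gamma_simps par)
    have ind': "a = 0 \<and> b = 0" if "a *\<^sub>R u1 + b *\<^sub>R u2 = 0" for a b
    proof -
      define P where "P = c * s + d * u"
      define Q where "Q = c * t - d * s"
      have "(a * P + b * c) *\<^sub>R w1 + (a * Q + b * d) *\<^sub>R w2 = 0"
        using that unfolding u1_def u2_def P_def[symmetric] Q_def[symmetric] by (simp add: algebra_simps)
      from ind[OF this] have 1: "a * P + b * c = 0" "a * Q + b * d = 0" by simp_all
      have "a * (Q * c - P * d) = c * (a * Q + b * d) - d * (a * P + b * c)"
        "b * (Q * c - P * d) = Q * (a * P + b * c) - P * (a * Q + b * d)"
            by (simp_all add: algebra_simps)
      then have "a * (Q * c - P * d) = 0" "b * (Q * c - P * d) = 0" unfolding 1 by simp_all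
      then show ?thesis using cd unfolding P_def[symmetric] Q_def[symmetric] by simp
    qed
    obtain v1' v2' where hyp': "hyperbolic u1 u2 v1' v2'" using hyperbolic_complement[OF iso' ind']
        by blast
    note h' = hyperbolicD[OF hyp']
    \<comment> \<open>This change of the complement makes \<open>\<eta> (S v1) v1\<close> vanish.\<close>
    define b where "b = \<eta> (S v1') v1'"
    define v1 where "v1 = v1' - (b / 2) *\<^sub>R u2"
    define v2 where "v2 = v2' + (b / 2) *\<^sub>R u1"
    have hyp2: "hyperbolic u1 u2 v1 v2"
      unfolding hyperbolic_def by (simp add: v1_def v2_def eta_simps h')
    note h2 = hyperbolicD[OF hyp2]
    have b0: "\<eta> (S v1) v1 = 0"
      using self_adjoint[of v1' u2] by (simp add: v1_def S_simps S2 eta_simps h' b_def[symmetric])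
    define p where "p = \<eta> (S v1) v2"
    define r where "r = \<eta> (S v2) v2"
    have pp: "\<eta> (S v2) v1 = p" using self_adjoint[of v2 v1] sym[of v2 "S v1"] by (simp add: p_def)
    have Sv1: "S v1 = v2 + p *\<^sub>R u2"
      using hyperbolic_expansion[OF hyp2, of "S v1"]
      by (simp add: b0 p_def[symmetric] self_adjoint[of v1 u1] self_adjoint[of v1 u2] S1 S2 eta_simps h2 algebra_simps)
    have Sv2: "S v2 = \<delta> *\<^sub>R v1 + p *\<^sub>R u1 + r *\<^sub>R u2"
      using hyperbolic_expansion[OF hyp2, of "S v2"]
      by (simp add: pp r_def[symmetric] self_adjoint[of v2 u1] self_adjoint[of v2 u2] S1 S2 eta_simps h2 algebra_simps)
    show ?thesis
      using normal_form_derogatory[OF hyp2 S1 S2 Sv1 Sv2]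
        parallel_plane_normal_form_contradiction[OF hyp2 S1 S2 Sv1 Sv2 par'] by blast
  qed
qed

text \<open>\<open>R(x, y) u\<close> is a multiple of \<open>u\<close>. For \<open>x\<close> and \<open>y\<close> orthogonal to \<open>u\<close> this makes \<open>u\<close> an eigenvector of
  \<open>S\<close>, say for \<open>l\<close>; for \<open>y\<close> with \<open>\<eta> u y = 1\<close> it then gives that \<open>S x + l x\<close> is a multiple of \<open>u\<close>
  for all \<open>x\<close> orthogonal to \<open>u\<close>. The multiple is a linear functional of \<open>x\<close>, so that \<open>S + l\<close> has a
  kernel of dimension at least two.\<close>

lemma parallel_null_line_derogatory:
  assumes u: "u \<noteq> 0" "\<eta> u u = 0" and par: "\<And>x. \<exists>c. \<Gamma> x u = c *\<^sub>R u"
  shows "derogatory S"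
proof -
  have fun_inner: "\<exists>b. \<forall>x. f x = b \<bullet> x" if "linear f" for f ::
      "real ^ 4 \<Rightarrow> real"
    using adjoint_works[OF that, of _ 1] by (metis inner_commute inner_real_def mult.right_neutral)
  have leta: "linear (\<eta> v)" for v using bilin by (simp add: bilinear_def)
  obtain a where a: "\<And>x. \<eta> u x = a \<bullet> x" using fun_inner[OF leta] by blast
  have "a \<noteq> 0" using a nondeg[of u] u by auto
  obtain y' where "\<eta> u y' \<noteq> 0" using nondeg[of u] u by auto
  define y0 where "y0 = y' /\<^sub>R \<eta> u y'"
  have y0: "\<eta> u y0 = 1" using \<open>\<eta> u y' \<noteq> 0\<close> by (simp add: y0_def eta_simps)
  have Ru: "\<exists>c. \<eta> y u *\<^sub>R S x - \<eta> x u *\<^sub>R S y + \<eta> (S y) u *\<^sub>R x - \<eta> (S x) u *\<^sub>R y = c *\<^sub>R u" for x y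
  proof -
    obtain k where "\<And>x. \<Gamma> x u = k x *\<^sub>R u" using par by metis
    then have "\<Gamma> x (\<Gamma> y u) - \<Gamma> y (\<Gamma> x u) - \<Gamma> (\<Gamma> x y - \<Gamma> y x) u = (k y * k x - k x * k y - k (\<Gamma> x y - \<Gamma> y x)) *\<^sub>R u"
      by (simp add: Gamma_simps algebra_simps)
    then show ?thesis unfolding curv by blast
  qed
  have Sx: "\<eta> (S x) u = 0" if x: "\<eta> u x = 0" for x
  proof (rule ccontr)
    assume ne: "\<eta> (S x) u \<noteq> 0"
    have "y \<in> Real_Vector_Spaces.span {x, u}" if y: "\<eta> u y = 0" for y
    proof -
      obtain c where "\<eta> (S y) u *\<^sub>R x - \<eta> (S x) u *\<^sub>R y = c *\<^sub>R u"
        using Ru[of y x] x y sym[of _ u] by auto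
      then have "\<eta> (S x) u *\<^sub>R y = \<eta> (S y) u *\<^sub>R x - c *\<^sub>R u"
          by (simp add: algebra_simps)
      then have y: "y = (\<eta> (S y) u *\<^sub>R x - c *\<^sub>R u) /\<^sub>R \<eta> (S x) u" using ne
        by (metis scaleR_one scaleR_scaleR left_inverse)
      show ?thesis by (subst y, intro span_scale span_diff span_base) simp_all
    qed
    then have "{y. a \<bullet> y = 0} \<subseteq> Real_Vector_Spaces.span {x, u}" using a by auto
    then have "Real_Vector_Spaces.dim {y. a \<bullet> y = 0} \<le> Real_Vector_Spaces.dim {x, u}"
        using dim_subset dim_span by metis
    also have "Real_Vector_Spaces.dim {x, u} \<le> card {x, u}" by (rule dim_le_card') simp
    finally have "Real_Vector_Spaces.dim {y. a \<bullet> y = 0} \<le> card {x, u}" .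
    then show False using dim_hyperplane[OF \<open>a \<noteq> 0\<close>]
      by (simp add: card_insert_if split: if_splits)
  qed
  define l where "l = \<eta> (S u) y0"
  have "S u - l *\<^sub>R u = 0"
  proof (rule nondeg)
    fix z
    have "\<eta> u (z - \<eta> u z *\<^sub>R y0) = 0" by (simp add: eta_simps y0)
    from Sx[OF this] have "\<eta> (S u) (z - \<eta> u z *\<^sub>R y0) = 0" by (metis self_adjoint sym)
    then show "\<eta> (S u - l *\<^sub>R u) z = 0" by (simp add: eta_simps l_def)
  qed
  then have Su: "S u = l *\<^sub>R u" by simp
  have k: "S x = - l *\<^sub>R x" if x: "\<eta> u x = 0" "\<eta> (S x + l *\<^sub>R x) y0 = 0" for x
  proof -
    obtain c where "S x + \<eta> (S y0) u *\<^sub>R x = c *\<^sub>R u"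
      using Ru[of y0 x] x Sx[OF x(1)] sym[of _ u] y0 by auto
    moreover have "\<eta> (S y0) u = l" by (metis l_def self_adjoint sym)
    ultimately have c: "S x + l *\<^sub>R x = c *\<^sub>R u" by simp
    then have "c = 0" using x(2) y0 by (simp add: eta_simps)
    then show ?thesis using c by (simp add: add_eq_0_iff2)
  qed
  have lb: "linear (\<lambda>x. \<eta> (S x + l *\<^sub>R x) y0)"
    by (rule linearI) (auto simp: S_simps eta_simps algebra_simps)
  obtain b where b: "\<And>x. \<eta> (S x + l *\<^sub>R x) y0 = b \<bullet> x" using fun_inner[OF lb]
      by blast
  define K where "K = {y \<in> UNIV. \<forall>x \<in> Real_Vector_Spaces.span {a, b}. x \<bullet> y = 0}"
  have "Real_Vector_Spaces.dim K + Real_Vector_Spaces.dim (Real_Vector_Spaces.span {a, b}) =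
      Real_Vector_Spaces.dim (UNIV :: (real ^ 4) set)"
    using dim_subspace_orthogonal_to_vectors[of "Real_Vector_Spaces.span {a, b}" UNIV]
    by (simp add: K_def Linear_Algebra.orthogonal_def)
  moreover have "Real_Vector_Spaces.dim (Real_Vector_Spaces.span {a, b}) \<le> 2"
    using dim_le_card'[of "{a, b}"] by (simp add: card_insert_if split: if_splits)
  ultimately have dK: "2 \<le> Real_Vector_Spaces.dim K" by (simp add: dim_UNIV)
  obtain B where B: "B \<subseteq> K" "independent B" "card B = Real_Vector_Spaces.dim K"
    by (rule basis_exists[of K])
  then have "\<not> card B \<le> Suc 0" using dK by simp
  then obtain x1 x2 where x12: "x1 \<in> B" "x2 \<in> B" "x1 \<noteq> x2"
    using card_le_Suc0_iff_eq[of B] independent_imp_finite[OF B(2)] by blast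
  have "independent {x1, x2}" using independent_mono[OF B(2), of "{x1, x2}"] x12 by simp
  then have i: "c = 0 \<and> d = 0" if "c *\<^sub>R x1 + d *\<^sub>R x2 = 0" for c d
    using that x12(3)
      independentD[OF \<open>independent {x1, x2}\<close>, of "{x1, x2}" "\<lambda>x. if x =
          x1 then c else d" x1]
      independentD[OF \<open>independent {x1, x2}\<close>, of "{x1, x2}" "\<lambda>x. if x =
          x1 then c else d" x2]
    by simp
  have "S x = - l *\<^sub>R x" if "x \<in> K" for x
    using that k[of x] a b by (simp add: K_def span_base)
  then show ?thesis using derogatory_real[of S x1 "- l" x2] x12 B(1) i by (auto simp: linear_0[OF lin])
qed

end

section \<open>The Levi-Civita connection in coordinates\<close>

definition christoffel_map :: "(real ^ 'n \<Rightarrow> real ^ 'n ^ 'n) \<Rightarrow> real ^ 'n \<Rightarrow> real ^ 'n \<Rightarrow> real ^ 'n \<Rightarrow> real ^ 'n::finite" where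
  "christoffel_map h x u v = (\<chi> k. \<Sum>i\<in>UNIV. \<Sum>j\<in>UNIV. christoffel h x k i j * u $ i * v $ j)"

lemma covariant_derivative_christoffel_map:
  "covariant_derivative h X Y x = frechet_derivative Y (at x) (X x) + christoffel_map h x (X x) (Y x)"
  by (simp add: covariant_derivative_def christoffel_map_def)

lemma bilinear_christoffel_map: "bilinear (christoffel_map h x)"
  unfolding bilinear_def christoffel_map_def
  by (auto intro!: linearI simp: Finite_Cartesian_Product.vec_eq_iff sum.distrib sum_distrib_left algebra_simps)

lemma form_sum: "form m u v = (\<Sum>i\<in>UNIV. \<Sum>j\<in>UNIV. m $ i $ j * u $ i * v $ j)"
  by (simp add: form_def inner_vec_def matrix_vector_mult_def sum_distrib_left mult_ac)

lemma form_bilinear: "bilinear (form m)"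
  unfolding bilinear_def form_sum
  by (auto intro!: linearI simp: sum.distrib sum_distrib_left algebra_simps)

lemmas form_simps = bilinear_ladd[OF form_bilinear] bilinear_radd[OF form_bilinear]
  bilinear_lmul[OF form_bilinear] bilinear_rmul[OF form_bilinear] bilinear_lneg[OF form_bilinear]
  bilinear_rneg[OF form_bilinear] bilinear_lsub[OF form_bilinear] bilinear_rsub[OF form_bilinear]
  bilinear_lzero[OF form_bilinear] bilinear_rzero[OF form_bilinear]

lemmas christoffel_map_simps = bilinear_ladd[OF bilinear_christoffel_map] bilinear_radd[OF bilinear_christoffel_map]
  bilinear_lmul[OF bilinear_christoffel_map] bilinear_rmul[OF bilinear_christoffel_map] bilinear_lneg[OF bilinear_christoffel_map]
  bilinear_rneg[OF bilinear_christoffel_map] bilinear_lsub[OF bilinear_christoffel_map] bilinear_rsub[OF bilinear_christoffel_map]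
  bilinear_lzero[OF bilinear_christoffel_map] bilinear_rzero[OF bilinear_christoffel_map]

lemma form_matrix: "form (a + b) u v = form a u v + form b u v"
  "form (c *\<^sub>R a) u v = c * form a u v"
  by (simp_all add: form_sum sum.distrib sum_distrib_left algebra_simps)

lemma linear_form_matrix: "linear (\<lambda>m. form m u v)"
  by (rule linearI) (simp_all add: form_matrix)

lemma form_commute:
  assumes "transpose m = m" shows "form m u v = form m v u"
  unfolding form_def by (metis assms dot_lmul_matrix inner_commute vector_transpose_matrix)

lemma form_nondegenerate:
  assumes "invertible m" "\<And>v. form m v u = 0"
  shows "u = 0"
proof -
  have "m *v u = 0" using assms(2) unfolding form_def by (metis inner_eq_zero_iff)
  then show ?thesis using assms(1)
      by (metis invertible_def matrix_vector_mul_assoc matrix_vector_mul_lid matrix_vector_mult_0_right)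
qed

lemma matrix_inv_mult:
  fixes A :: "real ^ 'n ^ 'n"
  assumes "invertible A" shows "A ** matrix_inv A = Finite_Cartesian_Product.mat 1"
  using someI_ex[OF assms[unfolded invertible_def]] unfolding matrix_inv_def by blast

lemma linear_expand_axis:
  assumes "linear g" shows "g u = (\<Sum>i\<in>UNIV. u $ i *\<^sub>R g (axis i 1))"
proof -
  have "g u = g (\<Sum>i\<in>UNIV. u $ i *\<^sub>R axis i 1)"
    using basis_expansion[of u] by (simp add: scalar_mult_eq_scaleR)
  then show ?thesis using assms by (simp add: linear_sum linear_cmul)
qed

lemma bilinear_expand_axis:
  assumes "bilinear B" shows "B u v =
      (\<Sum>i\<in>UNIV. \<Sum>j\<in>UNIV. (u $ i * v $ j) *\<^sub>R B (axis i 1) (axis j 1))"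
proof -
  have "linear (\<lambda>u. B u v)" "linear (B w)" for w using assms by (auto simp: bilinear_def)
  note l = linear_expand_axis[OF this(1), of u] linear_expand_axis[OF this(2), of _ v]
  show ?thesis by (subst l(1), subst l(2)) (simp add: scaleR_sum_right)
qed

text \<open>The product rule for a bilinear map that itself depends on the point.\<close>

lemma has_derivative_bilinear_field:
  fixes B :: "'a::real_normed_vector \<Rightarrow> real ^ 'n \<Rightarrow> real ^ 'm \<Rightarrow> 'd::real_normed_vector"
  assumes bil: "\<And>y. bilinear (B y)"
    and D: "\<And>a b. ((\<lambda>y. B y a b) has_derivative DB a b) (at x)"
    and f: "(f has_derivative f') (at x)" and g: "(g has_derivative g') (at x)"
  shows "((\<lambda>y. B y (f y) (g y)) has_derivative
    (\<lambda>v. DB (f x) (g x) v + B x (f' v) (g x) + B x (f x) (g' v))) (at x)"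
proof -
  have fi: "((\<lambda>y. f y $ i) has_derivative (\<lambda>v. f' v $ i)) (at x)" for i
    using bounded_linear.has_derivative[OF bounded_linear_vec_nth f] .
  have gi: "((\<lambda>y. g y $ i) has_derivative (\<lambda>v. g' v $ i)) (at x)" for i
    using bounded_linear.has_derivative[OF bounded_linear_vec_nth g] .
  have DBe: "DB a b v = (\<Sum>i\<in>UNIV. \<Sum>j\<in>UNIV. (a $ i * b $ j) *\<^sub>R DB (axis i 1) (axis j 1) v)" for a b v
  proof -
    have "((\<lambda>y. B y a b)
        has_derivative (\<lambda>v. \<Sum>i\<in>UNIV. \<Sum>j\<in>UNIV. (a $ i * b $ j) *\<^sub>R DB (axis i 1) (axis j 1) v)) (at x)"
      by (subst bilinear_expand_axis[OF bil], intro has_derivative_sum has_derivative_scaleR_right D)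
    from has_derivative_unique[OF D this] show ?thesis by metis
  qed
  have "((\<lambda>y. B y (f y) (g y)) has_derivative
    (\<lambda>v. \<Sum>i\<in>UNIV. \<Sum>j\<in>UNIV. (f x $ i * g x $ j) *\<^sub>R DB (axis i 1) (axis j 1) v +
       (f x $ i * g' v $ j + f' v $ i * g x $ j) *\<^sub>R B x (axis i 1) (axis j 1))) (at x)"
    by (subst bilinear_expand_axis[OF bil], intro has_derivative_sum has_derivative_scaleR has_derivative_mult fi gi D)
  moreover have "(\<Sum>i\<in>UNIV. \<Sum>j\<in>UNIV. (f x $ i * g x $ j) *\<^sub>R DB (axis i 1) (axis j 1) v +
       (f x $ i * g' v $ j + f' v $ i * g x $ j) *\<^sub>R B x (axis i 1) (axis j 1)) =
       DB (f x) (g x) v + B x (f' v) (g x) + B x (f x) (g' v)" for v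
    by (subst DBe[of "f x" "g x" v], subst bilinear_expand_axis[OF bil, of x "f' v"], subst bilinear_expand_axis[OF bil, of x "f x"])
      (simp add: sum.distrib scaleR_left_distrib)
  ultimately show ?thesis by simp
qed

lemma det_differentiable:
  fixes A :: "'a::real_normed_vector \<Rightarrow> real ^ 'n ^ 'n"
  assumes "\<And>i j. (\<lambda>y. A y $ i $ j) differentiable (at x)"
  shows "(\<lambda>y. Determinants.det (A y)) differentiable (at x)"
proof -
  obtain D where D: "\<And>i j. ((\<lambda>y. A y $ i $ j) has_derivative D i j) (at x)"
    using assms unfolding differentiable_def by metis
  have "\<exists>D'. ((\<lambda>y. \<Prod>i\<in>UNIV. A y $ i $ p i) has_derivative D') (at x)" for p ::
      "'n \<Rightarrow> 'n"
    using has_derivative_prod[of UNIV "\<lambda>i y. A y $ i $ p i" "\<lambda>i. D i (p i)" x UNIV] D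
        by blast
  then have "(\<lambda>y. \<Prod>i\<in>UNIV. A y $ i $ p i) differentiable (at x)" for p ::
      "'n \<Rightarrow> 'n"
    by (simp add: differentiable_def)
  then show ?thesis unfolding Determinants.det_def
    by (intro differentiable_sum differentiable_mult differentiable_const) auto
qed

text \<open>By Cramer's rule the solution is a quotient of determinants.\<close>

lemma linear_solve_differentiable:
  fixes A :: "'a::real_normed_vector \<Rightarrow> real ^ 'n ^ 'n"
  assumes U: "open U" "x \<in> U"
    and inv: "\<And>y. y \<in> U \<Longrightarrow> invertible (A y)" and eq:
        "\<And>y. y \<in> U \<Longrightarrow> A y *v z y = t y"
    and A: "\<And>i j. (\<lambda>y. A y $ i $ j) differentiable (at x)"
    and t: "\<And>i. (\<lambda>y. t y $ i) differentiable (at x)"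
  shows "z differentiable (at x)"
proof -
  define C where "C k y = (\<chi> i j. if j = k then t y $ i else A y $ i $ j)" for k y
  have z: "Determinants.det (C k y) / Determinants.det (A y) = z y $ k" if "y \<in> U" for k y
    using cramer[of "A y" "z y" "t y"] inv[OF that] eq[OF that] unfolding C_def
    by (simp add: invertible_det_nz)
  have "(\<lambda>y. C k y $ i $ j) differentiable (at x)" for i j k
    using A t by (cases "j = k") (simp_all add: C_def)
  then have d: "(\<lambda>y. Determinants.det (C k y) / Determinants.det (A y)) differentiable (at x)"
      for k
    using inv[OF U(2)] by (intro differentiable_divide det_differentiable A) (simp_all add: invertible_det_nz)
  have "(\<lambda>y. z y $ k) differentiable (at x)" for k
  proof -
    obtain D where "((\<lambda>y. Determinants.det (C k y) / Determinants.det (A y))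
        has_derivative D) (at x)"
      using d unfolding differentiable_def by blast
    then have "((\<lambda>y. z y $ k) has_derivative D) (at x)"
      by (rule has_derivative_transform_within_open[OF _ U]) (rule z)
    then show ?thesis unfolding differentiable_def by blast
  qed
  then have "\<forall>k. \<exists>D. ((\<lambda>y. z y $ k) has_derivative D) (at x)"
      by (simp add: differentiable_def)
  then obtain D where D: "\<And>k. ((\<lambda>y. z y $ k) has_derivative D k) (at x)" by metis
  have "((\<lambda>y. \<Sum>k\<in>UNIV. z y $ k *\<^sub>R axis k (1::real))
      has_derivative (\<lambda>v. \<Sum>k\<in>UNIV. D k v *\<^sub>R axis k 1)) (at x)"
    by (intro has_derivative_sum has_derivative_scaleR_left D)
  then have "(z has_derivative (\<lambda>v. \<Sum>k\<in>UNIV. D k v *\<^sub>R axis k 1)) (at x)"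
    using basis_expansion[of "z _"] by (simp add: scalar_mult_eq_scaleR)
  then show ?thesis unfolding differentiable_def by blast
qed

text \<open>The properties of the component matrix of a metric that do not refer to a signature.\<close>

definition metric_on :: "(real ^ 'n) set \<Rightarrow> (real ^ 'n \<Rightarrow> real ^ 'n ^ 'n) \<Rightarrow> bool" where
  "metric_on U h \<longleftrightarrow> open U \<and> smooth_on U h \<and> (\<forall>x\<in>U. transpose (h x) =
      h x \<and> invertible (h x))"

abbreviation Dm :: "(real ^ 'n \<Rightarrow> real ^ 'n ^ 'n) \<Rightarrow> real ^ 'n \<Rightarrow> real ^ 'n \<Rightarrow> real ^ 'n ^ 'n" where
  "Dm h x \<equiv> frechet_derivative h (at x)"

context
  fixes U :: "(real ^ 'n::finite) set" and h :: "real ^ 'n \<Rightarrow> real ^ 'n ^ 'n"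
  assumes h: "metric_on U h"
begin

lemma metric_on_open: "open U" and metric_on_smooth: "smooth_on U h"
  and metric_on_sym: "x \<in> U \<Longrightarrow> form (h x) u v = form (h x) v u"
  and metric_on_inv: "x \<in> U \<Longrightarrow> invertible (h x)"
  and metric_on_nondeg: "x \<in> U \<Longrightarrow> (\<And>w. form (h x) w u =
      form (h x) w v) \<Longrightarrow> u = v"
proof -
  show "open U" "smooth_on U h" "x \<in> U \<Longrightarrow> form (h x) u v = form (h x) v u"
      "x \<in> U \<Longrightarrow> invertible (h x)"
    using h by (auto simp: metric_on_def intro: form_commute)
  show "x \<in> U \<Longrightarrow> (\<And>w. form (h x) w u = form (h x) w v) \<Longrightarrow> u = v"
    using form_nondegenerate[of "h x" "u - v"] h by (simp add: metric_on_def form_simps)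
qed

lemma has_derivative_metric: "x \<in> U \<Longrightarrow> (h has_derivative Dm h x) (at x)"
  using smooth_on_has_derivative metric_on_open metric_on_smooth by blast

lemma has_derivative_metric_entry: "x \<in> U \<Longrightarrow> ((\<lambda>y. h y $ i $ j)
    has_derivative (\<lambda>v. Dm h x v $ i $ j)) (at x)"
  using bounded_linear.has_derivative[OF bounded_linear_vec_nth bounded_linear.has_derivative[OF bounded_linear_vec_nth has_derivative_metric]] .

lemma has_derivative_form: "x \<in> U \<Longrightarrow> ((\<lambda>y. form (h y) a b)
    has_derivative (\<lambda>v. form (Dm h x v) a b)) (at x)"
  using bounded_linear.has_derivative[OF linear_linear[THEN iffD2, OF linear_form_matrix] has_derivative_metric] .

lemma Dm_linear: "x \<in> U \<Longrightarrow> linear (Dm h x)"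
  using has_derivative_metric has_derivative_linear by blast

lemma Dm_sym: assumes x: "x \<in> U" shows "form (Dm h x v) a b = form (Dm h x v) b a"
proof -
  have "((\<lambda>y. form (h y) b a) has_derivative (\<lambda>v. form (Dm h x v) a b)) (at x)"
    by (rule has_derivative_transform_within_open[OF has_derivative_form[OF x] metric_on_open x]) (rule metric_on_sym)
  from has_derivative_unique[OF this has_derivative_form[OF x]] show ?thesis by metis
qed

text \<open>The defining formula of the Christoffel symbols, freed of the inverse matrix. All properties of
  the connection are derived from this identity.\<close>

lemma form_christoffel_map:
  assumes x: "x \<in> U"
  shows "form (h x) w (christoffel_map h x u v) =
    (form (Dm h x u) v w + form (Dm h x v) u w - form (Dm h x w) u v) / 2"
proof -
  have pd: "pderiv_at i (\<lambda>y. h y $ j $ l) x = Dm h x (axis i 1) $ j $ l" for i j l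
    unfolding pderiv_at_def using frechet_derivative_at[OF has_derivative_metric_entry[OF x], of j l]
        by metis
  define t where "t = (\<chi> l. (form (Dm h x u) v (axis l 1) + form (Dm h x v) u (axis l 1) - form (Dm h x (axis l 1)) u v) / 2)"
  have fa: "form m a (axis l 1) = (\<Sum>j\<in>UNIV. m $ j $ l * a $ j)" for m ::
      "real ^ 'n ^ 'n" and a l
    unfolding form_sum by (simp add: axis_def if_distrib cong: if_cong)
  have De: "Dm h x a $ j $ l = (\<Sum>i\<in>UNIV. a $ i * Dm h x (axis i 1) $ j $ l)" for a j l
  proof -
    have "linear (\<lambda>a. Dm h x a $ j $ l)"
      using Dm_linear[OF x] by (auto intro!: linearI simp: linear_add linear_cmul)
    from linear_expand_axis[OF this, of a] show ?thesis by simp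
  qed
  have tl: "t $ l = (1 / 2) * (\<Sum>i\<in>UNIV. \<Sum>j\<in>UNIV. (Dm h x (axis i 1) $ j $ l + Dm h x (axis j 1) $ i $ l
      - Dm h x (axis l 1) $ i $ j) * u $ i * v $ j)" for l
  proof -
    have "form (Dm h x u) v (axis l 1) =
        (\<Sum>j\<in>UNIV. \<Sum>i\<in>UNIV. Dm h x (axis i 1) $ j $ l * u $ i * v $ j)"
      unfolding fa De[of u] by (simp add: sum_distrib_left sum_distrib_right mult_ac)
    also have "\<dots> = (\<Sum>i\<in>UNIV. \<Sum>j\<in>UNIV. Dm h x (axis i 1) $ j $ l * u $ i * v $ j)"
      by (rule sum.swap)
    finally have 1: "form (Dm h x u) v (axis l 1) = \<dots>" .
    have 2: "form (Dm h x v) u (axis l 1) =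
        (\<Sum>i\<in>UNIV. \<Sum>j\<in>UNIV. Dm h x (axis j 1) $ i $ l * u $ i * v $ j)"
      unfolding fa De[of v] by (simp add: sum_distrib_left sum_distrib_right mult_ac)
    show ?thesis
      by (simp add: t_def 1 2 form_sum[of "Dm h x (axis l 1)"] sum.distrib sum_subtractf algebra_simps add_divide_distrib diff_divide_distrib)
  qed
  have c: "christoffel_map h x u v = matrix_inv (h x) *v t"
  proof -
    have "christoffel_map h x u v $ k = (matrix_inv (h x) *v t) $ k" for k
    proof -
      have "christoffel_map h x u v $ k =
          (\<Sum>i\<in>UNIV. \<Sum>j\<in>UNIV. \<Sum>l\<in>UNIV. matrix_inv (h x) $ k $ l * ((1 / 2) *
         ((Dm h x (axis i 1) $ j $ l + Dm h x (axis j 1) $ i $ l - Dm h x (axis l 1) $ i $ j) * u $ i * v $ j)))"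
        by (simp add: christoffel_map_def christoffel_def pd sum_distrib_left sum_distrib_right mult_ac)
      also have "\<dots> = (\<Sum>l\<in>UNIV. \<Sum>i\<in>UNIV. \<Sum>j\<in>UNIV. matrix_inv (h x) $ k $ l * ((1 / 2) *
         ((Dm h x (axis i 1) $ j $ l + Dm h x (axis j 1) $ i $ l - Dm h x (axis l 1) $ i $ j) * u $ i * v $ j)))"
        by (subst sum.swap[of _ UNIV UNIV], subst (2) sum.swap) (rule refl)
      also have "\<dots> = (matrix_inv (h x) *v t) $ k"
        unfolding matrix_vector_mult_def tl by (simp add: sum_distrib_left mult_ac)
      finally show ?thesis .
    qed
    then show ?thesis by (simp add: Finite_Cartesian_Product.vec_eq_iff)
  qed
  have "h x *v (matrix_inv (h x) *v t) = t"
    using matrix_inv_mult[OF metric_on_inv[OF x]] by (simp add: matrix_vector_mul_assoc)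
  then have "form (h x) w (christoffel_map h x u v) = w \<bullet> t" by (simp add: form_def c)
  also have "\<dots> = (form (Dm h x u) v w + form (Dm h x v) u w - form (Dm h x w) u v) / 2"
  proof -
    have "linear (\<lambda>w. (form (Dm h x u) v w + form (Dm h x v) u w - form (Dm h x w) u v) / 2)"
      by (rule linearI) (simp_all add: form_simps form_matrix linear_add[OF Dm_linear[OF x]] linear_cmul[OF Dm_linear[OF x]] field_simps)
    from linear_expand_axis[OF this, of w] show ?thesis by (simp add: inner_vec_def t_def)
  qed
  finally show ?thesis .
qed

lemma christoffel_map_commute: assumes x: "x \<in> U" shows "christoffel_map h x u v =
    christoffel_map h x v u"
  by (rule metric_on_nondeg[OF x]) (simp add: form_christoffel_map[OF x] Dm_sym[OF x, of _ u v])

lemma Dm_christoffel_map: assumes x: "x \<in> U"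
  shows "form (Dm h x w) u v = form (h x) (christoffel_map h x w u) v + form (h x) u (christoffel_map h x w v)"
  unfolding metric_on_sym[OF x, of "christoffel_map h x w u" v] form_christoffel_map[OF x]
  using Dm_sym[OF x, of w u v] Dm_sym[OF x, of u w v] Dm_sym[OF x, of v w u] by (simp add: field_simps)

text \<open>The Christoffel symbols solve a linear system whose coefficients are the entries of the metric
  and whose right side consists of their derivatives.\<close>

lemma christoffel_map_differentiable: assumes x: "x \<in> U" shows
    "(\<lambda>y. christoffel_map h y u v) differentiable (at x)"
proof (rule linear_solve_differentiable[OF metric_on_open x metric_on_inv])
  show "h y *v christoffel_map h y u v =
      (\<chi> l. (form (Dm h y u) v (axis l 1) + form (Dm h y v) u (axis l 1) - form (Dm h y (axis l 1)) u v) / 2)"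
    if "y \<in> U" for y
    unfolding Finite_Cartesian_Product.vec_eq_iff
    using form_christoffel_map[OF that, of "axis _ 1" u v] by (simp add: form_def inner_axis')
  show "(\<lambda>y. h y $ i $ j) differentiable (at x)" for i j
    using has_derivative_metric_entry[OF x] unfolding differentiable_def by blast
  have d: "(\<lambda>y. form (Dm h y c) a b) differentiable (at x)" for a b c
    using bounded_linear.has_derivative[OF linear_linear[THEN iffD2, OF linear_form_matrix]
      smooth_on_has_derivative[OF metric_on_open smooth_on_frechet_derivative[OF metric_on_open metric_on_smooth] x]]
    unfolding differentiable_def by blast
  then show "(\<lambda>y. (\<chi> l. (form (Dm h y u) v (axis l 1) + form (Dm h y v) u (axis l 1) - form (Dm h y (axis l 1)) u v) / 2) $ i) differentiable (at x)" for i
    unfolding vec_lambda_beta by (intro differentiable_divide differentiable_diff differentiable_add d) auto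
qed

abbreviation dchristoffel where
    "dchristoffel x a b \<equiv> frechet_derivative (\<lambda>y. christoffel_map h y a b) (at x)"

lemma has_derivative_christoffel_map: "x \<in> U \<Longrightarrow> ((\<lambda>y. christoffel_map h y a b)
    has_derivative dchristoffel x a b) (at x)"
  using christoffel_map_differentiable frechet_derivative_works by blast

lemma has_derivative_christoffel_map_field:
  assumes x: "x \<in> U" and f: "(f has_derivative f') (at x)" and g: "(g has_derivative g') (at x)"
  shows "((\<lambda>y. christoffel_map h y (f y) (g y)) has_derivative
    (\<lambda>v. dchristoffel x (f x) (g x) v + christoffel_map h x (f' v) (g x) + christoffel_map h x (f x) (g' v))) (at x)"
  by (rule has_derivative_bilinear_field[OF bilinear_christoffel_map has_derivative_christoffel_map[OF x] f g])

text \<open>No derivative of \<open>X\<close>, \<open>Y\<close> or \<open>Z\<close> survives: the second derivatives of \<open>Z\<close> cancel by symmetry, and the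
  first derivatives of \<open>X\<close> and \<open>Y\<close> are those of the Lie bracket.\<close>

lemma curvature_formula:
  assumes x: "x \<in> U" and X: "smooth_on U X" and Y: "smooth_on U Y" and Z: "smooth_on U Z"
  shows "curvature h X Y Z x = dchristoffel x (Y x) (Z x) (X x) - dchristoffel x (X x) (Z x) (Y x)
    + christoffel_map h x (X x) (christoffel_map h x (Y x) (Z x)) - christoffel_map h x (Y x) (christoffel_map h x (X x) (Z x))"
proof -
  note dX = smooth_on_has_derivative[OF metric_on_open X x] and dY = smooth_on_has_derivative[OF metric_on_open Y x]
    and dZ = smooth_on_has_derivative[OF metric_on_open Z x]
  define DZ where "DZ y = frechet_derivative Z (at y)" for y
  define D2 where "D2 v = frechet_derivative (\<lambda>y. DZ y v) (at x)" for v
  have lin: "linear (DZ y)" if "y \<in> U" for y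
    unfolding DZ_def using smooth_on_has_derivative[OF metric_on_open Z that]
        by (rule has_derivative_linear)
  have d2: "((\<lambda>y. DZ y v) has_derivative D2 v) (at x)" for v
    unfolding D2_def DZ_def using smooth_on_has_derivative[OF metric_on_open smooth_on_frechet_derivative[OF metric_on_open Z] x] .
  have D2_sym: "D2 u v = D2 v u" for u v
    unfolding D2_def DZ_def using symmetric_second_derivative[OF metric_on_open Z x] .
  have D2_lin: "D2 a v = (\<Sum>i\<in>UNIV. a $ i *\<^sub>R D2 (axis i 1) v)" for a v
    using linear_expand_axis[OF has_derivative_linear[OF d2[of v]], of a] by (simp add: D2_sym)
  have DV: "((\<lambda>y. DZ y (V y))
      has_derivative (\<lambda>v. D2 (V x) v + DZ x (frechet_derivative V (at x) v))) (at x)"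
    if V: "smooth_on U V" for V
  proof -
    have Vi: "((\<lambda>y. V y $ i) has_derivative (\<lambda>v. frechet_derivative V (at x) v $ i)) (at x)"
        for i
      using bounded_linear.has_derivative[OF bounded_linear_vec_nth smooth_on_has_derivative[OF metric_on_open V x]] .
    have "((\<lambda>y. \<Sum>i\<in>UNIV. V y $ i *\<^sub>R DZ y (axis i 1)) has_derivative
       (\<lambda>v. \<Sum>i\<in>UNIV. V x $ i *\<^sub>R D2 (axis i 1) v + frechet_derivative V (at x) v $ i *\<^sub>R DZ x (axis i 1))) (at x)"
      by (intro has_derivative_sum has_derivative_scaleR Vi d2)
    moreover have "(\<Sum>i\<in>UNIV. V x $ i *\<^sub>R D2 (axis i 1) v + frechet_derivative V (at x) v $ i *\<^sub>R DZ x (axis i 1)) =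
       D2 (V x) v + DZ x (frechet_derivative V (at x) v)" for v
      by (simp add: sum.distrib D2_lin[of "V x"] linear_expand_axis[OF lin[OF x], symmetric])
    ultimately have "((\<lambda>y. \<Sum>i\<in>UNIV. V y $ i *\<^sub>R DZ y (axis i 1)) has_derivative
      (\<lambda>v. D2 (V x) v + DZ x (frechet_derivative V (at x) v))) (at x)" by simp
    then show ?thesis
      by (rule has_derivative_transform_within_open[OF _ metric_on_open x]) (simp add: linear_expand_axis[OF lin, symmetric])
  qed
  have cov: "frechet_derivative (covariant_derivative h V Z) (at x) w =
      D2 (V x) w + DZ x (frechet_derivative V (at x) w) + (dchristoffel x (V x) (Z x) w
      + christoffel_map h x (frechet_derivative V (at x) w) (Z x) + christoffel_map h x (V x) (DZ x w))"
    if V: "smooth_on U V" for V w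
  proof -
    have "((\<lambda>y. DZ y (V y) + christoffel_map h y (V y) (Z y)) has_derivative
      (\<lambda>w. (D2 (V x) w + DZ x (frechet_derivative V (at x) w)) + (dchristoffel x (V x) (Z x) w
      + christoffel_map h x (frechet_derivative V (at x) w) (Z x) + christoffel_map h x (V x) (DZ x w)))) (at x)"
      unfolding DZ_def[of x]
      by (intro has_derivative_add DV[unfolded DZ_def[of x]] has_derivative_christoffel_map_field x smooth_on_has_derivative[OF metric_on_open _ x] V Z)
    moreover have "covariant_derivative h V Z =
        (\<lambda>y. DZ y (V y) + christoffel_map h y (V y) (Z y))"
      by (auto simp: covariant_derivative_christoffel_map DZ_def)
    ultimately have "(covariant_derivative h V Z has_derivative
      (\<lambda>w. (D2 (V x) w + DZ x (frechet_derivative V (at x) w)) + (dchristoffel x (V x) (Z x) w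
      + christoffel_map h x (frechet_derivative V (at x) w) (Z x) + christoffel_map h x (V x) (DZ x w)))) (at x)" by simp
    from arg_cong[OF frechet_derivative_at[OF this], of "\<lambda>F. F w"] show ?thesis by simp
  qed
  have c: "covariant_derivative h A B x = frechet_derivative B (at x) (A x) + christoffel_map h x (A x) (B x)"
      for A B
    by (rule covariant_derivative_christoffel_map)
  show ?thesis
    unfolding curvature_def c[of X] c[of Y] c[of "lie_bracket X Y"] cov[OF X] cov[OF Y] lie_bracket_def
    unfolding DZ_def[of x, symmetric] covariant_derivative_christoffel_map DZ_def[symmetric]
    by (simp add: linear_diff[OF lin[OF x]] christoffel_map_simps D2_sym[of "X x" "Y x"])
qed

lemma curvature_tensorial:
  assumes "x \<in> U" "smooth_on U X" "smooth_on U Y" "smooth_on U Z"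
  shows "curvature h X Y Z x = curvature_at h x (X x) (Y x) (Z x)"
  unfolding curvature_at_def curvature_formula[OF assms]
  by (subst curvature_formula[OF assms(1)]) (simp_all add: smooth_on_def ck_on_const metric_on_open)

lemma curvature_at_formula:
  assumes "x \<in> U"
  shows "curvature_at h x u v w = dchristoffel x v w u - dchristoffel x u w v
    + christoffel_map h x u (christoffel_map h x v w) - christoffel_map h x v (christoffel_map h x u w)"
  unfolding curvature_at_def
  by (subst curvature_formula[OF assms]) (simp_all add: smooth_on_def ck_on_const metric_on_open)

lemma torsion_free:
  assumes "x \<in> U"
  shows "covariant_derivative h X Y x - covariant_derivative h Y X x = lie_bracket X Y x"
  by (simp add: covariant_derivative_christoffel_map lie_bracket_def christoffel_map_commute[OF assms, of "Y x"])

lemma metric_compatible: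
  assumes x: "x \<in> U" and X: "smooth_on U X" and Y: "smooth_on U Y"
    and const: "\<And>y. y \<in> U \<Longrightarrow> form (h y) (X y) (Y y) = c"
  shows "form (h x) (covariant_derivative h Z X x) (Y x) + form (h x) (X x) (covariant_derivative h Z Y x) = 0"
proof -
  have 1: "((\<lambda>y. form (h y) (X y) (Y y)) has_derivative (\<lambda>v. form (Dm h x v) (X x) (Y x)
    + form (h x) (frechet_derivative X (at x) v) (Y x) + form (h x) (X x) (frechet_derivative Y (at x) v))) (at x)"
    by (rule has_derivative_bilinear_field[OF form_bilinear has_derivative_form[OF x]
          smooth_on_has_derivative[OF metric_on_open X x] smooth_on_has_derivative[OF metric_on_open Y x]])
  have 2: "((\<lambda>y. form (h y) (X y) (Y y)) has_derivative (\<lambda>v. 0)) (at x)"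
    by (rule has_derivative_transform_within_open[OF has_derivative_const[of c] metric_on_open x]) (simp add: const)
  have "form (Dm h x v) (X x) (Y x)
    + form (h x) (frechet_derivative X (at x) v) (Y x) + form (h x) (X x) (frechet_derivative Y (at x) v) = 0" for v
    using fun_cong[OF has_derivative_unique[OF 1 2], of v] by simp
  from this[of "Z x"] show ?thesis
    by (simp add: covariant_derivative_christoffel_map Dm_christoffel_map[OF x] form_simps)
qed

lemma koszul:
  assumes x: "x \<in> U" and X: "smooth_on U X" and Y: "smooth_on U Y" and Z: "smooth_on U Z"
    and const: "\<And>y. y \<in> U \<Longrightarrow> form (h y) (X y) (Y y) = a"
        "\<And>y. y \<in> U \<Longrightarrow> form (h y) (Y y) (Z y) = b"
      "\<And>y. y \<in> U \<Longrightarrow> form (h y) (Z y) (X y) = c"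
  shows "form (h x) (covariant_derivative h X Y x) (Z x) =
    (form (h x) (lie_bracket X Y x) (Z x) - form (h x) (lie_bracket Y Z x) (X x)
      + form (h x) (lie_bracket Z X x) (Y x)) / 2"
proof -
  note m = metric_compatible[OF x X Y const(1), of Z] metric_compatible[OF x Y Z const(2), of X]
    metric_compatible[OF x Z X const(3), of Y]
  show ?thesis
    unfolding torsion_free[OF x, symmetric] form_simps
    using m metric_on_sym[OF x, of "X x"] metric_on_sym[OF x, of "Y x"] metric_on_sym[OF x, of "Z x"]
        by (simp add: field_simps)
qed

end

section \<open>Frames with constant structure coefficients\<close>

text \<open>The frame is given as a family \<open>E w\<close> of fields that depends linearly on the vector \<open>w\<close> of an abstract
  copy of \<open>\<real>\<^sup>n\<close>, the Lie algebra in the case of left-invariant fields. It carries the inner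
  product \<open>\<eta>\<close> and the bracket \<open>br\<close>.\<close>

definition constant_frame :: "(real ^ 'n::finite) set \<Rightarrow> (real ^ 'n \<Rightarrow> real ^ 'n ^ 'n) \<Rightarrow>
    (real ^ 'n \<Rightarrow> real ^ 'n \<Rightarrow> real ^ 'n) \<Rightarrow> (real ^ 'n \<Rightarrow> real ^ 'n \<Rightarrow> real) \<Rightarrow>
    (real ^ 'n \<Rightarrow> real ^ 'n \<Rightarrow> real ^ 'n) \<Rightarrow> bool" where
  "constant_frame U h E \<eta> br \<longleftrightarrow> (\<forall>w. smooth_on U (E w)) \<and>
     (\<forall>x\<in>U. linear (\<lambda>w. E w x) \<and> inj (\<lambda>w. E w x)) \<and>
     (\<forall>x\<in>U. \<forall>w z. form (h x) (E w x) (E z x) = \<eta> w z) \<and>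
     (\<forall>x\<in>U. \<forall>w z. lie_bracket (E w) (E z) x = E (br w z) x)"

lemma covariant_derivative_cong:
  assumes "open U" "x \<in> U" "\<And>y. y \<in> U \<Longrightarrow> Y y = Y' y" "smooth_on U Y'" "X x =
      X' x"
  shows "covariant_derivative h X Y x = covariant_derivative h X' Y' x"
proof -
  have "(Y has_derivative frechet_derivative Y' (at x)) (at x)"
    by (rule has_derivative_transform_within_open[OF smooth_on_has_derivative[OF assms(1,4,2)] assms(1,2)])
      (simp add: assms(3))
  from frechet_derivative_at[OF this] show ?thesis
    by (simp add: covariant_derivative_christoffel_map assms(2,3,5))
qed

context
  fixes U :: "(real ^ 'n::finite) set" and h E \<eta> br \<Gamma>
  assumes h: "metric_on U h" and frame: "constant_frame U h E \<eta> br"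
    and \<Gamma>: "\<And>w z v. \<eta> (\<Gamma> w z) v =
        (\<eta> (br w z) v - \<eta> (br z v) w + \<eta> (br v w) z) / 2"
begin

text \<open>All inner products are constant, so that only the brackets remain in the Koszul formula, and the
  assumption on \<open>\<Gamma>\<close> is that formula in the abstract copy.\<close>

lemma frame_connection:
  assumes x: "x \<in> U"
  shows "covariant_derivative h (E w) (E z) x = E (\<Gamma> w z) x"
proof (rule metric_on_nondeg[OF h x])
  fix v
  have E: "smooth_on U (E w)" "form (h y) (E w y) (E z y) = \<eta> w z" "lie_bracket (E w) (E z) y =
      E (br w z) y"
    if "y \<in> U" for w z y
    using frame that by (auto simp: constant_frame_def)
  have "linear (\<lambda>w. E w x)" "inj (\<lambda>w. E w x)"
    using frame x by (auto simp: constant_frame_def)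
  then have "surj (\<lambda>w. E w x)" by (rule linear_injective_imp_surjective) simp
  then obtain u where u: "v = E u x" by (metis surjD)
  have "form (h x) (covariant_derivative h (E w) (E z) x) (E u x) = \<eta> (\<Gamma> w z) u"
    by (subst koszul[OF h x]) (use x E in \<open>auto simp: \<Gamma>\<close>)
  then show "form (h x) v (covariant_derivative h (E w) (E z) x) = form (h x) v (E (\<Gamma> w z) x)"
    unfolding u metric_on_sym[OF h x, of "E u x"] by (simp add: E(2)[OF x])
qed

lemma frame_torsion: 
  assumes x: "x \<in> U" shows "\<Gamma> w z - \<Gamma> z w = br w z"
proof -
  have l: "linear (\<lambda>w. E w x)" "inj (\<lambda>w. E w x)" and b: "lie_bracket (E w) (E z) x =
      E (br w z) x"
    using frame x by (auto simp: constant_frame_def)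
  have "E (\<Gamma> w z - \<Gamma> z w) x = E (br w z) x"
    using torsion_free[OF h x, of "E w" "E z"] linear_diff[OF l(1)]
        by (simp add: b frame_connection[OF x])
  then show ?thesis using injD[OF l(2)] by blast
qed

lemma frame_curvature:
  assumes x: "x \<in> U"
  shows "curvature_at h x (E a x) (E b x) (E c x) =
    E (\<Gamma> a (\<Gamma> b c) - \<Gamma> b (\<Gamma> a c) - \<Gamma> (\<Gamma> a b - \<Gamma> b a) c) x"
proof -
  have s: "smooth_on U (E w)" for w using frame by (simp add: constant_frame_def)
  have l: "linear (\<lambda>w. E w x)" and b: "lie_bracket (E w) (E z) x = E (br w z) x" for w z
    using frame x by (auto simp: constant_frame_def)
  have 1: "covariant_derivative h (E w) (covariant_derivative h (E z) (E c)) x =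
      E (\<Gamma> w (\<Gamma> z c)) x" for w z
    using covariant_derivative_cong[OF metric_on_open[OF h] x frame_connection s,
        where X = "E w" and X' = "E w" and h = h] frame_connection[OF x] by simp
  have 2: "covariant_derivative h (lie_bracket (E a) (E b)) (E c) x = E (\<Gamma> (br a b) c) x"
    using covariant_derivative_cong[OF metric_on_open[OF h] x refl s,
        where X = "lie_bracket (E a) (E b)" and X' = "E (br a b)" and h = h]
      frame_connection[OF x] b by simp
  show ?thesis
    unfolding curvature_tensorial[OF h x s s s, symmetric] curvature_def 1 2 frame_torsion[OF x]
    by (simp add: linear_diff[OF l])
qed

end

section \<open>Curvature of conformally flat metrics\<close>

lemma metric_on_conformal:
  assumes g: "metric_on U g" and f: "smooth_on U f"
      "\<And>y. y \<in> U \<Longrightarrow> f y > (0::real)"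
  shows "metric_on U (\<lambda>z. f z *\<^sub>R g z)"
proof -
  have "smooth_on U (\<lambda>z. f z *\<^sub>R g z)"
    by (rule smooth_on_bilinear[OF metric_on_open[OF g] bounded_bilinear_scaleR f(1) metric_on_smooth[OF g]])
  then show ?thesis using g f(2) unfolding metric_on_def
    by (auto simp: transpose_scalar intro!: scalar_invertible) (metis less_irrefl)
qed

text \<open>Let \<open>\<alpha>\<close> be half of the logarithmic derivative of \<open>f\<close> and \<open>G\<close> its gradient with respect to \<open>g\<close>. The
  connections of \<open>f g\<close> and \<open>g\<close> differ by the symmetric tensor
  \<open>K(u, v) = \<alpha>(u) v + \<alpha>(v) u - g(u, v) G\<close>. Expressing the vanishing curvature of \<open>f g\<close> by this gives
  the curvature of \<open>g\<close> with the operator \<open>S u = \<nabla>\<^sub>u G - \<alpha>(u) G + \<alpha>(G) u / 2\<close>. It is self-adjoint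
  because \<open>\<alpha>\<close> is closed.\<close>

lemma conformally_flat_curvature:
  assumes g: "metric_on U g" and f: "smooth_on U f"
      "\<And>y. y \<in> U \<Longrightarrow> f y > (0::real)" and x: "x \<in> U"
    and flat: "\<And>u v w. curvature_at (\<lambda>z. f z *\<^sub>R g z) x u v w = 0"
  shows "\<exists>S. linear S \<and> (\<forall>u v. form (g x) (S u) v = form (g x) u (S v)) \<and>
    (\<forall>u v w. curvature_at g x u v w = form (g x) v w *\<^sub>R S u - form (g x) u w *\<^sub>R S v
       + form (g x) (S v) w *\<^sub>R u - form (g x) (S u) w *\<^sub>R v)"
proof -
  define h where "h z = f z *\<^sub>R g z" for z
  have h: "metric_on U h" unfolding h_def[abs_def] by (rule metric_on_conformal[OF g f])
  note U = metric_on_open[OF g]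
  note gs = metric_on_sym[OF g]
  define \<alpha> where "\<alpha> y a = frechet_derivative f (at y) a / (2 * f y)" for y a
  note Df = smooth_on_has_derivative[OF U f(1)]
  have lf: "linear (frechet_derivative f (at y))" if "y \<in> U" for y
    using Df[OF that] by (rule has_derivative_linear)
  have la: "linear (\<alpha> y)" if "y \<in> U" for y
    unfolding \<alpha>_def using f(2)[OF that]
    by (auto intro!: linearI simp: linear_add[OF lf[OF that]] linear_cmul[OF lf[OF that]] field_simps)
  define G where "G y = matrix_inv (g y) *v (\<chi> i. \<alpha> y (axis i 1))" for y
  have gG: "g y *v G y = (\<chi> i. \<alpha> y (axis i 1))" if "y \<in> U" for y
    using matrix_inv_mult[OF metric_on_inv[OF g that]] by (simp add: G_def matrix_vector_mul_assoc)
  have G: "form (g y) w (G y) = \<alpha> y w" if "y \<in> U" for y w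
    unfolding form_def gG[OF that] using linear_expand_axis[OF la[OF that], of w]
        by (simp add: inner_vec_def)
  \<comment> \<open>\<open>A u w\<close> is the derivative of \<open>\<alpha> w\<close> in the direction \<open>u\<close>.\<close>
  define A where "A u w = frechet_derivative (\<lambda>y. frechet_derivative f (at y) w) (at x) u / (2 * f x)
     - frechet_derivative f (at x) u * frechet_derivative f (at x) w / (2 * (f x)\<^sup>2)" for u w
  have A_sym: "A u w = A w u" for u w
    using symmetric_second_derivative_real[OF U f(1) x, of u w] by (simp add: A_def)
  have D\<alpha>: "((\<lambda>y. \<alpha> y w) has_derivative (\<lambda>u. A u w)) (at x)" for w
  proof -
    have "((\<lambda>y. frechet_derivative f (at y) w / (2 * f y)) has_derivative
      (\<lambda>u. (frechet_derivative (\<lambda>y. frechet_derivative f (at y) w) (at x) u * (2 * f x)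
         - frechet_derivative f (at x) w * (2 * frechet_derivative f (at x) u)) / ((2 * f x) * (2 * f x)))) (at x)"
      using f(2)[OF x]
      by (intro has_derivative_divide' has_derivative_mult_right Df x
         smooth_on_has_derivative[OF U smooth_on_frechet_derivative[OF U f(1)]]) auto
    moreover have "(frechet_derivative (\<lambda>y. frechet_derivative f (at y) w) (at x) u * (2 * f x)
         - frechet_derivative f (at x) w * (2 * frechet_derivative f (at x) u)) / ((2 * f x) * (2 * f x)) = A u w" for u
      using f(2)[OF x] by (simp add: A_def field_simps power2_eq_square)
    ultimately show ?thesis unfolding \<alpha>_def by simp
  qed
  have "G differentiable (at x)"
  proof (rule linear_solve_differentiable[OF U x metric_on_inv[OF g] gG])
    show "(\<lambda>y. g y $ i $ j) differentiable (at x)" for i j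
      using has_derivative_metric_entry[OF g x] unfolding differentiable_def by blast
    show "(\<lambda>y. (\<chi> i. \<alpha> y (axis i 1)) $ i) differentiable (at x)" for i
      using D\<alpha> unfolding differentiable_def by auto
  qed
  then obtain G' where G': "(G has_derivative G') (at x)" unfolding differentiable_def by blast
  have lG': "linear G'" using G' by (rule has_derivative_linear)
  define K where "K y u v = \<alpha> y u *\<^sub>R v + \<alpha> y v *\<^sub>R u - form (g y) u v *\<^sub>R G y" for y u v
  have christoffel_h: "christoffel_map h y u v = christoffel_map g y u v + K y u v" if y: "y \<in> U"
      for y u v
  proof (rule metric_on_nondeg[OF h y])
    fix w
    have "(h has_derivative (\<lambda>a. f y *\<^sub>R Dm g y a + frechet_derivative f (at y) a *\<^sub>R g y)) (at y)"
      unfolding h_def[abs_def] by (rule has_derivative_scaleR[OF Df[OF y] has_derivative_metric[OF g y]])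
    then have Dh: "Dm h y a = f y *\<^sub>R Dm g y a + frechet_derivative f (at y) a *\<^sub>R g y" for a
      using fun_cong[OF frechet_derivative_at, of h _ y a] by simp
    have fa: "frechet_derivative f (at y) a = 2 * f y * \<alpha> y a" for a
      using f(2)[OF y] by (simp add: \<alpha>_def)
    have hf: "form (h y) a b = f y * form (g y) a b" for a b by (simp add: h_def form_matrix)
    show "form (h y) w (christoffel_map h y u v) = form (h y) w (christoffel_map g y u v + K y u v)"
      unfolding form_christoffel_map[OF h y]
          unfolding Dh fa hf form_matrix form_simps form_christoffel_map[OF g y] K_def
      using gs[OF y, of w u] gs[OF y, of w v]
      by (simp add: G[OF y] field_simps)
  qed
  have DK: "((\<lambda>y. K y a b) has_derivative
      (\<lambda>u. A u a *\<^sub>R b + A u b *\<^sub>R a - (form (g x) a b *\<^sub>R G' u + form (Dm g x u) a b *\<^sub>R G x))) (at x)" for a b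
    unfolding K_def
    by (intro has_derivative_diff has_derivative_add has_derivative_scaleR_left D\<alpha> has_derivative_scaleR has_derivative_form[OF g x] G')
  have dchristoffel_h: "frechet_derivative (\<lambda>y. christoffel_map h y a b) (at x) u =
      frechet_derivative (\<lambda>y. christoffel_map g y a b) (at x) u +
      (A u a *\<^sub>R b + A u b *\<^sub>R a - (form (g x) a b *\<^sub>R G' u + form (Dm g x u) a b *\<^sub>R G x))" for a b u
  proof -
    have "((\<lambda>y. christoffel_map h y a b)
        has_derivative (\<lambda>u. frechet_derivative (\<lambda>y. christoffel_map g y a b) (at x) u +
      (A u a *\<^sub>R b + A u b *\<^sub>R a - (form (g x) a b *\<^sub>R G' u + form (Dm g x u) a b *\<^sub>R G x)))) (at x)"
      by (rule has_derivative_transform_within_open[OF has_derivative_add[OF has_derivative_christoffel_map[OF g x] DK] U x])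
        (simp add: christoffel_h)
    from fun_cong[OF frechet_derivative_at[OF this], of u] show ?thesis by simp
  qed
  define c where "c = christoffel_map g x"
  have c: "c u (a + b) = c u a + c u b" "c u (a - b) = c u a - c u b" "c u (r *\<^sub>R a) =
      r *\<^sub>R c u a"
      "c (a + b) u = c a u + c b u" "c (a - b) u = c a u - c b u" "c (r *\<^sub>R a) u = r *\<^sub>R c a u"
          for u a b r
    by (simp_all add: c_def christoffel_map_simps)
  have csym: "c u v = c v u" for u v unfolding c_def by (rule christoffel_map_commute[OF g x])
  define \<eta> where "\<eta> = form (g x)"
  have eta: "\<eta> u (a + b) = \<eta> u a + \<eta> u b" "\<eta> u (a - b) = \<eta> u a - \<eta> u b"
      "\<eta> u (r *\<^sub>R a) = r * \<eta> u a"
      "\<eta> (a + b) u = \<eta> a u + \<eta> b u" "\<eta> (a - b) u = \<eta> a u - \<eta> b u"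
          "\<eta> (r *\<^sub>R a) u = r * \<eta> a u" for u a b r
    by (simp_all add: \<eta>_def form_simps)
  have esym: "\<eta> u v = \<eta> v u" for u v unfolding \<eta>_def by (rule gs[OF x])
  define a where "a = \<alpha> x"
  have a: "a (u + v) = a u + a v" "a (u - v) = a u - a v" "a (r *\<^sub>R u) = r * a u" for u v r
    using linear_add[OF la[OF x]] linear_diff[OF la[OF x]] linear_cmul[OF la[OF x]]
        by (simp_all add: a_def)
  define k where "k = G x"
  have ek: "\<eta> w k = a w" "\<eta> k w = a w" for w using G[OF x, of w] esym[of k w]
      by (simp_all add: \<eta>_def k_def a_def)
  have Dg: "form (Dm g x u) v w = \<eta> (c u v) w + \<eta> v (c u w)" for u v w
    unfolding \<eta>_def c_def by (rule Dm_christoffel_map[OF g x])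
  have G'_eq: "\<eta> (c u k) w + a (c u w) + \<eta> (G' u) w = A u w" for u w
  proof -
    have 1: "((\<lambda>y. form (g y) (G y) w) has_derivative
      (\<lambda>v. form (Dm g x v) (G x) w + form (g x) (G' v) w + form (g x) (G x) 0)) (at x)"
      using has_derivative_bilinear_field[OF form_bilinear has_derivative_form[OF g x] G' has_derivative_const[of w]] .
    have 2: "((\<lambda>y. form (g y) (G y) w) has_derivative (\<lambda>u. A u w)) (at x)"
      by (rule has_derivative_transform_within_open[OF D\<alpha>[of w] U x]) (metis G gs)
    have "form (Dm g x u) (G x) w + form (g x) (G' u) w + form (g x) (G x) 0 = A u w"
      using fun_cong[OF has_derivative_unique[OF 1 2], of u] by simp
    then show ?thesis using linear_0[OF la[OF x]]
        by (simp add: a_def[symmetric] Dg form_simps \<eta>_def[symmetric] k_def[symmetric] ek)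
  qed
  define S where "S u = G' u + c u k - a u *\<^sub>R k + (a k / 2) *\<^sub>R u" for u
  have "linear S"
    unfolding S_def by (rule linearI)
      (simp_all add: linear_add[OF lG'] linear_cmul[OF lG'] c a algebra_simps)
  have eS: "\<eta> (S u) w = A u w - a (c u w) - a u * a w + (a k / 2) * \<eta> u w" for u w
    unfolding G'_eq[of u w, symmetric] S_def by (simp add: eta ek)
  have "\<eta> (S u) w = \<eta> u (S w)" for u w
    unfolding esym[of u "S w"] eS using A_sym[of u w] csym[of u w] esym[of u w] by simp
  moreover have "curvature_at g x u v w = \<eta> v w *\<^sub>R S u - \<eta> u w *\<^sub>R S v
       + \<eta> (S v) w *\<^sub>R u - \<eta> (S u) w *\<^sub>R v" for u v w
  proof -
    have K: "K x u v = a u *\<^sub>R v + a v *\<^sub>R u - \<eta> u v *\<^sub>R k" for u v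
      by (simp add: K_def a_def \<eta>_def k_def)
    have "curvature_at h x u v w = 0" using flat unfolding h_def[abs_def] .
    then have "curvature_at g x u v w = - (
      (A u v *\<^sub>R w + A u w *\<^sub>R v - (\<eta> v w *\<^sub>R G' u + form (Dm g x u) v w *\<^sub>R k))
      - (A v u *\<^sub>R w + A v w *\<^sub>R u - (\<eta> u w *\<^sub>R G' v + form (Dm g x v) u w *\<^sub>R k))
      + c u (K x v w) + K x u (c v w + K x v w) - c v (K x u w) - K x v (c u w + K x u w))"
      unfolding curvature_at_formula[OF h x] curvature_at_formula[OF g x] dchristoffel_h christoffel_h[OF x]
      by (simp add: c_def[symmetric] \<eta>_def[symmetric] k_def[symmetric] c algebra_simps)
    also have "\<dots> = \<eta> v w *\<^sub>R S u - \<eta> u w *\<^sub>R S v + \<eta> (S v) w *\<^sub>R u - \<eta> (S u) w *\<^sub>R v"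
      unfolding K Dg eS S_def using A_sym[of u v] csym[of u v] esym[of u v]
      by (simp add: c eta a ek algebra_simps vec_times_numeral G'_eq[of u w, symmetric] G'_eq[of v w, symmetric])
    finally show ?thesis .
  qed
  ultimately show ?thesis using \<open>linear S\<close> unfolding \<eta>_def by blast
qed

section \<open>The Ricci operator\<close>

lemma length_filter_distinct_snd:
  "distinct (map snd xs) \<Longrightarrow> length (filter (\<lambda>p. snd p = ev) xs) \<le> 1"
proof (induction xs)
  case (Cons p xs)
  show ?case
  proof (cases "snd p = ev")
    case True
    then have "filter (\<lambda>p. snd p = ev) xs = []"
      using Cons.prems by (force simp: filter_empty_conv image_iff)
    then show ?thesis using True by simp
  next
    case False
    then show ?thesis using Cons by simp
  qed
qed simp

text \<open>The dimension of an eigenspace is the number of Jordan blocks of the eigenvalue, here at most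
  one.\<close>

lemma nondegenerate_not_derogatory:
  assumes "nondegenerate_operator Q"
  shows "\<not> derogatory ((*v) Q)"
proof
  assume "derogatory ((*v) Q)"
  then obtain \<alpha> \<beta> x1 y1 x2 y2 where
    e1: "Q *v x1 = \<alpha> *\<^sub>R x1 - \<beta> *\<^sub>R y1" "Q *v y1 =
        \<beta> *\<^sub>R x1 + \<alpha> *\<^sub>R y1" and
    e2: "Q *v x2 = \<alpha> *\<^sub>R x2 - \<beta> *\<^sub>R y2" "Q *v y2 =
        \<beta> *\<^sub>R x2 + \<alpha> *\<^sub>R y2" and
    ind: "\<And>a b c d. a *\<^sub>R x1 - b *\<^sub>R y1 + c *\<^sub>R x2 - d *\<^sub>R y2 =
        0 \<Longrightarrow>
        b *\<^sub>R x1 + a *\<^sub>R y1 + d *\<^sub>R x2 + c *\<^sub>R y2 = 0 \<Longrightarrow> a = 0 \<and> b = 0 \<and> c = 0 \<and> d = 0"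
    unfolding derogatory_def by blast
  obtain blocks where jnf: "jordan_nf (complex_matrix Q) blocks" and dist: "distinct (map snd blocks)"
    using assms unfolding nondegenerate_operator_def by blast
  define M where "M = complex_matrix Q"
  define l where "l = Complex \<alpha> \<beta>"
  define z where "z x y = Matrix.vec 4 (\<lambda>i. Complex (x $ of_nat i) (y $ of_nat i))" for x y ::
      "real ^ 4"
  have M: "M \<in> carrier_mat 4 4" by (simp add: M_def complex_matrix_def)
  \<comment> \<open>In the index type \<open>4\<close> numerals are taken modulo four.\<close>
  have mod_4: "(4::4) = 0" "(5::4) = 1" "(6::4) = 2" "(7::4) = 3" by simp_all
  have sum4: "(\<Sum>j\<in>{0..<4}. f (of_nat j :: 4)) = sum f UNIV" for f ::
      "4 \<Rightarrow> 'a::comm_monoid_add"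
    by (simp add: numeral_eq_Suc sum_4 mod_4 ac_simps)
  have all4: "\<forall>i<4. P (of_nat i :: 4) \<Longrightarrow> P j" for P j
    using exhaust_4[of j] by (auto simp: numeral_eq_Suc All_less_Suc mod_4)
  define N where "N = char_matrix M l"
  have N: "N \<in> carrier_mat 4 4" using M by (simp add: N_def)
  have ker: "z x y \<in> mat_kernel N"
    if e: "Q *v x = \<alpha> *\<^sub>R x - \<beta> *\<^sub>R y" "Q *v y =
        \<beta> *\<^sub>R x + \<alpha> *\<^sub>R y" for x y
  proof (rule mat_kernelI[OF N])
    show "z x y \<in> carrier_vec 4" by (simp add: z_def)
    show "N *\<^sub>v z x y = 0\<^sub>v 4"
    proof (rule Matrix.eq_vecI)
      fix i assume "i < dim_vec (0\<^sub>v 4 :: complex Matrix.vec)"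
      then have i: "i < 4" by simp
      have "Matrix.vec_index (N *\<^sub>v z x y) i =
          (\<Sum>j\<in>{0..<4}. N $$ (i, j) * Matrix.vec_index (z x y) j)"
        using i N by (simp add: Matrix.scalar_prod_def z_def)
      also have "\<dots> = (\<Sum>j\<in>{0..<4}. complex_of_real (Q $ of_nat i $ of_nat j) * Complex (x $ of_nat j) (y $ of_nat j)
          - (if i = j then l * Complex (x $ of_nat j) (y $ of_nat j) else 0))"
        using i by (intro sum.cong) (auto simp: N_def char_matrix_def M_def complex_matrix_def z_def algebra_simps)
      also have "\<dots> = (\<Sum>j\<in>{0..<4}. complex_of_real (Q $ of_nat i $ of_nat j) * Complex (x $ of_nat j) (y $ of_nat j))
          - l * Complex (x $ of_nat i) (y $ of_nat i)"
        using i by (simp add: sum_subtractf)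
      also have "(\<Sum>j\<in>{0..<4}. complex_of_real (Q $ of_nat i $ of_nat j) * Complex (x $ of_nat j) (y $ of_nat j)) =
          Complex ((Q *v x) $ of_nat i) ((Q *v y) $ of_nat i)"
        by (simp add: sum4[of "\<lambda>j. complex_of_real (Q $ of_nat i $ j) * Complex (x $ j) (y $ j)"]
            complex_eq_iff matrix_vector_mult_def)
      also have "\<dots> - l * Complex (x $ of_nat i) (y $ of_nat i) = 0"
        by (simp add: e l_def complex_eq_iff)
      finally show "Matrix.vec_index (N *\<^sub>v z x y) i = Matrix.vec_index (0\<^sub>v 4) i" using i
          by simp
    qed (use N in simp)
  qed
  have dim: "kernel_dim N \<le> 1"
  proof -
    have "dim_gen_eigenspace M l 1 = (\<Sum>n\<leftarrow>map fst [(n, e)\<leftarrow>blocks . e =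
        l]. min 1 n)"
      by (rule dim_gen_eigenspace[OF jnf[folded M_def]])
    also have "\<dots> \<le> (\<Sum>n\<leftarrow>map fst [(n, e)\<leftarrow>blocks . e = l]. 1)"
      by (rule sum_list_mono) simp
    also have "\<dots> \<le> 1"
      using length_filter_distinct_snd[OF dist, of l] by (simp add: sum_list_triv case_prod_beta')
    finally show ?thesis using N by (simp add: dim_gen_eigenspace_def N_def)
  qed
  interpret K: kernel 4 4 N by unfold_locales (rule N)
  have Kdim: "K.dim \<le> 1" using dim by simp
  have comb: "a = 0 \<and> b = 0" if
      "\<And>i. i < 4 \<Longrightarrow> a * Matrix.vec_index (z x1 y1) i + b * Matrix.vec_index (z x2 y2) i =
          0" for a b
  proof -
    have "Re a * x1 $ j - Im a * y1 $ j + Re b * x2 $ j - Im b * y2 $ j = 0 \<and>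
       Im a * x1 $ j + Re a * y1 $ j + Im b * x2 $ j + Re b * y2 $ j = 0" for j
      by (rule all4) (use that in \<open>simp add: z_def complex_eq_iff algebra_simps\<close>)
    then have "Re a = 0 \<and> Im a = 0 \<and> Re b = 0 \<and> Im b = 0"
      by (intro ind) (simp_all add: Finite_Cartesian_Product.vec_eq_iff)
    then show ?thesis by (simp add: complex_eq_iff)
  qed
  have ne: "z x1 y1 \<noteq> z x2 y2" using comb[of 1 "- 1"] by auto
  let ?B = "{z x1 y1, z x2 y2}"
  have sub: "?B \<subseteq> mat_kernel N" using ker[OF e1] ker[OF e2] by simp
  have sub4: "?B \<subseteq> carrier_vec 4" by (simp add: z_def)
  have "K.lin_indpt ?B"
  proof (rule K.Ker.finite_lin_indpt2)
    fix a assume "K.lincomb a ?B = 0\<^sub>v 4"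
    then have 0: "K.NC.lincomb a ?B = 0\<^sub>v 4" using K.lincomb_same[OF sub] by simp
    have "a (z x1 y1) * Matrix.vec_index (z x1 y1) i + a (z x2 y2) * Matrix.vec_index (z x2 y2) i = 0" if i:
        "i < 4" for i
      using K.NC.lincomb_index[OF i sub4, of a] ne i unfolding 0 by simp
    from comb[OF this] show "\<forall>v\<in>?B. a v = 0" by simp
  qed (use sub in auto)
  moreover have "K.Ker.fin_dim"
    using kernel_basis_exists[OF N] K.Ker.basis_def K.Ker.fin_dim_def by blast
  ultimately have "card ?B \<le> K.dim" using K.Ker.li_le_dim(2)[of ?B] sub by simp
  then show False using Kdim ne by simp
qed

lemma derogatory_affine:
  assumes "derogatory S"
  shows "derogatory (\<lambda>u. k *\<^sub>R S u + t *\<^sub>R u)"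
proof -
  obtain \<alpha> \<beta> x1 y1 x2 y2 where
    e: "S x1 = \<alpha> *\<^sub>R x1 - \<beta> *\<^sub>R y1" "S y1 =
        \<beta> *\<^sub>R x1 + \<alpha> *\<^sub>R y1"
    "S x2 = \<alpha> *\<^sub>R x2 - \<beta> *\<^sub>R y2" "S y2 =
        \<beta> *\<^sub>R x2 + \<alpha> *\<^sub>R y2" and
    ind: "\<And>a b c d. a *\<^sub>R x1 - b *\<^sub>R y1 + c *\<^sub>R x2 - d *\<^sub>R y2 =
        0 \<Longrightarrow>
        b *\<^sub>R x1 + a *\<^sub>R y1 + d *\<^sub>R x2 + c *\<^sub>R y2 = 0 \<Longrightarrow> a = 0 \<and> b = 0 \<and> c = 0 \<and> d = 0"
    using assms unfolding derogatory_def by blast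
  show ?thesis
    by (rule derogatoryI[OF _ _ _ _ ind, where \<alpha> = "k * \<alpha> + t" and \<beta> = "k * \<beta>" and ?x1.0 = x1 and ?y1.0 = y1 and ?x2.0 = x2 and ?y2.0 = y2])
      (simp_all add: e algebra_simps)
qed

lemma derogatory_conjugate:
  assumes "derogatory S" "linear \<theta>" "inj \<theta>" "\<And>u. T (\<theta> u) = \<theta> (S u)"
  shows "derogatory T"
proof -
  obtain \<alpha> \<beta> x1 y1 x2 y2 where
    e: "S x1 = \<alpha> *\<^sub>R x1 - \<beta> *\<^sub>R y1" "S y1 =
        \<beta> *\<^sub>R x1 + \<alpha> *\<^sub>R y1"
    "S x2 = \<alpha> *\<^sub>R x2 - \<beta> *\<^sub>R y2" "S y2 =
        \<beta> *\<^sub>R x2 + \<alpha> *\<^sub>R y2" and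
    ind: "\<And>a b c d. a *\<^sub>R x1 - b *\<^sub>R y1 + c *\<^sub>R x2 - d *\<^sub>R y2 =
        0 \<Longrightarrow>
        b *\<^sub>R x1 + a *\<^sub>R y1 + d *\<^sub>R x2 + c *\<^sub>R y2 = 0 \<Longrightarrow> a = 0 \<and> b = 0 \<and> c = 0 \<and> d = 0"
    using assms(1) unfolding derogatory_def by blast
  have l: "\<theta> (a *\<^sub>R u) = a *\<^sub>R \<theta> u" "\<theta> (u + v) = \<theta> u + \<theta> v"
      "\<theta> (u - v) = \<theta> u - \<theta> v" for a u v
    using assms(2) by (simp_all add: linear_cmul linear_add linear_diff)
  have i: "\<theta> u = 0 \<Longrightarrow> u = 0" for u using assms(2,3)
      by (simp add: linear_injective_0)
  show ?thesis
  proof (rule derogatoryI[where \<alpha> = \<alpha> and \<beta> = \<beta> and ?x1.0 = "\<theta> x1" and ?y1.0 = "\<theta> y1" and ?x2.0 = "\<theta> x2" and ?y2.0 = "\<theta> y2"])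
    fix a b c d
    assume "a *\<^sub>R \<theta> x1 - b *\<^sub>R \<theta> y1 + c *\<^sub>R \<theta> x2 - d *\<^sub>R \<theta> y2 = 0"
      "b *\<^sub>R \<theta> x1 + a *\<^sub>R \<theta> y1 + d *\<^sub>R \<theta> x2 + c *\<^sub>R \<theta> y2 = 0"
    then have "\<theta> (a *\<^sub>R x1 - b *\<^sub>R y1 + c *\<^sub>R x2 - d *\<^sub>R y2) = 0"
      "\<theta> (b *\<^sub>R x1 + a *\<^sub>R y1 + d *\<^sub>R x2 + c *\<^sub>R y2) = 0"
          by (simp_all add: l)
    then show "a = 0 \<and> b = 0 \<and> c = 0 \<and> d = 0" using i ind by blast
  qed (simp_all add: assms(4) e l)
qed

lemma form_sum_left: "form m (\<Sum>i\<in>I. f i) v = (\<Sum>i\<in>I. form m (f i) v)"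
  using linear_sum[of "\<lambda>u. form m u v" f I] form_bilinear[of m] by (simp add: bilinear_def)

lemma pseudo_orthonormal_contraction:
  fixes m :: "real ^ 'n::finite ^ 'n"
  assumes m: "transpose m = m" and e: "pseudo_orthonormal_basis m e"
  shows "(\<Sum>i\<in>UNIV. form m (e i) (e i) * (form m u (e i) * form m (e i) v)) = form m u v"
    and "form m (e i) (e i) * form m (e i) (e i) = 1"
proof -
  show sq: "form m (e i) (e i) * form m (e i) (e i) = 1" for i
    using e unfolding pseudo_orthonormal_basis_def by (metis mult_minus1_right minus_minus mult_1)
  define L where "L c = (\<Sum>i\<in>UNIV. c $ i *\<^sub>R e i)" for c :: "real ^ 'n"
  have lin: "linear L" unfolding L_def
      by (rule linearI) (simp_all add: sum.distrib scaleR_sum_right algebra_simps)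
  have coef: "form m (L c) (e j) = c $ j * form m (e j) (e j)" for c j
  proof -
    have "form m (L c) (e j) = (\<Sum>i\<in>UNIV. c $ i * form m (e i) (e j))"
      unfolding L_def by (simp add: form_sum_left form_simps)
    also have "\<dots> = (\<Sum>i\<in>UNIV. if i = j then c $ i * form m (e i) (e j) else 0)"
      using e by (intro sum.cong) (auto simp: pseudo_orthonormal_basis_def)
    finally show ?thesis by simp
  qed
  have "c = 0" if "L c = 0" for c
  proof -
    have "c $ j = 0" for j
      using coef[of c j] sq[of j] that by (auto simp: form_simps)
    then show ?thesis by (simp add: Finite_Cartesian_Product.vec_eq_iff)
  qed
  then have "inj L" using lin by (simp add: linear_injective_0)
  then have "surj L" using lin linear_injective_imp_surjective by blast
  then obtain c where c: "L c = u" by (metis surjD)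
  have "form m u v = (\<Sum>i\<in>UNIV. c $ i * form m (e i) v)"
    unfolding c[symmetric] L_def by (simp add: form_sum_left form_simps)
  also have "\<dots> = (\<Sum>i\<in>UNIV. form m (e i) (e i) * (form m u (e i) * form m (e i) v))"
    using coef[of c] sq by (intro sum.cong) (simp_all add: c algebra_simps)
  finally show "(\<Sum>i\<in>UNIV. form m (e i) (e i) * (form m u (e i) * form m (e i) v)) = form m u v"
      by simp
qed

text \<open>Contracting the curvature formula gives the trace \<open>t\<close> of \<open>S\<close> from the first term, and multiples of
  \<open>S\<close> from the others. Non-degeneracy makes the operator unique.\<close>

lemma ricci_operator_schouten:
  fixes h :: "real ^ 'n::finite \<Rightarrow> real ^ 'n ^ 'n"
  assumes m: "transpose (h x) = h x" "invertible (h x)"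
    and e: "pseudo_orthonormal_basis (h x) e"
    and S: "linear S" "\<And>u v. form (h x) (S u) v = form (h x) u (S v)"
    and curv: "\<And>u v w. curvature_at h x u v w =
        form (h x) v w *\<^sub>R S u - form (h x) u w *\<^sub>R S v
       + form (h x) (S v) w *\<^sub>R u - form (h x) (S u) w *\<^sub>R v"
  shows "\<exists>t. \<forall>u. ricci_operator h x *v u =
      (real CARD('n) - 2) *\<^sub>R S u + t *\<^sub>R u"
proof -
  define f where "f = (SOME e. pseudo_orthonormal_basis (h x) e)"
  have f: "pseudo_orthonormal_basis (h x) f" unfolding f_def using e
      by (rule someI[of "pseudo_orthonormal_basis (h x)"])
  note c = pseudo_orthonormal_contraction[OF m(1) f]
  define t where "t = (\<Sum>i\<in>UNIV. form (h x) (f i) (f i) * form (h x) (S (f i)) (f i))"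
  define Q where "Q u = (real CARD('n) - 2) *\<^sub>R S u + t *\<^sub>R u" for u
  have fsym: "form (h x) u v = form (h x) v u" for u v by (rule form_commute[OF m(1)])
  have ric: "ricci h x u v = form (h x) (Q u) v" for u v
  proof -
    have "ricci h x u v = (\<Sum>i\<in>UNIV. form (h x) (f i) (f i) * form (h x) (curvature_at h x (f i) u v) (f i))"
      by (simp add: ricci_def f_def Let_def)
    also have "\<dots> = (\<Sum>i\<in>UNIV. form (h x) u v * (form (h x) (f i) (f i) * form (h x) (S (f i)) (f i))
      - form (h x) (f i) (f i) * (form (h x) (S u) (f i) * form (h x) (f i) v)
      + form (h x) (S u) v * (form (h x) (f i) (f i) * form (h x) (f i) (f i))
      - form (h x) (f i) (f i) * (form (h x) u (f i) * form (h x) (f i) (S v)))"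
      by (rule sum.cong) (simp_all add: curv form_simps S(2)[of "f _" v] algebra_simps)
    also have "\<dots> = form (h x) u v * t - form (h x) (S u) v + form (h x) (S u) v * real CARD('n) - form (h x) u (S v)"
      by (simp add: sum.distrib sum_subtractf c sum_distrib_left[symmetric] t_def)
    finally show ?thesis by (simp add: Q_def form_simps S(2) algebra_simps)
  qed
  have linQ: "linear Q" unfolding Q_def
    by (rule linearI) (simp_all add: linear_add[OF S(1)] linear_cmul[OF S(1)] algebra_simps)
  have "ricci_operator h x = matrix Q"
    unfolding ricci_operator_def
  proof (rule the_equality)
    show "\<forall>u v. form (h x) (matrix Q *v u) v = ricci h x u v"
      using linQ by (simp add: ric matrix_works)
    fix P assume P: "\<forall>u v. form (h x) (P *v u) v = ricci h x u v"
    have "P *v u = matrix Q *v u" for u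
    proof -
      have "form (h x) v (P *v u - Q u) = 0" for v using P fsym[of v] by (simp add: form_simps ric)
      from form_nondegenerate[OF m(2) this] show ?thesis using linQ by (simp add: matrix_works)
    qed
    then show "P = matrix Q" by (simp add: matrix_eq)
  qed
  then have "ricci_operator h x *v u = Q u" for u using linQ by (simp add: matrix_works)
  then show ?thesis unfolding Q_def by blast
qed

section \<open>Charts and related vector fields\<close>

lemma smooth_on_ident: "open S \<Longrightarrow> smooth_on S (\<lambda>x. x)"
  unfolding smooth_on_def
proof
  fix k assume "open S"
  then show "ck_on k S (\<lambda>x. x)"
    by (cases k) (auto intro!: ck_on_SucI[of S "\<lambda>x. x" "\<lambda>x v. v"] ck_on_const)
qed

text \<open>Differentiating the relation \<open>X' \<circ> \<psi> = D\<psi> X\<close> along \<open>Y\<close> produces a second derivative of \<open>\<psi>\<close> that is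
  symmetric in \<open>X\<close> and \<open>Y\<close> and therefore drops out of the bracket.\<close>

lemma bracket_related:
  fixes \<psi> :: "real ^ 'n::finite \<Rightarrow> real ^ 'n"
  assumes U: "open U" "smooth_on U \<psi>" "x \<in> U" and V: "open V" "\<psi> x \<in> V"
    and X: "smooth_on U X" "smooth_on V X'" "\<And>y. y \<in> U \<Longrightarrow> X' (\<psi> y) =
        frechet_derivative \<psi> (at y) (X y)"
    and Y: "smooth_on U Y" "smooth_on V Y'" "\<And>y. y \<in> U \<Longrightarrow> Y' (\<psi> y) =
        frechet_derivative \<psi> (at y) (Y y)"
  shows "lie_bracket X' Y' (\<psi> x) = frechet_derivative \<psi> (at x) (lie_bracket X Y x)"
proof -
  define P where "P y = frechet_derivative \<psi> (at y)" for y
  define D2 where "D2 v = frechet_derivative (\<lambda>y. P y v) (at x)" for v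
  have D\<psi>: "(\<psi> has_derivative P y) (at y)" if "y \<in> U" for y
    unfolding P_def using smooth_on_has_derivative[OF U(1,2) that] .
  have d2: "((\<lambda>y. P y v) has_derivative D2 v) (at x)" for v
    unfolding D2_def P_def using smooth_on_has_derivative[OF U(1) smooth_on_frechet_derivative[OF U(1,2)] U(3)] .
  have D2_sym: "D2 u v = D2 v u" for u v
    unfolding D2_def P_def using symmetric_second_derivative[OF U] .
  have D2_lin: "D2 a v = (\<Sum>i\<in>UNIV. a $ i *\<^sub>R D2 (axis i 1) v)" for a v
    using linear_expand_axis[OF has_derivative_linear[OF d2[of v]], of a] by (simp add: D2_sym)
  have linP: "linear (P y)" if "y \<in> U" for y using D\<psi>[OF that] by (rule has_derivative_linear)
  have key: "frechet_derivative Z' (at (\<psi> x)) (P x v) =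
      D2 (Z x) v + P x (frechet_derivative Z (at x) v)"
    if Z: "smooth_on U Z" "smooth_on V Z'" "\<And>y. y \<in> U \<Longrightarrow> Z' (\<psi> y) = P y (Z y)"
        for Z Z' v
  proof -
    have Zi: "((\<lambda>y. Z y $ i) has_derivative (\<lambda>v. frechet_derivative Z (at x) v $ i)) (at x)"
        for i
      using bounded_linear.has_derivative[OF bounded_linear_vec_nth smooth_on_has_derivative[OF U(1) Z(1) U(3)]] .
    have "((\<lambda>y. \<Sum>i\<in>UNIV. Z y $ i *\<^sub>R P y (axis i 1)) has_derivative
       (\<lambda>v. \<Sum>i\<in>UNIV. Z x $ i *\<^sub>R D2 (axis i 1) v + frechet_derivative Z (at x) v $ i *\<^sub>R P x (axis i 1))) (at x)"
      by (intro has_derivative_sum has_derivative_scaleR Zi d2)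
    then have 1: "((\<lambda>y. Z' (\<psi> y)) has_derivative
       (\<lambda>v. \<Sum>i\<in>UNIV. Z x $ i *\<^sub>R D2 (axis i 1) v + frechet_derivative Z (at x) v $ i *\<^sub>R P x (axis i 1))) (at x)"
      by (rule has_derivative_transform_within_open[OF _ U(1,3)])
        (simp add: Z(3) linear_expand_axis[OF linP, symmetric])
    have 2: "((\<lambda>y. Z' (\<psi> y))
        has_derivative (\<lambda>v. frechet_derivative Z' (at (\<psi> x)) (P x v))) (at x)"
      by (rule has_derivative_compose[OF D\<psi>[OF U(3)] smooth_on_has_derivative[OF V(1) Z(2) V(2)]])
    show ?thesis
      using fun_cong[OF has_derivative_unique[OF 2 1], of v]
      by (simp add: sum.distrib D2_lin[of "Z x"] linear_expand_axis[OF linP[OF U(3)], symmetric])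
  qed
  have kX: "frechet_derivative X' (at (\<psi> x)) (P x v) = D2 (X x) v + P x (frechet_derivative X (at x) v)"
      for v
    by (rule key[OF X(1,2)]) (simp add: X(3) P_def)
  have kY: "frechet_derivative Y' (at (\<psi> x)) (P x v) = D2 (Y x) v + P x (frechet_derivative Y (at x) v)"
      for v
    by (rule key[OF Y(1,2)]) (simp add: Y(3) P_def)
  have "lie_bracket X' Y' (\<psi> x) = P x (lie_bracket X Y x)"
    unfolding lie_bracket_def X(3)[OF U(3)] Y(3)[OF U(3)] P_def[of x, symmetric] kX kY
    by (simp add: linear_diff[OF linP[OF U(3)]] D2_sym[of "X x"])
  then show ?thesis by (simp add: P_def)
qed

lemma chart_open_image:
  assumes "is_chart c" "open V" "V \<subseteq> fst c"
  shows "open (snd c ` V)"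
proof -
  have c: "open (fst c)" "open (chart_image c)"
      "homeomorphism (fst c) (chart_image c) (snd c) (chart_inv c)"
    using assms(1) by (simp_all add: is_chart_def)
  have "openin (top_of_set (fst c)) V"
    using openin_open_eq[OF c(1), of V] assms(2,3) by simp
  then have "openin (top_of_set (chart_image c)) (snd c ` V)"
    by (rule homeomorphism_imp_open_map[OF c(3)])
  then show ?thesis using openin_open_eq[OF c(2)] by simp
qed

lemma chart_inv_image: "is_chart c \<Longrightarrow> p \<in> fst c \<Longrightarrow> chart_inv c (snd c p) = p"
  unfolding is_chart_def homeomorphism_def by blast

lemma chart_inv_in: "x \<in> chart_image c \<Longrightarrow> chart_inv c x \<in> fst c"
    "x \<in> chart_image c \<Longrightarrow> snd c (chart_inv c x) = x"
  by (auto intro: inv_into_into f_inv_into_f)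

lemma differential_compose:
  assumes c: "is_chart c" and d: "is_chart d" and V: "open V" "p \<in> V" "V \<subseteq> fst c"
      "F ` V \<subseteq> fst d"
    and F: "local_rep F c d differentiable at (snd c p)" and H:
        "local_rep H d e differentiable at (snd d (F p))"
  shows "differential (\<lambda>b. H (F b)) c e p v = differential H d e (F p) (differential F c d p v)"
proof -
  have Fp: "local_rep F c d (snd c p) = snd d (F p)"
    using V chart_inv_image[OF c] by (auto simp: local_rep_def)
  have 1: "((\<lambda>y. local_rep H d e (local_rep F c d y)) has_derivative
     (\<lambda>v. differential H d e (F p) (differential F c d p v))) (at (snd c p))"
    unfolding differential_def
    using has_derivative_compose[OF F[unfolded frechet_derivative_works], of "local_rep H d e"]
      H[unfolded frechet_derivative_works] by (simp add: Fp)
  have "(local_rep (\<lambda>b. H (F b)) c e has_derivative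
     (\<lambda>v. differential H d e (F p) (differential F c d p v))) (at (snd c p))"
  proof (rule has_derivative_transform_within_open[OF 1 chart_open_image[OF c V(1,3)]])
    show "snd c p \<in> snd c ` V" using V by blast
    fix y assume "y \<in> snd c ` V"
    then obtain b where b: "b \<in> V" "y = snd c b" by blast
    then have "b \<in> fst c" "F b \<in> fst d" using V by auto
    then show "local_rep H d e (local_rep F c d y) = local_rep (\<lambda>b. H (F b)) c e y"
      using b chart_inv_image[OF c, of b] chart_inv_image[OF d, of "F b"] by (simp add: local_rep_def)
  qed
  from fun_cong[OF frechet_derivative_at[OF this], of v] show ?thesis by (simp add: differential_def)
qed

lemma smooth_map_local_rep:
  assumes "smooth_atlas A" "smooth_map A B W F" "open W" "c \<in> A" "d \<in> B"
      "\<And>d. d \<in> B \<Longrightarrow> open (fst d)"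
  shows "open (W \<inter> fst c \<inter> F -` fst d)"
      "open (snd c ` (W \<inter> fst c \<inter> F -` fst d))"
    and "smooth_on (snd c ` (W \<inter> fst c \<inter> F -` fst d)) (local_rep F c d)"
    and "p \<in> W \<Longrightarrow> p \<in> fst c \<Longrightarrow> F p \<in> fst d \<Longrightarrow> local_rep F c d differentiable at (snd c p)"
proof -
  have c: "is_chart c" using assms(1,4) by (simp add: smooth_atlas_def)
  have "open (W \<inter> F -` fst d)"
    using assms(2,3,5,6) continuous_open_preimage[of W F "fst d"] by (simp add: smooth_map_def)
  moreover have "open (fst c)" using c by (simp add: is_chart_def)
  ultimately show o: "open (W \<inter> fst c \<inter> F -` fst d)"
      by (metis Int_commute Int_left_commute open_Int)
  then show o': "open (snd c ` (W \<inter> fst c \<inter> F -` fst d))"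
      by (rule chart_open_image[OF c]) auto
  show s: "smooth_on (snd c ` (W \<inter> fst c \<inter> F -` fst d)) (local_rep F c d)"
    using assms(2,4,5) by (simp add: smooth_map_def)
  show "local_rep F c d differentiable at (snd c p)" if "p \<in> W" "p \<in> fst c" "F p \<in> fst d"
    using smooth_on_has_derivative[OF o' s, of "snd c p"] that unfolding differentiable_def by blast
qed

section \<open>Left-invariant vector fields\<close>

text \<open>The left-invariant field whose value at the unit, in the chart \<open>d0\<close>, is \<open>w\<close>.\<close>

definition left_invariant_ext ::
    "'k monoid \<Rightarrow> ('k, 'n::finite) chart \<Rightarrow> real ^ 'n \<Rightarrow> ('k, 'n) chart \<Rightarrow> real ^ 'n \<Rightarrow> real ^ 'n" where
  "left_invariant_ext G d0 w c x =
      differential (\<lambda>b. chart_inv c x \<otimes>\<^bsub>G\<^esub> b) d0 c \<one>\<^bsub>G\<^esub> w"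

locale metric_lie_group =
  fixes G :: "'k::{t2_space,second_countable_topology} monoid"
    and B :: "('k, 'n::finite) chart set" and h :: "('k, 'n) metric" and d0 :: "('k, 'n) chart"
  assumes lie: "lie_group G B" and metric: "left_invariant_metric G B h"
    and d0: "d0 \<in> B" "\<one>\<^bsub>G\<^esub> \<in> fst d0"
begin

abbreviation mult (infixl "\<cdot>" 70) where "a \<cdot> b \<equiv> a \<otimes>\<^bsub>G\<^esub> b"
abbreviation unit ("\<e>") where "\<e> \<equiv> \<one>\<^bsub>G\<^esub>"

lemma group: "Group.group G" "carrier G = UNIV" and atlas: "smooth_atlas B"
  using lie by (auto simp: lie_group_def)

lemma chart: "c \<in> B \<Longrightarrow> is_chart c" "c \<in> B \<Longrightarrow> open (fst c)"
  using atlas by (auto simp: smooth_atlas_def is_chart_def)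

lemma mult_laws: "a \<cdot> (b \<cdot> c) = a \<cdot> b \<cdot> c" "a \<cdot> \<e> = a"
    "\<e> \<cdot> a = a"
proof -
  interpret Group.group G by (rule group)
  show "a \<cdot> (b \<cdot> c) = a \<cdot> b \<cdot> c" "a \<cdot> \<e> = a" "\<e> \<cdot> a = a"
      using group(2) m_assoc by auto
qed

lemma translation: "smooth_map B B UNIV (\<lambda>b. a \<cdot> b)"
  using metric by (simp add: left_invariant_metric_def local_isometry_def diffeomorphism_on_def)

lemma translation_differentiable:
  "c \<in> B \<Longrightarrow> d \<in> B \<Longrightarrow> p \<in> fst c \<Longrightarrow> a \<cdot> p \<in> fst d \<Longrightarrow> local_rep (\<lambda>b. a \<cdot> b) c d differentiable at (snd c p)"
  using smooth_map_local_rep(4)[OF atlas translation open_UNIV _ _ chart(2)] by blast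

lemma metric_on: "c \<in> B \<Longrightarrow> metric_on (chart_image c) (h c)"
  using metric chart by (auto simp: metric_on_def left_invariant_metric_def pseudo_riemannian_metric_def is_chart_def)

lemma open_translation: "c \<in> B \<Longrightarrow> d \<in> B \<Longrightarrow> open (fst c \<inter> (\<lambda>b. a \<cdot> b) -` fst d)"
  using smooth_map_local_rep(1)[OF atlas translation open_UNIV _ _ chart(2)] by simp

lemma left_invariant_ext_transform:
  assumes "c \<in> B" "d \<in> B" "b \<in> fst c" "a \<cdot> b \<in> fst d"
  shows "left_invariant_ext G d0 w d (snd d (a \<cdot> b)) =
      differential (\<lambda>b. a \<cdot> b) c d b (left_invariant_ext G d0 w c (snd c b))"
proof -
  have "differential (\<lambda>p. a \<cdot> (b \<cdot> p)) d0 d \<e> w =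
    differential (\<lambda>p. a \<cdot> p) c d (b \<cdot> \<e>) (differential (\<lambda>p. b \<cdot> p) d0 c \<e> w)"
  proof (rule differential_compose[OF chart(1)[OF d0(1)] chart(1)[OF assms(1)]])
    show "open (fst d0 \<inter> (\<lambda>p. b \<cdot> p) -` fst c)"
        by (rule open_translation[OF d0(1) assms(1)])
  qed (use assms d0 translation_differentiable mult_laws in auto)
  then show ?thesis
    using assms chart_inv_image[OF chart(1)] by (simp add: left_invariant_ext_def mult_laws)
qed

lemma left_invariant_ext_chart_change:
  assumes "c \<in> B" "d \<in> B" "p \<in> fst c \<inter> fst d"
  shows "left_invariant_ext G d0 w d (snd d p) =
      differential id c d p (left_invariant_ext G d0 w c (snd c p))"
  using left_invariant_ext_transform[OF assms(1,2), of p \<e>] assms(3) by (simp add: mult_laws id_def)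

lemma left_invariant_ext_linear: assumes "c \<in> B" "x \<in> chart_image c" shows
    "linear (\<lambda>w. left_invariant_ext G d0 w c x)"
  unfolding left_invariant_ext_def differential_def
  by (rule linear_frechet_derivative, rule translation_differentiable)
    (use assms(1) d0 chart_inv_in[OF assms(2)] in \<open>simp_all add: mult_laws\<close>)

lemma left_invariant_ext_form:
  assumes "c \<in> B" "x \<in> chart_image c"
  shows "form (h c x) (left_invariant_ext G d0 w c x) (left_invariant_ext G d0 z c x) =
      form (h d0 (snd d0 \<e>)) w z"
proof -
  define a where "a = chart_inv c x"
  have a: "a \<in> fst c" "snd c a = x" using chart_inv_in[OF assms(2)] by (simp_all add: a_def)
  have "local_isometry B h B h UNIV (\<lambda>b. a \<cdot> b)" using metric
      by (simp add: left_invariant_metric_def)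
  then have "form (h c (snd c (a \<cdot> \<e>))) (differential (\<lambda>b. a \<cdot> b) d0 c \<e> w) (differential (\<lambda>b. a \<cdot> b) d0 c \<e> z)
    = form (h d0 (snd d0 \<e>)) w z"
    using assms(1) d0 a mult_laws unfolding local_isometry_def by (metis Int_iff UNIV_I)
  then show ?thesis by (simp add: left_invariant_ext_def a_def[symmetric] mult_laws a)
qed

lemma unit_in_chart_image: "snd d0 \<e> \<in> chart_image d0" using d0 by blast

lemma left_invariant_ext_inj: assumes "c \<in> B" "x \<in> chart_image c" shows
    "inj (\<lambda>w. left_invariant_ext G d0 w c x)"
proof -
  have "w = 0" if "left_invariant_ext G d0 w c x = 0" for w
    using form_nondegenerate[OF metric_on_inv[OF metric_on[OF d0(1)] unit_in_chart_image], of w] left_invariant_ext_form[OF assms, of _ w] that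
    by (simp add: form_simps)
  then show ?thesis using left_invariant_ext_linear[OF assms] by (simp add: linear_injective_0)
qed

text \<open>The field is a partial derivative, at the unit, of the group multiplication, which is jointly smooth
  in both factors.\<close>

lemma left_invariant_ext_smooth: assumes c: "c \<in> B" shows
    "smooth_on (chart_image c) (left_invariant_ext G d0 w c)"
proof -
  define y0 where "y0 = snd d0 \<e>"
  define m where "m = (\<lambda>(x, y). snd c (chart_inv c x \<cdot> chart_inv d0 y))"
  define \<Omega> where "\<Omega> =
      {(snd c a, snd d0 b) | a b. a \<in> fst c \<and> b \<in> fst d0 \<and> a \<cdot> b \<in> fst c}"
  have sm: "smooth_on \<Omega> m" unfolding \<Omega>_def m_def using lie c d0(1)
      by (simp add: lie_group_def)
  have co: "open (chart_image c)" "open (chart_image d0)" using chart(1)[OF c] chart(1)[OF d0(1)]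
      by (auto simp: is_chart_def)
  have "\<Omega> = (chart_image c \<times> chart_image d0) \<inter> (\<lambda>z. chart_inv c (fst z) \<cdot> chart_inv d0 (snd z)) -` fst c"
  proof (rule Set.set_eqI)
    fix z :: "(real ^ 'n) \<times> (real ^ 'n)"
    obtain x y where z: "z = (x, y)" by fastforce
    show "z \<in> \<Omega> \<longleftrightarrow> z \<in> (chart_image c \<times> chart_image d0) \<inter> (\<lambda>z. chart_inv c (fst z) \<cdot> chart_inv d0 (snd z)) -` fst c"
    proof
      assume "z \<in> \<Omega>"
      then obtain a b where "x = snd c a" "y = snd d0 b" "a \<in> fst c" "b \<in> fst d0"
          "a \<cdot> b \<in> fst c"
        by (auto simp: \<Omega>_def z)
      then show "z \<in> (chart_image c \<times> chart_image d0) \<inter> (\<lambda>z. chart_inv c (fst z) \<cdot> chart_inv d0 (snd z)) -` fst c"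
        using chart_inv_image[OF chart(1)[OF c], of a] chart_inv_image[OF chart(1)[OF d0(1)], of b]
            by (auto simp: z)
    next
      assume "z \<in> (chart_image c \<times> chart_image d0) \<inter> (\<lambda>z. chart_inv c (fst z) \<cdot> chart_inv d0 (snd z)) -` fst c"
      then have "x \<in> chart_image c" "y \<in> chart_image d0"
          "chart_inv c x \<cdot> chart_inv d0 y \<in> fst c" by (auto simp: z)
      then show "z \<in> \<Omega>" unfolding \<Omega>_def z
          using chart_inv_in[of x c] chart_inv_in[of y d0]
        by (intro CollectI exI[of _ "chart_inv c x"] exI[of _ "chart_inv d0 y"]) auto
    qed
  qed
  moreover have "continuous_on (chart_image c \<times> chart_image d0) (\<lambda>z. chart_inv c (fst z) \<cdot> chart_inv d0 (snd z))"
  proof -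
    have "continuous_on (chart_image c) (chart_inv c)" "continuous_on (chart_image d0) (chart_inv d0)"
      using chart(1)[OF c] chart(1)[OF d0(1)] by (auto simp: is_chart_def homeomorphism_def)
    then have "continuous_on (chart_image c \<times> chart_image d0) (\<lambda>z. (chart_inv c (fst z), chart_inv d0 (snd z)))"
      by (intro continuous_on_Pair continuous_on_compose2[of _ "chart_inv c" _ fst] continuous_on_compose2[of _ "chart_inv d0" _ snd] continuous_intros) auto
    moreover have "continuous_on UNIV (\<lambda>z. fst z \<cdot> snd z)"
      using lie by (simp add: lie_group_def case_prod_beta)
    ultimately show ?thesis using continuous_on_compose2[of UNIV "\<lambda>z. fst z \<cdot> snd z"]
        by fastforce
  qed
  ultimately have o: "open \<Omega>"
    using continuous_open_preimage[OF _ open_Times[OF co] chart(2)[OF c]] by simp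
  have in\<Omega>: "(x, y0) \<in> \<Omega>" if "x \<in> chart_image c" for x
    unfolding \<Omega>_def y0_def using chart_inv_in[OF that] d0(2)
    by (intro CollectI exI[of _ "chart_inv c x"] exI[of _ \<e>]) (simp add: mult_laws)
  have eq: "frechet_derivative m (at (x, y0)) (0, w) = left_invariant_ext G d0 w c x" if x:
      "x \<in> chart_image c" for x
  proof -
    have "((\<lambda>y. (x, y)) has_derivative (\<lambda>v. (0, v))) (at y0)"
        by (auto intro!: derivative_eq_intros)
    from has_derivative_compose[OF this smooth_on_has_derivative[OF o sm in\<Omega>[OF x]]]
    have "(local_rep (\<lambda>b. chart_inv c x \<cdot> b) d0 c
        has_derivative (\<lambda>v. frechet_derivative m (at (x, y0)) (0, v))) (at y0)"
      by (simp add: local_rep_def comp_def m_def)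
    from fun_cong[OF frechet_derivative_at[OF this], of w] show ?thesis
      by (simp add: left_invariant_ext_def differential_def y0_def)
  qed
  have s1: "smooth_on (chart_image c) (\<lambda>x. (x, y0))"
  proof -
    have "smooth_on (chart_image c) (\<lambda>x. (x, 0::real^'n))"
      by (rule smooth_on_bounded_linear[OF co(1) _ smooth_on_ident[OF co(1)]])
        (intro bounded_linear_Pair bounded_linear_ident bounded_linear_zero)
    then have "smooth_on (chart_image c) (\<lambda>x. (x, 0::real^'n) + (0, y0))"
      using co(1) by (simp add: smooth_on_def ck_on_add ck_on_const del: add_Pair)
    then show ?thesis by simp
  qed
  have "smooth_on (chart_image c) (\<lambda>x. frechet_derivative m (at (x, y0)) (0, w))"
    by (rule smooth_on_compose[OF co(1) o _ s1 smooth_on_frechet_derivative[OF o sm]]) (use in\<Omega> in auto)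
  then show ?thesis by (rule smooth_on_cong[OF co(1), rotated]) (rule eq)
qed

lemma left_invariant_ext_smooth_vector_field: "smooth_vector_field B (left_invariant_ext G d0 w)"
  unfolding smooth_vector_field_def using left_invariant_ext_smooth left_invariant_ext_chart_change
      by blast

lemma left_invariant_eq_ext:
  assumes "left_invariant_vector_field G B E" "c \<in> B" "x \<in> chart_image c"
  shows "E c x = left_invariant_ext G d0 (E d0 (snd d0 \<e>)) c x"
proof -
  have "E c (snd c (chart_inv c x \<cdot> \<e>)) =
      differential (\<lambda>b. chart_inv c x \<cdot> b) d0 c \<e> (E d0 (snd d0 \<e>))"
    using assms(1,2) d0 chart_inv_in[OF assms(3)] mult_laws unfolding left_invariant_vector_field_def
        by metis
  then show ?thesis using chart_inv_in[OF assms(3)] by (simp add: mult_laws left_invariant_ext_def)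
qed

definition bracket where
  "bracket w z = lie_bracket (left_invariant_ext G d0 w d0) (left_invariant_ext G d0 z d0) (snd d0 \<e>)"

text \<open>The fields are related to themselves by left translations, hence so are their brackets.\<close>

lemma left_invariant_ext_bracket:
  assumes c: "c \<in> B" and x: "x \<in> chart_image c"
  shows "lie_bracket (left_invariant_ext G d0 w c) (left_invariant_ext G d0 z c) x =
      left_invariant_ext G d0 (bracket w z) c x"
proof -
  define a where "a = chart_inv c x"
  have a: "a \<in> fst c" "snd c a = x" using chart_inv_in[OF x] by (simp_all add: a_def)
  define \<psi> where "\<psi> = local_rep (\<lambda>b. a \<cdot> b) d0 c"
  define U where "U = snd d0 ` (UNIV \<inter> fst d0 \<inter> (\<lambda>b. a \<cdot> b) -` fst c)"
  note sm = smooth_map_local_rep[OF atlas translation[of a] open_UNIV d0(1) c chart(2)]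
  have U: "open U" "smooth_on U \<psi>" "snd d0 \<e> \<in> U"
    using sm(2,3) d0 a by (auto simp: U_def \<psi>_def mult_laws)
  have \<psi>x: "\<psi> (snd d0 \<e>) = x"
    using chart_inv_image[OF chart(1)[OF d0(1)] d0(2)] a
        by (simp add: \<psi>_def local_rep_def mult_laws)
  have rel: "left_invariant_ext G d0 v c (\<psi> y) =
      frechet_derivative \<psi> (at y) (left_invariant_ext G d0 v d0 y)" if "y \<in> U" for v y
  proof -
    obtain b where b: "b \<in> fst d0" "a \<cdot> b \<in> fst c" "y = snd d0 b" using \<open>y \<in> U\<close>
        by (auto simp: U_def)
    then have "\<psi> y = snd c (a \<cdot> b)" using chart_inv_image[OF chart(1)[OF d0(1)], of b]
        by (simp add: \<psi>_def local_rep_def)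
    then show ?thesis using left_invariant_ext_transform[OF d0(1) c b(1,2)] b(3)
        by (simp add: differential_def \<psi>_def)
  qed
  have sub: "U \<subseteq> chart_image d0" by (auto simp: U_def)
  have "lie_bracket (left_invariant_ext G d0 w c) (left_invariant_ext G d0 z c) (\<psi> (snd d0 \<e>)) =
     frechet_derivative \<psi> (at (snd d0 \<e>)) (lie_bracket (left_invariant_ext G d0 w d0) (left_invariant_ext G d0 z d0) (snd d0 \<e>))"
    using chart(1)[OF c] x
    by (intro bracket_related[OF U, of "chart_image c"] smooth_on_subset[OF left_invariant_ext_smooth sub] left_invariant_ext_smooth rel c d0)
      (auto simp: \<psi>x is_chart_def)
  then show ?thesis
    unfolding \<psi>x bracket_def[symmetric]
        by (simp add: left_invariant_ext_def differential_def \<psi>_def a_def)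
qed

lemma left_invariant_ext_constant_frame:
  assumes "c \<in> B"
  shows "constant_frame (chart_image c) (h c) (\<lambda>w. left_invariant_ext G d0 w c) (form (h d0 (snd d0 \<e>))) bracket"
  by (simp add: constant_frame_def left_invariant_ext_smooth left_invariant_ext_linear left_invariant_ext_inj left_invariant_ext_form left_invariant_ext_bracket assms)

end

section \<open>Transfer to the manifold\<close>

lemma (in bilinear_form) levi_civita_product:
  assumes br: "bilinear br" and anti: "\<And>x y. br x y = - br y x"
  shows "\<exists>\<Gamma>. bilinear \<Gamma> \<and> (\<forall>x y z. \<eta> (\<Gamma> x y) z =
      - \<eta> y (\<Gamma> x z)) \<and>
    (\<forall>w z v. \<eta> (\<Gamma> w z) v = (\<eta> (br w z) v - \<eta> (br z v) w + \<eta> (br v w) z) / 2)"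
proof -
  note b = bilinear_ladd[OF br] bilinear_radd[OF br] bilinear_lmul[OF br] bilinear_rmul[OF br]
  have "linear (\<lambda>v. (\<eta> (br w z) v - \<eta> (br z v) w + \<eta> (br v w) z) / 2)" for w z
    by (rule linearI) (simp_all add: b eta_simps field_simps)
  then have "\<exists>u. \<forall>v. \<eta> u v =
      (\<eta> (br w z) v - \<eta> (br z v) w + \<eta> (br v w) z) / 2" for w z
    by (rule functional_representation)
  then obtain \<Gamma> where \<Gamma>: "\<And>w z v. \<eta> (\<Gamma> w z) v =
      (\<eta> (br w z) v - \<eta> (br z v) w + \<eta> (br v w) z) / 2"
    by metis
  have eqI: "u = v" if "\<And>z. \<eta> u z = \<eta> v z" for u v
    using nondeg[of "u - v"] that by (simp add: eta_simps)
  have "bilinear \<Gamma>"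
    unfolding bilinear_def
    by (intro allI conjI linearI eqI) (simp_all add: \<Gamma> b eta_simps field_simps)
  moreover have "\<eta> (\<Gamma> x y) z = - \<eta> y (\<Gamma> x z)" for x y z
  proof -
    have "\<eta> (br y x) z = - \<eta> (br x y) z" "\<eta> (br z x) y = - \<eta> (br x z) y"
        "\<eta> (br z y) x = - \<eta> (br y z) x"
      using anti[of y x] anti[of z x] anti[of z y] by (simp_all add: eta_simps)
    then show ?thesis unfolding sym[of y "\<Gamma> x z"] \<Gamma> by (simp add: field_simps)
  qed
  ultimately show ?thesis using \<Gamma> by blast
qed

text \<open>The Lie bracket of vector fields is bilinear and antisymmetric, and the frame is independent at
  the chosen point.\<close>

lemma constant_frame_bracket:
  assumes fr: "constant_frame U h E \<eta> br" and U: "open U" "x \<in> U"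
  shows "bilinear br" and "br w z = - br z w"
proof -
  have s: "smooth_on U (E w)" and l: "y \<in> U \<Longrightarrow> linear (\<lambda>w. E w y)" and i:
      "inj (\<lambda>w. E w x)"
    and b: "E (br w z) x = lie_bracket (E w) (E z) x" for w z y
    using fr U by (auto simp: constant_frame_def)
  have eqI: "u = v" if "E u x = E v x" for u v using injD[OF i] that by blast
  have add: "frechet_derivative (E (a + b)) (at x) v =
      frechet_derivative (E a) (at x) v + frechet_derivative (E b) (at x) v" for a b v
  proof -
    have "(E (a + b) has_derivative (\<lambda>v. frechet_derivative (E a) (at x) v + frechet_derivative (E b) (at x) v)) (at x)"
      by (rule has_derivative_transform_within_open[OF has_derivative_add[OF
        smooth_on_has_derivative[OF U(1) s U(2)] smooth_on_has_derivative[OF U(1) s U(2)]] U])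
        (simp add: linear_add[OF l])
    from fun_cong[OF frechet_derivative_at[OF this], of v] show ?thesis by simp
  qed
  have scale: "frechet_derivative (E (r *\<^sub>R a)) (at x) v =
      r *\<^sub>R frechet_derivative (E a) (at x) v" for r a v
  proof -
    have "(E (r *\<^sub>R a) has_derivative (\<lambda>v. r *\<^sub>R frechet_derivative (E a) (at x) v)) (at x)"
      by (rule has_derivative_transform_within_open[OF has_derivative_scaleR_right[OF
        smooth_on_has_derivative[OF U(1) s U(2)]] U]) (simp add: linear_cmul[OF l])
    from fun_cong[OF frechet_derivative_at[OF this], of v] show ?thesis by simp
  qed
  have ld: "linear (frechet_derivative (E a) (at x))" for a
    using smooth_on_has_derivative[OF U(1) s U(2)] by (rule has_derivative_linear)
  note lx = linear_add[OF l[OF U(2)]] linear_cmul[OF l[OF U(2)]] linear_neg[OF l[OF U(2)]]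
    linear_add[OF ld] linear_cmul[OF ld] add scale b lie_bracket_def
  show "bilinear br"
    unfolding bilinear_def by (intro allI conjI linearI; rule eqI; simp add: lx algebra_simps)
  show "br w z = - br z w" by (rule eqI) (simp add: lx)
qed

text \<open>The pulled back fields are \<open>D\<psi> E\<close> for the local inverse \<open>\<psi>\<close> of the isometry \<open>\<phi>\<close>. They are related by
  \<open>\<phi>\<close> to the given frame, which transfers the brackets.\<close>

lemma pullback_frame:
  assumes A: "smooth_atlas A" and B: "smooth_atlas B" and iso: "local_isometry A g B h W F"
    and c: "c \<in> A" and d: "d \<in> B" and p: "p \<in> W" "p \<in> fst c" "F p \<in> fst d"
    and fr: "constant_frame (chart_image d) (h d) E \<eta> br"
  shows "\<exists>U E'. open U \<and> snd c p \<in> U \<and> U \<subseteq> chart_image c \<and> constant_frame U (g c) E' \<eta> br"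
proof -
  have W: "open W" "open (F ` W)" "inj_on F W" "smooth_map A B W F"
      "smooth_map B A (F ` W) (inv_into W F)"
    and isom: "\<And>p u v. p \<in> W \<inter> fst c \<Longrightarrow> F p \<in> fst d \<Longrightarrow>
      form (h d (snd d (F p))) (differential F c d p u) (differential F c d p v) = form (g c (snd c p)) u v"
    using iso c d by (auto simp: local_isometry_def diffeomorphism_on_def)
  have ch: "is_chart c" "is_chart d" "\<And>d. d \<in> B \<Longrightarrow> open (fst d)"
      "\<And>c. c \<in> A \<Longrightarrow> open (fst c)"
    using A B c d by (auto simp: smooth_atlas_def is_chart_def)
  define \<phi> where "\<phi> = local_rep F c d"
  define \<psi> where "\<psi> = local_rep (inv_into W F) d c"
  define U where "U = snd c ` (W \<inter> fst c \<inter> F -` fst d)"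
  define V where "V = snd d ` (F ` W \<inter> fst d \<inter> (inv_into W F) -` fst c)"
  have U: "open U" "smooth_on U \<phi>" unfolding U_def \<phi>_def
    using smooth_map_local_rep[OF A W(4) W(1) c d ch(3)] by blast+
  have V: "open V" "smooth_on V \<psi>" unfolding V_def \<psi>_def
    using smooth_map_local_rep[OF B W(5) W(2) d c ch(4)] by blast+
  have pt: "\<phi> (snd c b) = snd d (F b)" "\<psi> (snd d (F b)) = snd c b" "snd d (F b) \<in> V"
      "snd c b \<in> U"
    if "b \<in> W" "b \<in> fst c" "F b \<in> fst d" for b
    using that chart_inv_image[OF ch(1), of b] chart_inv_image[OF ch(2), of "F b"] W(3)
    by (auto simp: \<phi>_def \<psi>_def local_rep_def V_def U_def)
  have Uex: "\<exists>b. b \<in> W \<and> b \<in> fst c \<and> F b \<in> fst d \<and> y = snd c b" if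
      "y \<in> U" for y
    using that by (auto simp: U_def)
  have Vex: "\<exists>b. b \<in> W \<and> b \<in> fst c \<and> F b \<in> fst d \<and> z = snd d (F b)" if
      "z \<in> V" for z
    using that W(3) by (auto simp: V_def)
  have \<phi>V: "\<phi> y \<in> V" and \<psi>\<phi>: "\<psi> (\<phi> y) = y" if "y \<in> U" for y
    using Uex[OF that] pt by auto
  have \<psi>U: "\<psi> z \<in> U" and \<phi>\<psi>: "\<phi> (\<psi> z) = z" if "z \<in> V" for z
    using Vex[OF that] pt by auto
  have sub: "U \<subseteq> chart_image c" "V \<subseteq> chart_image d" by (auto simp: U_def V_def)
  have D\<phi>: "frechet_derivative \<phi> (at y) (frechet_derivative \<psi> (at (\<phi> y)) v) = v" if y:
      "y \<in> U" for y v
  proof -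
    have 1: "((\<lambda>z. \<phi> (\<psi> z))
        has_derivative (\<lambda>v. frechet_derivative \<phi> (at y) (frechet_derivative \<psi> (at (\<phi> y)) v))) (at (\<phi> y))"
      using has_derivative_compose[OF smooth_on_has_derivative[OF V \<phi>V[OF y]], of \<phi>]
        smooth_on_has_derivative[OF U y] \<psi>\<phi>[OF y] by simp
    have "((\<lambda>z. \<phi> (\<psi> z)) has_derivative (\<lambda>v. v)) (at (\<phi> y))"
      by (rule has_derivative_transform_within_open[OF has_derivative_ident V(1) \<phi>V[OF y]]) (simp add: \<phi>\<psi>)
    from fun_cong[OF has_derivative_unique[OF 1 this]] show ?thesis .
  qed
  define E' where "E' w y = frechet_derivative \<psi> (at (\<phi> y)) (E w (\<phi> y))" for w y
  have frE: "smooth_on (chart_image d) (E w)" "z \<in> V \<Longrightarrow> linear (\<lambda>w. E w z)"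
      "z \<in> V \<Longrightarrow> inj (\<lambda>w. E w z)"
    "z \<in> V \<Longrightarrow> form (h d z) (E w z) (E w' z) = \<eta> w w'"
        "z \<in> V \<Longrightarrow> lie_bracket (E w) (E w') z = E (br w w') z" for z w w'
    using fr sub(2) by (auto simp: constant_frame_def)
  have rel: "E w (\<phi> y) = frechet_derivative \<phi> (at y) (E' w y)" if "y \<in> U" for w y
    unfolding E'_def D\<phi>[OF that] ..
  have lin\<psi>: "linear (frechet_derivative \<psi> (at z))" if "z \<in> V" for z
    using smooth_on_has_derivative[OF V that] by (rule has_derivative_linear)
  have smE': "smooth_on U (E' w)" for w
  proof -
    have sE: "smooth_on V (E w)" by (rule smooth_on_subset[OF frE(1) sub(2)])
    have "smooth_on V (\<lambda>z. \<Sum>i\<in>UNIV. E w z $ i *\<^sub>R frechet_derivative \<psi> (at z) (axis i 1))"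
      by (intro smooth_on_sum smooth_on_bilinear[OF V(1) bounded_bilinear_scaleR] V(1)
          smooth_on_bounded_linear[OF V(1) bounded_linear_vec_nth sE] smooth_on_frechet_derivative[OF V])
    then have "smooth_on V (\<lambda>z. frechet_derivative \<psi> (at z) (E w z))"
      by (rule smooth_on_cong[OF V(1), rotated]) (simp add: linear_expand_axis[OF lin\<psi>, symmetric])
    from smooth_on_compose[OF U(1) V(1) _ U(2) this] show ?thesis
      using \<phi>V unfolding E'_def[abs_def] by blast
  qed
  have linE': "linear (\<lambda>w. E' w y)" if "y \<in> U" for y
    unfolding E'_def using linear_compose[OF frE(2)[OF \<phi>V[OF that]] lin\<psi>[OF \<phi>V[OF that]]]
        by (simp add: comp_def)
  have injE': "inj (\<lambda>w. E' w y)" if y: "y \<in> U" for y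
    by (rule injI) (metis rel[OF y] injD[OF frE(3)[OF \<phi>V[OF y]]])
  have formE': "form (g c y) (E' w y) (E' z y) = \<eta> w z" if y: "y \<in> U" for y w z
  proof -
    obtain b where b: "b \<in> W" "b \<in> fst c" "F b \<in> fst d" "y = snd c b" using Uex[OF y]
        by blast
    have "form (h d (\<phi> y)) (frechet_derivative \<phi> (at y) (E' w y)) (frechet_derivative \<phi> (at y) (E' z y)) =
      form (g c y) (E' w y) (E' z y)"
      using isom[of b "E' w y" "E' z y"] b pt(1)[OF b(1,2,3)] by (simp add: differential_def \<phi>_def)
    then show ?thesis by (simp add: rel[OF y, symmetric] frE(4)[OF \<phi>V[OF y]])
  qed
  have brE': "lie_bracket (E' w) (E' z) y = E' (br w z) y" if y: "y \<in> U" for y w z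
  proof -
    have "E (br w z) (\<phi> y) = frechet_derivative \<phi> (at y) (lie_bracket (E' w) (E' z) y)"
      unfolding frE(5)[OF \<phi>V[OF y], symmetric]
      by (rule bracket_related[OF U y V(1) \<phi>V[OF y] smE' smooth_on_subset[OF frE(1) sub(2)] rel
            smE' smooth_on_subset[OF frE(1) sub(2)] rel])
    then have "frechet_derivative \<psi> (at (\<phi> y)) (frechet_derivative \<phi> (at y) (lie_bracket (E' w) (E' z) y)) = E' (br w z) y"
      by (simp add: E'_def)
    moreover have "frechet_derivative \<psi> (at (\<phi> y)) (frechet_derivative \<phi> (at y) v) = v"
        for v
    proof -
      have "inj (frechet_derivative \<psi> (at (\<phi> y)))" by (rule injI) (metis D\<phi>[OF y])
      then have "surj (frechet_derivative \<psi> (at (\<phi> y)))"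
        using lin\<psi>[OF \<phi>V[OF y]] linear_injective_imp_surjective by blast
      then obtain u where "v = frechet_derivative \<psi> (at (\<phi> y)) u" by (metis surjD)
      then show ?thesis using D\<phi>[OF y] by simp
    qed
    ultimately show ?thesis by simp
  qed
  have "constant_frame U (g c) E' \<eta> br"
    by (simp add: constant_frame_def smE' linE' injE' formE' brE')
  then show ?thesis using U(1) sub(1) pt(4)[OF p] by blast
qed

text \<open>The parallel distribution is tested on left-invariant fields only. Their covariant derivatives are
  again left-invariant, with values given by \<open>\<Gamma>\<close>.\<close>

lemma (in metric_lie_group) parallel_left_invariant_span:
  fixes \<Gamma>
  assumes E: "\<And>i. i < r \<Longrightarrow> left_invariant_vector_field G B (E i)"
    and D: "\<And>c x. c \<in> B \<Longrightarrow> x \<in> chart_image c \<Longrightarrow> D c x =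
        Real_Vector_Spaces.span ((\<lambda>i. E i c x) ` {..<r})"
    and par: "parallel_distribution B h D"
    and \<Gamma>: "\<And>w z v. form (h d0 (snd d0 \<e>)) (\<Gamma> w z) v =
        (form (h d0 (snd d0 \<e>)) (bracket w z) v
       - form (h d0 (snd d0 \<e>)) (bracket z v) w + form (h d0 (snd d0 \<e>)) (bracket v w) z) / 2"
    and i: "i < r"
  shows "\<Gamma> w (E i d0 (snd d0 \<e>)) \<in> D d0 (snd d0 \<e>)"
proof -
  define x0 where "x0 = snd d0 \<e>"
  have x0: "x0 \<in> chart_image d0" unfolding x0_def by (rule unit_in_chart_image)
  have o: "open (chart_image d0)" using chart(1)[OF d0(1)] by (simp add: is_chart_def)
  define L where "L w = left_invariant_ext G d0 w d0 x0" for w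
  have L: "linear L" "inj L" unfolding L_def
      using left_invariant_ext_linear[OF d0(1) x0] left_invariant_ext_inj[OF d0(1) x0] by simp_all
  have LE: "L (E j d0 x0) = E j d0 x0" if "j < r" for j
    using left_invariant_eq_ext[OF E[OF that] d0(1) x0] by (simp add: L_def x0_def)
  have "covariant_derivative (h d0) (left_invariant_ext G d0 w d0) (E i d0) x0 \<in> D d0 x0"
  proof -
    have "smooth_vector_field B (E i)" using E[OF i] by (simp add: left_invariant_vector_field_def)
    moreover have "\<forall>c\<in>B. \<forall>x\<in>chart_image c. E i c x \<in> D c x" using D i
        by (auto intro: span_base)
    ultimately show ?thesis
      using par left_invariant_ext_smooth_vector_field[of w] d0(1) x0 unfolding parallel_distribution_def
          by blast
  qed
  also have "covariant_derivative (h d0) (left_invariant_ext G d0 w d0) (E i d0) x0 =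
      covariant_derivative (h d0) (left_invariant_ext G d0 w d0) (left_invariant_ext G d0 (E i d0 x0) d0) x0"
    by (rule covariant_derivative_cong[OF o x0 _ left_invariant_ext_smooth[OF d0(1)] refl])
      (simp add: left_invariant_eq_ext[OF E[OF i] d0(1)] x0_def)
  also have "\<dots> = L (\<Gamma> w (E i d0 x0))"
    unfolding L_def by (rule frame_connection[OF metric_on[OF d0(1)] left_invariant_ext_constant_frame[OF d0(1)] \<Gamma> x0])
  also have "D d0 x0 = L ` D d0 x0"
  proof -
    have "(\<lambda>i. E i d0 x0) ` {..<r} = L ` ((\<lambda>i. E i d0 x0) ` {..<r})" using LE by force
    then show ?thesis unfolding D[OF d0(1) x0] using linear_span_image[OF L(1)] by metis
  qed
  finally show ?thesis unfolding x0_def[symmetric] using L(2) by (auto dest: injD)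
qed

lemma independent_pair:
  fixes w1 w2 :: "real ^ 'n::finite"
  assumes "Real_Vector_Spaces.dim (Real_Vector_Spaces.span {w1, w2}) = 2"
      "a *\<^sub>R w1 + b *\<^sub>R w2 = 0"
  shows "a = 0 \<and> b = 0"
proof (rule ccontr)
  have le1: "Real_Vector_Spaces.dim {w} \<le> 1" for w :: "real ^ 'n" using dim_le_card'[of "{w}"]
      by simp
  assume "\<not> (a = 0 \<and> b = 0)"
  then consider "a \<noteq> 0" | "b \<noteq> 0" by blast
  then show False
  proof cases
    case 1
    have "a *\<^sub>R w1 = - (b *\<^sub>R w2)" using assms(2) by (simp add: add_eq_0_iff2)
    then have "w1 = (- (b / a)) *\<^sub>R w2"
      using 1 by (metis (no_types) divide_inverse mult.commute scaleR_minus_left scaleR_one scaleR_scaleR left_inverse scaleR_minus_right)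
    then have "Real_Vector_Spaces.span {w1, w2} = Real_Vector_Spaces.span {w2}"
      by (metis span_redundant span_base span_scale insertI1)
    then show False using assms(1) le1[of w2] by simp
  next
    case 2
    have "b *\<^sub>R w2 = - (a *\<^sub>R w1)" using assms(2) by (simp add: add_eq_0_iff)
    then have "w2 = (- (a / b)) *\<^sub>R w1"
      using 2 by (metis (no_types) divide_inverse mult.commute scaleR_minus_left scaleR_one scaleR_scaleR left_inverse scaleR_minus_right)
    then have "Real_Vector_Spaces.span {w1, w2} = Real_Vector_Spaces.span {w1}"
      by (metis span_redundant span_base span_scale insertI1 insert_commute)
    then show False using assms(1) le1[of w1] by simp
  qed
qed

section \<open>Absence of left-invariant Walker structures\<close>

theorem theorem3p3:
  fixes A :: "('m::{t2_space,second_countable_topology}, 4) chart set"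
    and g :: "('m, 4) metric"
    and q :: nat
    and G :: "'k::{t2_space,second_countable_topology} monoid"
    and B :: "('k, 4) chart set"
    and h :: "('k, 4) metric"
  assumes "smooth_atlas A"
    and "pseudo_riemannian_metric A g"
    and "metric_index A g q" and "q = 1 \<or> q = 2"
    and "locally_homogeneous A g"
    and "conformally_flat A g"
    and "nondegenerate_ricci_operator A g"
  shows "\<not> admits_left_invariant_walker_structure A g G B h"
proof
  assume walker: "admits_left_invariant_walker_structure A g G B h"
  have lie: "lie_group G B" "left_invariant_metric G B h" and isometric: "locally_isometric A g B h"
    using walker by (auto simp: admits_left_invariant_walker_structure_def)
  obtain D where D: "left_invariant_walker_structure G B h D"
    using walker by (auto simp: admits_left_invariant_walker_structure_def)
  have B: "smooth_atlas B" using lie(1) by (simp add: lie_group_def)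
  obtain d0 where d0: "d0 \<in> B" "\<one>\<^bsub>G\<^esub> \<in> fst d0" using B unfolding smooth_atlas_def
      by blast
  interpret L: metric_lie_group G B h d0
    by unfold_locales (use lie d0 in auto)
  define x0 where "x0 = snd d0 \<one>\<^bsub>G\<^esub>"
  have x0: "x0 \<in> chart_image d0" unfolding x0_def by (rule L.unit_in_chart_image)
  define \<eta> where "\<eta> = form (h d0 x0)"
  interpret bilinear_form \<eta>
  proof
    show "bilinear \<eta>" unfolding \<eta>_def by (rule form_bilinear)
    show "\<eta> u v = \<eta> v u" for u v unfolding \<eta>_def
        by (rule metric_on_sym[OF L.metric_on[OF d0(1)] x0])
    then show "u = 0" if "\<And>v. \<eta> u v = 0" for u
      using form_nondegenerate[OF metric_on_inv[OF L.metric_on[OF d0(1)] x0], of u] that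
          by (simp add: \<eta>_def)
  qed
  have frame: "constant_frame (chart_image c) (h c) (\<lambda>w. left_invariant_ext G d0 w c) \<eta> L.bracket" if "c \<in> B" for c
    unfolding \<eta>_def x0_def by (rule L.left_invariant_ext_constant_frame[OF that])
  note br = constant_frame_bracket[OF frame[OF d0(1)] metric_on_open[OF L.metric_on[OF d0(1)]] x0]
  obtain \<Gamma> where \<Gamma>: "bilinear \<Gamma>" "\<And>x y z. \<eta> (\<Gamma> x y) z =
      - \<eta> y (\<Gamma> x z)"
    "\<And>w z v. \<eta> (\<Gamma> w z) v =
        (\<eta> (L.bracket w z) v - \<eta> (L.bracket z v) w + \<eta> (L.bracket v w) z) / 2"
    using levi_civita_product[OF br] by blast

  \<comment> \<open>The frame of the group is transported to a neighbourhood of an arbitrary point of the manifold.\<close>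
  obtain p :: 'm where True by blast
  obtain W F where p: "p \<in> W" and iso: "local_isometry A g B h W F"
    using isometric unfolding locally_isometric_def by blast
  obtain c where c: "c \<in> A" "p \<in> fst c" using assms(1) unfolding smooth_atlas_def by blast
  obtain d where d: "d \<in> B" "F p \<in> fst d" using B unfolding smooth_atlas_def by blast
  define x where "x = snd c p"
  have x: "x \<in> chart_image c" using c by (auto simp: x_def)
  obtain U E where U: "open U" "x \<in> U" "U \<subseteq> chart_image c" and E:
      "constant_frame U (g c) E \<eta> L.bracket"
    using pullback_frame[OF assms(1) B iso c(1) d(1) p c(2) d(2) frame[OF d(1)]] unfolding x_def by blast
  have gm: "metric_on V (g c)" if "open V" "V \<subseteq> chart_image c" for V
    using assms(2) c(1) that unfolding metric_on_def pseudo_riemannian_metric_def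
    by (auto intro: smooth_on_subset)
  obtain N f where N: "open N" "x \<in> N" "N \<subseteq> chart_image c" "smooth_on N f"
      "\<And>y. y \<in> N \<Longrightarrow> f y > (0::real)"
    "\<And>y u v w. y \<in> N \<Longrightarrow> curvature_at (\<lambda>z. f z *\<^sub>R g c z) y u v w = 0"
    using assms(6) c(1) x unfolding conformally_flat_def by meson
  obtain S where S: "linear S" "\<And>u v. form (g c x) (S u) v = form (g c x) u (S v)"
    and curvS: "\<And>u v w. curvature_at (g c) x u v w =
        form (g c x) v w *\<^sub>R S u - form (g c x) u w *\<^sub>R S v
       + form (g c x) (S v) w *\<^sub>R u - form (g c x) (S u) w *\<^sub>R v"
    using conformally_flat_curvature[OF gm[OF N(1,3)] N(4,5,2) N(6)[OF N(2)]] by blast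
  define \<theta> where "\<theta> w = E w x" for w
  have \<theta>: "linear \<theta>" "inj \<theta>" "\<And>u v. form (g c x) (\<theta> u) (\<theta> v) =
      \<eta> u v"
    using E U(2) unfolding \<theta>_def constant_frame_def by auto
  then have "surj \<theta>" using linear_injective_imp_surjective by blast
  then have inv: "\<theta> (inv_into UNIV \<theta> v) = v" for v by (rule surj_f_inv_f)
  \<comment> \<open>The Schouten operator at \<open>p\<close>, moved to the Lie algebra by the frame.\<close>
  define T where "T u = inv_into UNIV \<theta> (S (\<theta> u))" for u
  have \<theta>T: "\<theta> (T u) = S (\<theta> u)" for u by (simp add: T_def inv)
  note th = linear_add[OF \<theta>(1)] linear_diff[OF \<theta>(1)] linear_cmul[OF \<theta>(1)]
  have inj: "u = v" if "\<theta> u = \<theta> v" for u v using injD[OF \<theta>(2) that] .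
  have linT: "linear T"
      by (rule linearI; rule inj) (simp_all add: \<theta>T th linear_add[OF S(1)] linear_cmul[OF S(1)])
  have saT: "\<eta> (T u) v = \<eta> u (T v)" for u v
      using S(2)[of "\<theta> u" "\<theta> v"] by (simp add: \<theta>(3)[symmetric] \<theta>T)
  have curvT: "\<Gamma> u (\<Gamma> v w) - \<Gamma> v (\<Gamma> u w) - \<Gamma> (\<Gamma> u v - \<Gamma> v u) w =
      \<eta> v w *\<^sub>R T u - \<eta> u w *\<^sub>R T v + \<eta> (T v) w *\<^sub>R u - \<eta> (T u) w *\<^sub>R v" for u v w
    proof (rule inj)
      have "\<theta> (\<Gamma> u (\<Gamma> v w) - \<Gamma> v (\<Gamma> u w) - \<Gamma> (\<Gamma> u v - \<Gamma> v u) w) = curvature_at (g c) x (\<theta> u) (\<theta> v) (\<theta> w)"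
        unfolding \<theta>_def by (rule frame_curvature[OF gm[OF U(1,3)] E \<Gamma>(3) U(2), symmetric])
      also have "\<dots> = \<theta> (\<eta> v w *\<^sub>R T u - \<eta> u w *\<^sub>R T v + \<eta> (T v) w *\<^sub>R u - \<eta> (T u) w *\<^sub>R v)"
        unfolding curvS by (simp add: th \<theta>T \<theta>(3)[symmetric])
      finally show "\<theta> (\<Gamma> u (\<Gamma> v w) - \<Gamma> v (\<Gamma> u w) - \<Gamma> (\<Gamma> u v - \<Gamma> v u) w) =
         \<theta> (\<eta> v w *\<^sub>R T u - \<eta> u w *\<^sub>R T v + \<eta> (T v) w *\<^sub>R u - \<eta> (T u) w *\<^sub>R v)" .
    qed
  interpret conformally_flat_lie_algebra \<eta> \<Gamma> T
    by (rule conformally_flat_lie_algebra.intro[OF bilinear_form_axioms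
          conformally_flat_lie_algebra_axioms.intro[OF \<Gamma>(1,2) linT saT curvT]])

  \<comment> \<open>At the unit, the distribution becomes a null subspace that is invariant under \<open>\<Gamma>\<close>.\<close>
  have "left_invariant_distribution G B 1 D \<or> left_invariant_distribution G B 2 D"
    using D by (simp add: left_invariant_walker_structure_def)
  then obtain r :: nat where r: "r = 1 \<or> r = 2" and "left_invariant_distribution G B r D" by metis
  then obtain E' where E'D: "(\<forall>i<r. left_invariant_vector_field G B (E' i)) \<and>
        (\<forall>c\<in>B. \<forall>x\<in>chart_image c. D c x = Real_Vector_Spaces.span ((\<lambda>i. E' i c x) ` {..<r})
          \<and> Real_Vector_Spaces.dim (D c x) = r)"
    unfolding left_invariant_distribution_def by (elim exE)
  then have E': "\<And>i. i < r \<Longrightarrow> left_invariant_vector_field G B (E' i)"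
    and D': "\<And>c x. c \<in> B \<Longrightarrow> x \<in> chart_image c \<Longrightarrow> D c x =
        Real_Vector_Spaces.span ((\<lambda>i. E' i c x) ` {..<r})"
      "\<And>c x. c \<in> B \<Longrightarrow> x \<in> chart_image c \<Longrightarrow> Real_Vector_Spaces.dim (D c x) = r"
    by blast+
  have null: "\<eta> u v = 0" if "u \<in> D d0 x0" "v \<in> D d0 x0" for u v
    using D d0(1) x0 that unfolding left_invariant_walker_structure_def null_distribution_def \<eta>_def
        by blast
  have par: "\<Gamma> w (E' i d0 x0) \<in> D d0 x0" if "i < r" for i w
    unfolding x0_def
    by (rule L.parallel_left_invariant_span[OF E' D'(1) _ \<Gamma>(3)[unfolded \<eta>_def x0_def] that])
      (use D in \<open>auto simp: left_invariant_walker_structure_def\<close>)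
  note Dx0 = D'[OF d0(1) x0]
  have w: "E' i d0 x0 \<in> D d0 x0" if "i < r" for i
    unfolding Dx0(1) using that by (auto intro: span_base)
  have "derogatory T"
    using r
  proof
    assume r: "r = 1"
    have D1: "D d0 x0 = Real_Vector_Spaces.span {E' 0 d0 x0}"
      unfolding Dx0(1) r by (simp add: lessThan_Suc)
    have "E' 0 d0 x0 \<noteq> 0"
      using Dx0(2) unfolding D1 r by auto
    moreover have "\<exists>k. \<Gamma> w (E' 0 d0 x0) = k *\<^sub>R E' 0 d0 x0" for w
      using par[of 0 w] unfolding D1 by (auto simp: r span_singleton)
    ultimately show ?thesis
      using parallel_null_line_derogatory null[OF w w, of 0 0] r by simp
  next
    assume r: "r = 2"
    have "{..<2::nat} = {0, 1}" by auto
    then have D2: "D d0 x0 = Real_Vector_Spaces.span {E' 0 d0 x0, E' 1 d0 x0}"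
      unfolding Dx0(1) r by simp
    show ?thesis
    proof (rule parallel_null_plane_derogatory)
      show "a = 0 \<and> b = 0" if "a *\<^sub>R E' 0 d0 x0 + b *\<^sub>R E' 1 d0 x0 = 0" for a b
        using independent_pair[OF _ that] Dx0(2) unfolding D2 r by simp
    qed (use null w par r in auto)
  qed
  then have "derogatory S" by (rule derogatory_conjugate[OF _ \<theta>(1,2)]) (simp add: \<theta>T)
  obtain e where e: "pseudo_orthonormal_basis (g c x) e"
    using assms(3) c(1) x unfolding metric_index_def by blast
  have gx: "transpose (g c x) = g c x" "invertible (g c x)"
    using assms(2) c(1) x unfolding pseudo_riemannian_metric_def by blast+
  obtain t where "\<And>u. ricci_operator (g c) x *v u = 2 *\<^sub>R S u + t *\<^sub>R u"
    using ricci_operator_schouten[OF gx e S curvS] by auto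
  then have "(*v) (ricci_operator (g c) x) = (\<lambda>u. 2 *\<^sub>R S u + t *\<^sub>R u)" by auto
  then have "derogatory ((*v) (ricci_operator (g c) x))"
    using derogatory_affine[OF \<open>derogatory S\<close>, of 2 t] by simp
  moreover have "nondegenerate_operator (ricci_operator (g c) x)"
    using assms(7) c(1) x unfolding nondegenerate_ricci_operator_def by blast
  ultimately show False using nondegenerate_not_derogatory by blast
qed

end
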